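(* Let $V$ be a vertex operator superalgebra, $k$ a positive integer, $(M,Y_M)$ a weak $V$-module, and for $u\in V$ set $\bar Y(u,x)=Y_M(\Delta_k(x)u,x^{1/k})$. For $u,v\in V$ of homogeneous sign, the supercommutator $[\bar Y(u,x_1),\bar Y(v,x_2)]=\bar Y(u,x_1)\bar Y(v,x_2)-(-1)^{|u||v|}\bar Y(v,x_2)\bar Y(u,x_1)$ is given by $$[\bar Y(u,x_1),\bar Y(v,x_2)]=\mathrm{Res}_{x_0}\frac{x_2^{-1}}{k}\,\delta\!\left(\frac{(x_1-x_0)^{1/k}}{x_2^{1/k}}\right)\bar Y(Y(u,x_0)v,x_2)\left(\frac{x_1-x_0}{x_2}\right)^{\frac{|u|}{2k}(1-k)},$$ or equivalently: if $k$ is odd, $$[\bar Y(u,x_1),\bar Y(v,x_2)]=\mathrm{Res}_{x_0}\frac{x_2^{-1}}{k}\,\delta\!\left(\frac{(x_1-x_0)^{1/k}}{x_2^{1/k}}\right)\bar Y(Y(u,x_0)v,x_2),$$ and if $k$ is even, $$[\bar Y(u,x_1),\bar Y(v,x_2)]=\mathrm{Res}_{x_0}\frac{x_2^{-1}}{k}\,\delta\!\left(\frac{(x_1-x_0)^{1/k}}{x_2^{1/k}}\right)\bar Y(Y(u,x_0)v,x_2)\left(\frac{x_1-x_0}{x_2}\right)^{\frac{|u|}{2k}}.$$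
   Context: Conventions: $\delta(x)=\sum_{n\in\mathbb{Z}}x^n$; expressions $(x_1-x_2)^n$, $n\in\mathbb{C}$, are expanded in nonnegative integral powers of the second variable; $\mathrm{Res}_{x_0}$ is the coefficient of $x_0^{-1}$. In exponents $|u|\in\{0,1\}$. Vertex operator superalgebra $(V,Y,\mathbf 1,\omega)$: a $\mathbb{Z}_2$-graded vector space $V=V^{(0)}\oplus V^{(1)}$ over $\mathbb{C}$ ($|v|=j$ for $v\in V^{(j)}$) with a linear map $v\mapsto Y(v,x)=\sum_{n\in\mathbb{Z}}v_nx^{-n-1}\in(\mathrm{End}\,V)[[x,x^{-1}]]$, $v_n\in(\mathrm{End}\,V)^{(|v|)}$, and $\mathbf 1\in V^{(0)}$, such that $u_nv=0$ for $n$ large; $Y(\mathbf 1,x)=\mathrm{Id}_V$; $Y(v,x)\mathbf 1\in V[[x]]$ with constant term $v$; the Jacobi identity $x_0^{-1}\delta(\frac{x_1-x_2}{x_0})Y(u,x_1)Y(v,x_2)-(-1)^{|u||v|}x_0^{-1}\delta(\frac{x_2-x_1}{-x_0})Y(v,x_2)Y(u,x_1)=x_2^{-1}\delta(\frac{x_1-x_0}{x_2})Y(Y(u,x_0)v,x_2)$ for $u,v$ of homogeneous sign; and $\omega\in V_2$ whose modes $L(n)=\omega_{n+1}$ satisfy the Virasoro relations with central charge $c\in\mathbb{C}$, $\frac{d}{dx}Y(v,x)=Y(L(-1)v,x)$, $V=\coprod_{n\in\frac12\mathbb{Z}}V_n$ with $L(0)v=nv$ for $v\in V_n$, $\dim V_n<\infty$,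 $V_n=0$ for $n$ sufficiently negative, and $V^{(j)}=\coprod_{n\in\mathbb{Z}+j/2}V_n$. A weak $V$-module is a $\mathbb{Z}_2$-graded space $M$ with a linear map $v\mapsto Y_M(v,x)=\sum_{n\in\mathbb{Z}}v_nx^{-n-1}\in(\mathrm{End}\,M)[[x,x^{-1}]]$, $v_n\in(\mathrm{End}\,M)^{(|v|)}$, with $v_nw=0$ for $n$ large, $Y_M(\mathbf 1,x)=1$, and the Jacobi identity $x_0^{-1}\delta(\frac{x_1-x_2}{x_0})Y_M(u,x_1)Y_M(v,x_2)-(-1)^{|u||v|}x_0^{-1}\delta(\frac{x_2-x_1}{-x_0})Y_M(v,x_2)Y_M(u,x_1)=x_2^{-1}\delta(\frac{x_1-x_0}{x_2})Y_M(Y(u,x_0)v,x_2)$. The operator $\Delta_k$: let $a_j\in\mathbb{C}$, $j\ge1$, be the unique numbers with $\exp\big(-\sum_{j\ge1}a_jx^{j+1}\frac{\partial}{\partial x}\big)\cdot x=\frac1k(1+x)^k-\frac1k$. Fix a square root $k^{1/2}$. On $V$, $\Delta_k(x)=\exp\big(\sum_{j\ge1}a_jx^{-j/k}L(j)\big)(k^{1/2})^{-2L(0)}(x^{1/2k})^{(1-k)2L(0)}$, where $(t^{1/2})^{n2L(0)}v=t^{np}v$ for $v\in V_p$. Thus $\bar Y(u,x)$ is a formal series in $x^{\pm1/k}$ if $k$ is odd, and in $x^{|u|/2k}$ times such series if $k$ is even. *)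

theory Defs
  imports
    Complex_Main
    "HOL-Library.Groups_Big_Fun"
    "HOL-Library.Product_Plus"
    "HOL-Computational_Algebra.Formal_Power_Series"
begin

section \<open>Formal calculus\<close>

text \<open>
  A formal series with coefficients in \<open>'a\<close> is the function sending an exponent to its
  coefficient; supports are unrestricted. Exponents are complex numbers for one variable, pairs for
  \<open>(x\<^sub>1, x\<^sub>2)\<close>, and triples for \<open>(x\<^sub>0, x\<^sub>1, x\<^sub>2)\<close>, in this order.
  An operator-valued series is represented by its values on each vector.
  The function \<^const>\<open>Sum_any\<close> returns the sum over the support if that is finite (and \<open>0\<close>
  otherwise). For every series and product of series used below, the sum for each coefficient is
  finite, because \<open>u\<^sub>n w = 0\<close> for large \<open>n\<close> and weights are bounded below.
\<close>

text \<open>The series \<open>\<Sum>i. f i x\<^bsup>g i\<^esup>\<close>.\<close>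

definition fseries :: "('i \<Rightarrow> 'e) \<Rightarrow> ('i \<Rightarrow> 'a::comm_monoid_add) \<Rightarrow> 'e \<Rightarrow> 'a" where
  "fseries g f = (\<lambda>e. Sum_any (\<lambda>i. if g i = e then f i else 0))"

definition fmonom :: "complex \<Rightarrow> 'e \<Rightarrow> 'e \<Rightarrow> complex" where
  "fmonom c e0 = (\<lambda>e. if e = e0 then c else 0)"

definition fscale :: "(complex \<Rightarrow> 'a \<Rightarrow> 'a) \<Rightarrow> ('e::ab_group_add \<Rightarrow> complex) \<Rightarrow> ('e \<Rightarrow> 'a)
    \<Rightarrow> 'e \<Rightarrow> 'a::ab_group_add" where
  "fscale sc A B = (\<lambda>e. Sum_any (\<lambda>d. sc (A d) (B (e - d))))"

abbreviation ftimes :: "('e::ab_group_add \<Rightarrow> complex) \<Rightarrow> ('e \<Rightarrow> complex) \<Rightarrow> 'e \<Rightarrow> complex"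
    (infixl "\<star>" 70) where
  "A \<star> B \<equiv> fscale (*) A B"

type_synonym exp3 = "complex \<times> complex \<times> complex"

definition X0 :: "complex \<Rightarrow> exp3" where "X0 r = (r, 0, 0)"
definition X1 :: "complex \<Rightarrow> exp3" where "X1 r = (0, r, 0)"
definition X2 :: "complex \<Rightarrow> exp3" where "X2 r = (0, 0, r)"

text \<open>\<open>(y - z)\<^bsup>r\<^esup>\<close>, expanded in nonnegative integral powers of the second variable \<open>z\<close>.\<close>

definition diff_pow :: "(complex \<Rightarrow> exp3) \<Rightarrow> (complex \<Rightarrow> exp3) \<Rightarrow> complex \<Rightarrow> exp3 \<Rightarrow> complex" where
  "diff_pow y z r =
     fseries (\<lambda>i::nat. y (r - of_nat i) + z (of_nat i)) (\<lambda>i. (r gchoose i) * (-1) ^ i)"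

text \<open>\<open>\<delta>(f)\<close>, where \<open>P n\<close> is the \<open>n\<close>-th power of the expression \<open>f\<close>.\<close>

definition fdelta :: "(int \<Rightarrow> exp3 \<Rightarrow> complex) \<Rightarrow> exp3 \<Rightarrow> complex" where
  "fdelta P = (\<lambda>e. Sum_any (\<lambda>n. P n e))"

definition Res0 :: "(exp3 \<Rightarrow> 'a) \<Rightarrow> complex \<times> complex \<Rightarrow> 'a" where
  "Res0 F = (\<lambda>(b, c). F (-1, b, c))"

text \<open>For \<open>Y u n = u\<^sub>n\<close>, the series \<open>vertex_field Y u\<close> is \<open>Y(u, x) = \<Sum>n. u\<^sub>n x\<^bsup>-n-1\<^esup>\<close>:
  \<open>vertex_field Y u e w\<close> is the coefficient of \<open>x\<^bsup>e\<^esup>\<close> in \<open>Y(u, x) w\<close>.\<close>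

definition vertex_field :: "('v \<Rightarrow> int \<Rightarrow> 'w \<Rightarrow> 'w::comm_monoid_add) \<Rightarrow> 'v \<Rightarrow> complex \<Rightarrow> 'w \<Rightarrow> 'w" where
  "vertex_field Y u e w = fseries (\<lambda>n. - of_int n - 1) (\<lambda>n. Y u n w) e"

text \<open>For series \<open>F(u, x)\<close> of operators: \<open>F(u, x\<^sub>1) F(v, x\<^sub>2) w\<close>, \<open>F(v, x\<^sub>2) F(u, x\<^sub>1) w\<close>
  and \<open>F(Y(u, x\<^sub>0) v, x\<^sub>2) w\<close>.\<close>

definition prod12 :: "('v \<Rightarrow> complex \<Rightarrow> 'w \<Rightarrow> 'w::zero) \<Rightarrow> 'v \<Rightarrow> 'v \<Rightarrow> 'w \<Rightarrow> exp3 \<Rightarrow> 'w" where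
  "prod12 F u v w = (\<lambda>(a, b, c). if a = 0 then F u b (F v c w) else 0)"

definition prod21 :: "('v \<Rightarrow> complex \<Rightarrow> 'w \<Rightarrow> 'w::zero) \<Rightarrow> 'v \<Rightarrow> 'v \<Rightarrow> 'w \<Rightarrow> exp3 \<Rightarrow> 'w" where
  "prod21 F u v w = (\<lambda>(a, b, c). if a = 0 then F v c (F u b w) else 0)"

definition iterate02 :: "('v \<Rightarrow> complex \<Rightarrow> 'w \<Rightarrow> 'w::zero) \<Rightarrow> ('v \<Rightarrow> int \<Rightarrow> 'v \<Rightarrow> 'v::comm_monoid_add)
    \<Rightarrow> 'v \<Rightarrow> 'v \<Rightarrow> 'w \<Rightarrow> exp3 \<Rightarrow> 'w" where
  "iterate02 F Y u v w = (\<lambda>(a, b, c). if b = 0 then F (vertex_field Y u a v) c w else 0)"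

text \<open>The Jacobi identity for \<open>u, v\<close> of parities \<open>p, q\<close>, applied to \<open>w\<close>.\<close>

definition jacobi :: "(complex \<Rightarrow> 'w \<Rightarrow> 'w::ab_group_add) \<Rightarrow> ('v \<Rightarrow> int \<Rightarrow> 'v \<Rightarrow> 'v::comm_monoid_add)
    \<Rightarrow> ('v \<Rightarrow> int \<Rightarrow> 'w \<Rightarrow> 'w) \<Rightarrow> nat \<Rightarrow> nat \<Rightarrow> 'v \<Rightarrow> 'v \<Rightarrow> 'w \<Rightarrow> bool" where
  "jacobi sM Y YM p q u v w \<longleftrightarrow>
    (\<forall>e.
      fscale sM
        (fmonom 1 (X0 (-1)) \<star>
          fdelta (\<lambda>n. diff_pow X1 X2 (of_int n) \<star> fmonom 1 (X0 (- of_int n))))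
        (prod12 (vertex_field YM) u v w) e
      - sM ((-1) ^ (p * q)) (fscale sM
        (fmonom 1 (X0 (-1)) \<star>
          fdelta (\<lambda>n. diff_pow X2 X1 (of_int n) \<star> fmonom ((-1) powi (- n)) (X0 (- of_int n))))
        (prod21 (vertex_field YM) u v w) e)
      = fscale sM
        (fmonom 1 (X2 (-1)) \<star>
          fdelta (\<lambda>n. diff_pow X1 X0 (of_int n) \<star> fmonom 1 (X2 (- of_int n))))
        (iterate02 (vertex_field YM) Y u v w) e)"


section \<open>Vertex operator superalgebras and weak modules\<close>

definition internal_direct_sum :: "(complex \<Rightarrow> 'a \<Rightarrow> 'a::ab_group_add) \<Rightarrow> 'i set \<Rightarrow> ('i \<Rightarrow> 'a set)
    \<Rightarrow> 'a set \<Rightarrow> bool" where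
  "internal_direct_sum sc I W U \<longleftrightarrow>
     (\<forall>i\<in>I. module.subspace sc (W i)) \<and>
     U = {\<Sum>i\<in>F. f i | F f. finite F \<and> F \<subseteq> I \<and> (\<forall>i\<in>F. f i \<in> W i)} \<and>
     (\<forall>F f. finite F \<and> F \<subseteq> I \<and> (\<forall>i\<in>F. f i \<in> W i) \<and> (\<Sum>i\<in>F. f i) = 0
        \<longrightarrow> (\<forall>i\<in>F. f i = 0))"

locale super_space = vector_space scale
  for scale :: "complex \<Rightarrow> 'a \<Rightarrow> 'a::ab_group_add" +
  fixes par :: "nat \<Rightarrow> 'a set"
  assumes par_direct_sum: "internal_direct_sum scale {0, 1} par UNIV"

text \<open>Here \<open>Y u n = u\<^sub>n\<close>, and the weights are doubled: \<open>G m\<close> is the weight space \<open>V\<^bsub>m/2\<^esub>\<close>.\<close>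

locale vertex_operator_superalgebra = super_space sV P
  for sV :: "complex \<Rightarrow> 'v \<Rightarrow> 'v::ab_group_add" and P :: "nat \<Rightarrow> 'v set" +
  fixes Y :: "'v \<Rightarrow> int \<Rightarrow> 'v \<Rightarrow> 'v"
    and vac :: 'v
    and \<omega> :: 'v
    and c :: complex
    and G :: "int \<Rightarrow> 'v set"
  assumes Y_linear_left: "\<And>n w. Vector_Spaces.linear sV sV (\<lambda>u. Y u n w)"
    and Y_linear_right: "\<And>u n. Vector_Spaces.linear sV sV (Y u n)"
    and Y_parity: "\<And>p q u v n. \<lbrakk>p \<in> {0, 1}; q \<in> {0, 1}; u \<in> P p; v \<in> P q\<rbrakk>
                     \<Longrightarrow> Y u n v \<in> P ((p + q) mod 2)"
    and vac_even: "vac \<in> P 0"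
    and truncation: "\<And>u v. \<exists>N. \<forall>n\<ge>N. Y u n v = 0"
    and vacuum: "\<And>n v. Y vac n v = (if n = -1 then v else 0)"
    and creation: "\<And>v n. n \<ge> 0 \<Longrightarrow> Y v n vac = 0" "\<And>v. Y v (-1) vac = v"
    and jacobi_identity: "\<And>p q u v w. \<lbrakk>p \<in> {0, 1}; q \<in> {0, 1}; u \<in> P p; v \<in> P q\<rbrakk>
                     \<Longrightarrow> jacobi sV Y Y p q u v w"
    and omega_weight: "\<omega> \<in> G 4"
    and virasoro: "\<And>m n v. Y \<omega> (m + 1) (Y \<omega> (n + 1) v) - Y \<omega> (n + 1) (Y \<omega> (m + 1) v)
                     = sV (of_int (m - n)) (Y \<omega> (m + n + 1) v)
                       + (if m + n = 0 then sV (of_int (m ^ 3 - m) / 12 * c) v else 0)"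
    and L_derivative: "\<And>v e w. sV (e + 1) (vertex_field Y v (e + 1) w) = vertex_field Y (Y \<omega> 0 v) e w"
    and weight_direct_sum: "internal_direct_sum sV UNIV G UNIV"
    and L0_weight: "\<And>m v. v \<in> G m \<Longrightarrow> Y \<omega> 1 v = sV (of_int m / 2) v"
    and weight_finite: "\<And>m. \<exists>B. finite B \<and> G m = span B"
    and weight_bounded_below: "\<exists>m0. \<forall>m<m0. G m = {0}"
    and parity_weight: "\<And>j. j \<in> {0, 1} \<Longrightarrow>
                     internal_direct_sum sV {m. m mod 2 = int j} G (P j)"

locale weak_module =
  V: vertex_operator_superalgebra sV P Y vac \<omega> c G + M: super_space sM Q
  for sV :: "complex \<Rightarrow> 'v \<Rightarrow> 'v::ab_group_add" and P Y vac \<omega> c G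
    and sM :: "complex \<Rightarrow> 'w \<Rightarrow> 'w::ab_group_add" and Q :: "nat \<Rightarrow> 'w set" +
  fixes YM :: "'v \<Rightarrow> int \<Rightarrow> 'w \<Rightarrow> 'w"
  assumes YM_linear_left: "\<And>n w. Vector_Spaces.linear sV sM (\<lambda>u. YM u n w)"
    and YM_linear_right: "\<And>u n. Vector_Spaces.linear sM sM (YM u n)"
    and YM_parity: "\<And>p q u w n. \<lbrakk>p \<in> {0, 1}; q \<in> {0, 1}; u \<in> P p; w \<in> Q q\<rbrakk>
                     \<Longrightarrow> YM u n w \<in> Q ((p + q) mod 2)"
    and YM_truncation: "\<And>u w. \<exists>N. \<forall>n\<ge>N. YM u n w = 0"
    and YM_vacuum: "\<And>n w. YM vac n w = (if n = -1 then w else 0)"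
    and YM_jacobi: "\<And>p q u v w. \<lbrakk>p \<in> {0, 1}; q \<in> {0, 1}; u \<in> P p; v \<in> P q\<rbrakk>
                     \<Longrightarrow> jacobi sM Y YM p q u v w"


section \<open>The operator \<open>\<Delta>\<^sub>k(x)\<close>\<close>

text \<open>The derivation \<open>- \<Sum>j\<ge>1. a\<^sub>j x\<^bsup>j+1\<^esup> d/dx\<close> of \<open>\<complex>[[x]]\<close>.\<close>

definition coeff_derivation :: "(nat \<Rightarrow> complex) \<Rightarrow> complex fps \<Rightarrow> complex fps" where
  "coeff_derivation a f = - (Abs_fps (\<lambda>n. if n \<ge> 2 then a (n - 1) else 0) * fps_deriv f)"

text \<open>The condition defining the \<open>a\<^sub>j\<close>, \<open>j \<ge> 1\<close> (the value \<open>a 0\<close> is never used). The exponential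
  series converges in the \<open>x\<close>-adic topology of \<open>\<complex>[[x]]\<close>.\<close>

definition Delta_coeffs :: "nat \<Rightarrow> (nat \<Rightarrow> complex) \<Rightarrow> bool" where
  "Delta_coeffs k a \<longleftrightarrow>
     (\<lambda>n. fps_const (1 / fact n) * (coeff_derivation a ^^ n) fps_X) sums
       (fps_const (1 / of_nat k) * (1 + fps_X) ^ k - fps_const (1 / of_nat k))"

text \<open>Powers and exponential of a power series \<open>A(y) = \<Sum>i. A\<^sub>i y\<^sup>i\<close> of operators. In \<open>op_exp\<close> the
  constant term \<open>A\<^sub>0\<close> has to vanish, so that \<open>A(y)\<^sup>n\<close> contributes to the coefficient of \<open>y\<^sup>N\<close> only if
  \<open>n \<le> N\<close>.\<close>

fun op_power :: "(nat \<Rightarrow> 'v \<Rightarrow> 'v::comm_monoid_add) \<Rightarrow> nat \<Rightarrow> nat \<Rightarrow> 'v \<Rightarrow> 'v" where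
  "op_power A 0 N v = (if N = 0 then v else 0)"
| "op_power A (Suc n) N v = (\<Sum>i\<le>N. A i (op_power A n (N - i) v))"

definition op_exp :: "(complex \<Rightarrow> 'v \<Rightarrow> 'v::comm_monoid_add) \<Rightarrow> (nat \<Rightarrow> 'v \<Rightarrow> 'v) \<Rightarrow> nat \<Rightarrow> 'v \<Rightarrow> 'v" where
  "op_exp sV A N v = (\<Sum>n\<le>N. sV (1 / fact n) (op_power A n N v))"

text \<open>The component of \<open>u\<close> in \<open>G m = V\<^bsub>m/2\<^esub>\<close>.\<close>

definition weight_component :: "(int \<Rightarrow> 'v set) \<Rightarrow> int \<Rightarrow> 'v \<Rightarrow> 'v::comm_monoid_add" where
  "weight_component G m u =
     (THE f. (\<forall>i. f i \<in> G i) \<and> finite {i. f i \<noteq> 0} \<and> Sum_any f = u) m"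

text \<open>\<open>Delta sV Y \<omega> G a \<kappa> k u e\<close> is the coefficient of \<open>x\<^bsup>e\<^esup>\<close> in \<open>\<Delta>\<^sub>k(x) u\<close>, where \<open>\<kappa>\<close> is the chosen
  square root of \<open>k\<close>. On \<open>G m = V\<^bsub>m/2\<^esub>\<close> the operator \<open>(k\<^bsup>1/2\<^esup>)\<^bsup>-2L(0)\<^esup>\<close> is \<open>\<kappa>\<^bsup>-m\<^esup>\<close>, and
  \<open>(x\<^bsup>1/2k\<^esup>)\<^bsup>(1-k)2L(0)\<^esup>\<close> is \<open>x\<^bsup>(1-k)m/2k\<^esup>\<close>; the index \<open>N\<close> counts the powers of \<open>x\<^bsup>-1/k\<^esup>\<close> in the
  exponential, and \<open>L(j) = \<omega>\<^bsub>j+1\<^esub>\<close>.\<close>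

definition Delta :: "(complex \<Rightarrow> 'v \<Rightarrow> 'v::comm_monoid_add) \<Rightarrow> ('v \<Rightarrow> int \<Rightarrow> 'v \<Rightarrow> 'v) \<Rightarrow> 'v
    \<Rightarrow> (int \<Rightarrow> 'v set) \<Rightarrow> (nat \<Rightarrow> complex) \<Rightarrow> complex \<Rightarrow> nat \<Rightarrow> 'v \<Rightarrow> complex \<Rightarrow> 'v" where
  "Delta sV Y \<omega> G a \<kappa> k u =
     fseries
       (\<lambda>(N, m). - (of_nat N / of_nat k) + (1 - of_nat k) * of_int m / (2 * of_nat k))
       (\<lambda>(N, m). op_exp sV (\<lambda>j v. if j = 0 then 0 else sV (a j) (Y \<omega> (int j + 1) v)) N
                   (sV (\<kappa> powi (- m)) (weight_component G m u)))"

text \<open>\<open>Y\<^sub>M(D(x) u, x\<^bsup>1/k\<^esup>)\<close> for \<open>D(x) u = \<Sum>d. D u d x\<^bsup>d\<^esup>\<close>: the coefficient of \<open>x\<^bsup>e\<^esup>\<close>, applied to \<open>w\<close>.\<close>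

definition twisted_field :: "('v \<Rightarrow> int \<Rightarrow> 'w \<Rightarrow> 'w::comm_monoid_add) \<Rightarrow> ('v \<Rightarrow> complex \<Rightarrow> 'v) \<Rightarrow> nat
    \<Rightarrow> 'v \<Rightarrow> complex \<Rightarrow> 'w \<Rightarrow> 'w" where
  "twisted_field YM D k u e w =
     fseries (\<lambda>(d, n). d + (- of_int n - 1) / of_nat k) (\<lambda>(d, n). YM (D u d) n w) e"


section \<open>The two sides of the supercommutator formula\<close>

definition supercommutator :: "(complex \<Rightarrow> 'w \<Rightarrow> 'w::ab_group_add) \<Rightarrow> ('v \<Rightarrow> complex \<Rightarrow> 'w \<Rightarrow> 'w)
    \<Rightarrow> nat \<Rightarrow> nat \<Rightarrow> 'v \<Rightarrow> 'v \<Rightarrow> 'w \<Rightarrow> complex \<times> complex \<Rightarrow> 'w" where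
  "supercommutator sM F p q u v w =
     (\<lambda>(b, c). F u b (F v c w) - sM ((-1) ^ (p * q)) (F v c (F u b w)))"

text \<open>\<open>x\<^sub>2\<^bsup>-1\<^esup>/k \<delta>((x\<^sub>1 - x\<^sub>0)\<^bsup>1/k\<^esup> / x\<^sub>2\<^bsup>1/k\<^esup>)\<close>\<close>

definition root_delta :: "nat \<Rightarrow> exp3 \<Rightarrow> complex" where
  "root_delta k = fmonom (1 / of_nat k) (X2 (-1)) \<star>
     fdelta (\<lambda>n. diff_pow X1 X0 (of_int n / of_nat k) \<star> fmonom 1 (X2 (- (of_int n / of_nat k))))"

text \<open>\<open>((x\<^sub>1 - x\<^sub>0) / x\<^sub>2)\<^bsup>s\<^esup>\<close>\<close>

definition quot_pow :: "complex \<Rightarrow> exp3 \<Rightarrow> complex" where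
  "quot_pow s = diff_pow X1 X0 s \<star> fmonom 1 (X2 (- s))"

end

theory Submission
  imports Defs
begin

unbundle fps_syntax

text \<open>
  By the commutator formula for \<open>Y\<^sub>M\<close> and the substitution \<open>x\<^sub>2 + x\<^sub>0 = (x\<^sub>2\<^bsup>1/k\<^esup> + x)\<^sup>k\<close> under the residue, the
  claim amounts to the conjugation formula
  \<open>\<Delta>\<^sub>k(x\<^sub>2) Y(u, x\<^sub>0) = Y(\<Delta>\<^sub>k(x\<^sub>2 + x\<^sub>0) u, (x\<^sub>2 + x\<^sub>0)\<^bsup>1/k\<^esup> - x\<^sub>2\<^bsup>1/k\<^esup>) \<Delta>\<^sub>k(x\<^sub>2)\<close>, where \<open>x\<^sub>2 = 1\<close>
  suffices by homogeneity. Write \<open>(1 + z) log (1 + z) = \<Sum>\<^sub>j c\<^sub>j z\<^bsup>j+1\<^esup>\<close> and \<open>B = \<Sum>\<^sub>j c\<^sub>j L(j)\<close>. This vector field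
  generates the maps \<open>z \<mapsto> (1 + z)\<^sup>s - 1\<close>, so \<open>B\<close> commutes with \<open>\<Delta>\<^sub>k(1)\<close>, and bracketing with \<open>B\<close> acts on both
  sides of the conjugation formula in the same way. Since \<open>B\<close> is \<open>L(0)\<close> plus operators lowering the weight,
  the first nonzero component of the difference of the two sides would satisfy a homogeneous equation
  that determines it up to its leading coefficient, and the leading coefficients agree.
\<close>

section \<open>Power series\<close>

text \<open>The numbers \<open>a j\<close> are known only implicitly, through the map that their
  exponential generates, so a direct comparison of the two exponentials is out of reach. They enter
  through a single fact: the exponential carries a rescaled copy of \<open>fxi\<close> back to
  \<open>fxi\<close>. This field is chosen because \<open>z -> (1 + z)^k - 1\<close> carries it to
  itself as well; a single \<open>z^(j+1) d/dz\<close> is in general not preserved. The price is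
  that bracketing with \<open>B\<close> also produces \<open>L(j) u\<close>, \<open>L(j) v\<close>
  and altered test series, so the conjugation formula has to be proved for all \<open>u\<close>,
  \<open>v\<close> and all \<open>f\<close> at once. The test series needed in the end is
  \<open>(1 + z)^(-b-1)\<close>. It isolates the coefficient of \<open>x1^b\<close>, and its pairing
  with the modes of nonnegative index is all that a commutator contains. The variants for odd and
  even \<open>k\<close> agree with the general formula because the coefficients of the kernel depend
  on the exponent \<open>|u| (1-k) / 2k\<close> only modulo integral multiples of
  \<open>1/k\<close>.\<close>

lemma sum_triangle:
  fixes g :: "nat \<Rightarrow> nat \<Rightarrow> 'a::comm_monoid_add"
  shows "(\<Sum>i\<le>N. \<Sum>j\<le>N - i. g i j) = (\<Sum>n\<le>N. \<Sum>i\<le>n. g i (n - i))"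
proof -
  have "(\<Sum>i\<le>N. \<Sum>j\<le>N - i. g i j) = (\<Sum>(i, j)\<in>Sigma {..N} (\<lambda>i. {..N - i}). g i j)"
    by (simp add: sum.Sigma)
  also have "Sigma {..N} (\<lambda>i. {..N - i}) = {(i, j). i + j \<le> N}"
    by auto
  finally show ?thesis
    by (simp add: sum.triangle_reindex_eq)
qed

text \<open>The diagonal sum \<open>\<Sum>\<^sub>n F\<^sub>n\<close> is the \<open>z\<close>-adic limit as soon as \<open>z\<^sup>n\<close> divides \<open>F\<^sub>n\<close>.\<close>

definition fps_diag :: "(nat \<Rightarrow> 'a fps) \<Rightarrow> 'a::comm_ring_1 fps" where
  "fps_diag F = Abs_fps (\<lambda>N. \<Sum>n\<le>N. F n $ N)"

lemma fps_diag_nth: "fps_diag F $ N = (\<Sum>n\<le>N. F n $ N)"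
  by (simp add: fps_diag_def)

lemma fps_diag_nth_le:
  assumes "\<And>n N. N < n \<Longrightarrow> F n $ N = 0" and "N \<le> K"
  shows "fps_diag F $ N = (\<Sum>n\<le>K. F n $ N)"
  unfolding fps_diag_nth using assms by (intro sum.mono_neutral_left) auto

text \<open>To read off degree \<open>N\<close>, both sums may be cut at \<open>N\<close>. Products
  with \<open>i + j > N\<close> contribute nothing, so the square of index pairs shrinks to a
  triangle, which is summed along \<open>i + j = n\<close>.\<close>

lemma fps_diag_mult:
  assumes F: "\<And>n N. N < n \<Longrightarrow> F n $ N = 0" and H: "\<And>n N. N < n \<Longrightarrow> H n $ N = 0"
  shows "fps_diag F * fps_diag H = fps_diag (\<lambda>n. \<Sum>i\<le>n. F i * H (n - i))"
proof (rule fps_ext)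
  fix N
  have F': "fps_diag F $ p = (\<Sum>i\<le>N. F i $ p)" and H': "fps_diag H $ p = (\<Sum>i\<le>N. H i $ p)"
    if "p \<le> N" for p
    using fps_diag_nth_le[of F, OF F that] fps_diag_nth_le[of H, OF H that] by auto
  have "(fps_diag F * fps_diag H) $ N
      = (\<Sum>p\<le>N. (\<Sum>i\<le>N. F i $ p) * (\<Sum>j\<le>N. H j $ (N - p)))"
    unfolding fps_mult_nth atLeast0AtMost by (intro sum.cong refl) (simp add: F' H')
  also have "\<dots> = (\<Sum>i\<le>N. \<Sum>j\<le>N. \<Sum>p\<le>N. F i $ p * H j $ (N - p))"
    unfolding sum_product by (rule trans[OF sum.swap], rule sum.cong[OF refl], rule sum.swap)
  also have "\<dots> = (\<Sum>i\<le>N. \<Sum>j\<le>N. (F i * H j) $ N)"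
    by (simp add: fps_mult_nth atLeast0AtMost)
  also have "\<dots> = (\<Sum>i\<le>N. \<Sum>j\<le>N - i. (F i * H j) $ N)"
  proof (rule sum.cong[OF refl], rule sum.mono_neutral_right)
    fix i assume i: "i \<in> {..N}"
    show "\<forall>j\<in>{..N} - {..N - i}. (F i * H j) $ N = 0"
    proof
      fix j assume *: "j \<in> {..N} - {..N - i}"
      have "F i $ p * H j $ (N - p) = 0" if "p \<le> N" for p
        using F[of p i] H[of "N - p" j] * that by (cases "p < i") auto
      then show "(F i * H j) $ N = 0" by (simp add: fps_mult_nth)
    qed
  qed auto
  also have "\<dots> = (\<Sum>n\<le>N. \<Sum>i\<le>n. (F i * H (n - i)) $ N)"
    by (rule sum_triangle)
  finally show "(fps_diag F * fps_diag H) $ N = fps_diag (\<lambda>n. \<Sum>i\<le>n. F i * H (n - i)) $ N"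
    by (simp add: fps_diag_nth fps_sum_nth)
qed

section \<open>Binomial series and the logarithm under \<open>z -> (1 + z)^k - 1\<close>\<close>

lemma fps_deriv_binomial:
  "fps_deriv (fps_binomial c) = fps_const c * fps_binomial (c - 1)" for c :: "'a::field_char_0"
  using fps_binomial_add_mult[of c "-1"]
  by (simp add: fps_binomial_deriv fps_binomial_minus_one fps_divide_unit mult.assoc)

lemma fps_binomial_neg: "fps_binomial (- c) = inverse (fps_binomial c)" for c :: "'a::field_char_0"
proof -
  have "fps_binomial c * fps_binomial (- c) = 1"
    by (simp flip: fps_binomial_add_mult)
  then show ?thesis
    by (rule fps_inverse_unique[symmetric])
qed

lemma fps_binomial_nonzero [simp]: "fps_binomial c \<noteq> 0" for c :: "'a::field_char_0"
  by (metis fps_binomial_nth fps_zero_nth gbinomial_0(1) zero_neq_one)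

text \<open>Inversion commutes with substitution. This exponent comes first because the chain rule
  produces the factor \<open>1 / (1 + z)\<close> for every other one.\<close>

lemma fps_binomial_minus_1_compose:
  "fps_binomial (-1) oo (fps_binomial k - 1) = fps_binomial (- k)" for k :: "'a::field_char_0"
  by (simp add: fps_binomial_neg fps_inverse_compose fps_binomial_1 fps_compose_add_distrib)

text \<open>By the chain rule the composite solves \<open>(1 + x) y' = c k y\<close> with
  \<open>y(0) = 1\<close>, and this characterises the binomial series.\<close>

lemma fps_binomial_compose:
  "fps_binomial c oo (fps_binomial k - 1) = fps_binomial (c * k)" for c k :: "'a::field_char_0"
proof -
  have "fps_deriv (fps_binomial c oo (fps_binomial k - 1))
      = fps_const c * ((fps_binomial c oo (fps_binomial k - 1))
          * (fps_binomial (-1) oo (fps_binomial k - 1))) * (fps_const k * fps_binomial (k - 1))"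
    using fps_binomial_add_mult[of c "-1"]
    by (simp add: fps_compose_deriv fps_deriv_binomial fps_compose_mult_distrib)
  also have "\<dots> = fps_const (c * k) * (fps_binomial c oo (fps_binomial k - 1)) * fps_binomial (-1)"
    unfolding fps_binomial_minus_1_compose using fps_binomial_add_mult[of "-k" "k - 1"]
    by (simp add: mult_ac flip: fps_const_mult)
  finally show ?thesis
    by (subst fps_binomial_ODE_unique' [symmetric])
       (simp add: fps_binomial_minus_one fps_divide_unit)
qed

abbreviation fln :: "complex fps" where "fln \<equiv> fps_ln 1"

lemma fps_deriv_fln: "fps_deriv fln = fps_binomial (-1)"
  by (simp add: fps_ln_deriv fps_binomial_minus_one)

text \<open>Both sides have derivative \<open>k / (1 + x)\<close> and no constant term.\<close>

lemma fln_compose: "fln oo (fps_binomial k - 1) = fps_const k * fln"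
proof -
  have "fps_deriv (fln oo (fps_binomial k - 1)) = fps_deriv (fps_const k * fln)"
    using fps_binomial_add_mult[of "-k" "k - 1"]
    by (simp add: fps_compose_deriv fps_deriv_fln fps_deriv_binomial mult_ac del: fps_const_neg)
       (simp add: fps_binomial_minus_1_compose mult_ac flip: \<open>fps_binomial (-k + (k - 1)) = _\<close>)
  then show ?thesis
    unfolding fps_deriv_eq_iff by simp
qed

text \<open>The vector field \<open>\<xi> d/dz\<close> with \<open>\<xi> = (1 + z) log (1 + z)\<close> generates the one-parameter group
  \<open>z \<mapsto> (1 + z)\<^sup>s - 1\<close>, to which the coordinate change behind \<open>\<Delta>\<^sub>k\<close> belongs up to scaling.\<close>

definition fxi :: "complex fps" where "fxi = fps_binomial 1 * fln"

lemma fps_deriv_fxi: "fps_deriv fxi = 1 + fln"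
  using fps_binomial_add_mult[of "1::complex" "-1"]
  by (simp add: fxi_def fps_deriv_binomial fps_deriv_fln)

lemma fxi_nth_0 [simp]: "fxi $ 0 = 0" and fxi_nth_1 [simp]: "fxi $ Suc 0 = 1"
  using arg_cong[OF fps_deriv_fxi, of "\<lambda>f. f $ 0"] by (simp_all add: fxi_def)

lemma fxi_nth: "fxi $ Suc (Suc n) = (-1) ^ n / (of_nat (Suc n) * of_nat (Suc (Suc n)))"
proof -
  have "of_nat (Suc (Suc n)) * fxi $ Suc (Suc n) = fps_deriv fxi $ Suc n"
    by simp
  also have "\<dots> = (-1) ^ n / of_nat (Suc n)"
    by (simp add: fps_deriv_fxi fps_ln_nth del: of_nat_Suc)
  finally show ?thesis
    by (simp add: field_simps del: of_nat_Suc)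
qed

text \<open>The self-similarity of the vector field \<open>(1 + z) log (1 + z) d/dz\<close>: its Taylor expansion at
  \<open>z\<close> is, up to the term \<open>log (1 + z) (1 + z + w)\<close>, the rescaling \<open>(1 + z) \<xi>(w / (1 + z))\<close>.\<close>

lemma fxi_taylor:
  "of_nat (Suc (m + i) choose Suc i) * fxi $ Suc (m + i)
     = (if i = 0 then fln $ m else 0) + fxi $ Suc i * fps_binomial (- of_nat i) $ m"
proof (cases i)
  case 0
  have "of_nat (Suc m) * fxi $ Suc m = fps_deriv fxi $ m"
    by simp
  then show ?thesis
    using 0 by (simp add: fps_deriv_fxi del: of_nat_Suc)
next
  case (Suc l)
  have g: "(- of_nat (Suc l) gchoose m :: complex) = (-1) ^ m * of_nat ((m + l) choose m)"
    by (subst gbinomial_negated_upper) (simp add: binomial_gbinomial add_ac)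
  have F: "fact (Suc (Suc n)) = of_nat (Suc n) * of_nat (Suc (Suc n)) * (fact n :: complex)" for n
    by (simp only: fact_Suc of_nat_mult mult_ac)
  have fact1: "(of_nat (Suc (Suc (m + l)) choose Suc (Suc l)) :: complex)
      = fact (Suc (Suc (m + l))) / (fact (Suc (Suc l)) * fact m)"
    by (subst binomial_fact) auto
  have fact2: "(of_nat ((m + l) choose m) :: complex) = fact (m + l) / (fact m * fact l)"
    by (subst binomial_fact) auto
  show ?thesis
    unfolding Suc fps_binomial_nth g fact1 fact2 add_Suc_right fxi_nth F
    by (simp add: power_add divide_simps del: of_nat_Suc)
qed

text \<open>For \<open>u\<close> of \<open>L(0)\<close>-eigenvalue \<open>b\<close> and \<open>1 + z = (1 + x)\<^sup>k\<close>, so that \<open>dz = k (1 + x)\<^bsup>k-1\<^esup> dx\<close>, the series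
  \<open>substitution b N f\<close> is the weight in \<open>x\<close> of the \<open>N\<close>-th component of \<open>\<Delta>\<^sub>k(1 + z) u\<close> under
  \<open>Res\<^sub>z f(z)\<close>. Bracketing \<open>\<Sum>\<^sub>j c\<^sub>j L(j)\<close>, \<open>\<xi> = \<Sum>\<^sub>j c\<^sub>j z\<^bsup>j+1\<^esup>\<close>, with \<open>Res\<^sub>z f(z) Y(u, z)\<close> replaces \<open>f\<close> by
  \<open>fsharp b f\<close>, up to terms in \<open>L(j) u\<close>.\<close>

context
  fixes k :: nat
begin

definition substitution :: "complex \<Rightarrow> nat \<Rightarrow> complex fps \<Rightarrow> complex fps" where
  "substitution b N f = fps_const (of_nat k)
     * fps_binomial (of_nat k - 1 + b * (1 - of_nat k) - of_nat N)
     * (f oo (fps_binomial (of_nat k) - 1))"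

definition fsharp :: "complex \<Rightarrow> complex fps \<Rightarrow> complex fps" where
  "fsharp b f = fps_const b * fln * f - fps_deriv (fxi * f)"

lemma substitution_binomial:
  "substitution b N (fps_binomial c)
     = fps_const (of_nat k) * fps_binomial (of_nat k - 1 + b * (1 - of_nat k) - of_nat N + c * of_nat k)"
  by (simp add: substitution_def fps_binomial_compose mult.assoc flip: fps_binomial_add_mult)

text \<open>An \<open>L(j)\<close> applied after the exponential brings a factor
  \<open>(1 + x)^(-j)\<close>. Applied before it, it lowers \<open>b\<close> by \<open>j\<close> and
  brings \<open>(1 + z)^(-j) = (1 + x)^(-jk)\<close>. Either way the exponent changes as if
  \<open>N\<close> had grown by \<open>j\<close>.\<close>

lemma substitution_mult_binomial:
  "fps_binomial (- of_nat j) * substitution b N f = substitution b (j + N) f"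
  "substitution (b - of_nat j) N (fps_binomial (- of_nat j) * f) = substitution b (j + N) f"
proof -
  have "fps_binomial (of_nat k - 1 + b * (1 - of_nat k) - of_nat (j + N)) =
      fps_binomial (- of_nat j) * fps_binomial (of_nat k - 1 + b * (1 - of_nat k) - of_nat N :: complex)"
    unfolding fps_binomial_add_mult[symmetric] by (simp add: algebra_simps)
  then show "fps_binomial (- of_nat j) * substitution b N f = substitution b (j + N) f"
    by (simp add: substitution_def mult_ac)
  have "fps_binomial (of_nat k - 1 + b * (1 - of_nat k) - of_nat (j + N)) =
      fps_binomial (of_nat k - 1 + (b - of_nat j) * (1 - of_nat k) - of_nat N)
        * fps_binomial (- of_nat j * of_nat k :: complex)"
    unfolding fps_binomial_add_mult[symmetric] by (simp add: algebra_simps)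
  then show "substitution (b - of_nat j) N (fps_binomial (- of_nat j) * f) = substitution b (j + N) f"
    by (simp add: substitution_def mult_ac fps_compose_mult_distrib fps_binomial_compose)
qed

text \<open>The field is its own pullback: \<open>fxi oo u = u' fxi\<close> for
  \<open>u = (1 + x)^K - 1\<close>. The prefactor \<open>(1 + x)^e\<close> only changes the
  coefficient of the logarithm, and the shift from \<open>b\<close> to \<open>b - N\<close>, the
  \<open>L(0)\<close>-eigenvalue after lowering by \<open>N\<close>, compensates for that.\<close>

lemma fsharp_substitution:
  assumes "k > 0"
  shows "fsharp (b - of_nat N) (substitution b N f) = substitution b N (fsharp b f)"
proof -
  define K :: complex where "K = of_nat k"
  define e where "e = K - 1 + b * (1 - K) - of_nat N"
  define u where "u = fps_binomial K - 1"
  define F where "F = f oo u"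
  define M where "M = fps_binomial e"
  have K: "K \<noteq> 0" using assms by (simp add: K_def)
  have u0: "u $ 0 = 0" by (simp add: u_def)
  have fxi_u: "fxi oo u = fps_const K * fps_binomial K * fln"
    using fps_binomial_compose[of 1 K] fln_compose[of K]
    by (simp add: fxi_def u_def fps_compose_mult_distrib mult_ac)
  \<comment> \<open>The chain rule solved for the outer derivative,
    \<open>u' = K (1 + x)^(K-1)\<close> being invertible.\<close>
  have comp: "fps_deriv h oo u = fps_const (1 / K) * fps_binomial (1 - K) * fps_deriv (h oo u)" for h
  proof -
    have "fps_binomial (1 - K) * fps_binomial (K - 1) = 1"
      by (simp flip: fps_binomial_add_mult)
    moreover have "fps_deriv (h oo u) = (fps_deriv h oo u) * (fps_const K * fps_binomial (K - 1))"
      by (simp add: fps_compose_deriv u0) (simp add: u_def fps_deriv_binomial)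
    then have "fps_const (1 / K) * fps_binomial (1 - K) * fps_deriv (h oo u)
        = (fps_const (1 / K) * fps_const K) * (fps_binomial (1 - K) * fps_binomial (K - 1)) * (fps_deriv h oo u)"
      by (simp only: mult_ac)
    ultimately show ?thesis
      using K by simp
  qed
  have "fsharp b f oo u = fps_const b * (fps_const K * fln) * F
      - fps_const (1 / K) * fps_binomial (1 - K) * fps_deriv (fps_const K * fps_binomial K * fln * F)"
    using fln_compose[of K]
    by (simp add: fsharp_def fps_compose_sub_distrib fps_compose_mult_distrib u0 comp fxi_u F_def
        del: fps_deriv_mult) (simp add: u_def)
  also have "fps_deriv (fps_const K * fps_binomial K * fln * F)
     = fps_const K * (fps_const K * fps_binomial (K - 1) * fln * F
         + fps_binomial K * fps_deriv (fln * F))"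
    by (simp add: fps_deriv_binomial algebra_simps)
  also have "fps_const (1 / K) * fps_binomial (1 - K) * \<dots> =
      (fps_const (1 / K) * fps_const K) * (fps_const K * (fps_binomial (1 - K) * fps_binomial (K - 1)) * fln * F
         + (fps_binomial (1 - K) * fps_binomial K) * fps_deriv (fln * F))"
    by (simp add: algebra_simps del: fps_const_mult)
  also have "\<dots> = fps_const K * fln * F + fps_binomial 1 * fps_deriv (fln * F)"
    using K by (simp flip: fps_binomial_add_mult)
  finally have 1: "fsharp b f oo u
      = fps_const (b * K - K) * (fln * F) - fps_binomial 1 * fps_deriv (fln * F)"
    by (simp add: algebra_simps flip: fps_const_sub fps_const_mult)
  have "fps_deriv (fxi * (fps_const K * M * F)) = fps_deriv (fps_const K * fps_binomial (1 + e) * (fln * F))"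
    by (simp add: fxi_def M_def fps_binomial_add_mult mult_ac)
  also have "\<dots> = fps_const K * (fps_const (1 + e) * M * (fln * F) + fps_binomial 1 * M * fps_deriv (fln * F))"
    unfolding fps_deriv_mult[of "fps_const K * fps_binomial (1 + e)"]
    by (simp add: fps_deriv_binomial M_def algebra_simps) (simp add: fps_binomial_add_mult algebra_simps)
  finally have 2: "fsharp (b - of_nat N) (fps_const K * M * F)
     = fps_const K * M * (fps_const (b - of_nat N - 1 - e) * (fln * F) - fps_binomial 1 * fps_deriv (fln * F))"
    by (simp add: fsharp_def algebra_simps flip: fps_const_sub fps_const_add)
  \<comment> \<open>Here the choice of the exponent \<open>e\<close> pays off: the logarithm has the
    same coefficient in both computations.\<close>
  have "b - of_nat N - 1 - e = b * K - K"
    by (simp add: e_def algebra_simps)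
  then show ?thesis
    using 1 2 unfolding substitution_def K_def[symmetric] e_def[symmetric] u_def[symmetric] M_def[symmetric] F_def[symmetric]
    by simp
qed

end

section \<open>Exponentials of derivations of power series\<close>

text \<open>Think of \<open>p i j\<close> as \<open>(D^i f / i!) (D^j g / j!)\<close>: with divided
  powers the Leibniz rule raises one index and multiplies by its new value. An abstract
  \<open>p\<close> covers both products of series and the action \<open>h f'\<close> of a vector
  field.\<close>

lemma exp_leibniz_fps:
  fixes D :: "complex fps \<Rightarrow> complex fps" and p :: "nat \<Rightarrow> nat \<Rightarrow> complex fps"
  assumes D_add: "\<And>f g. D (f + g) = D f + D g"
    and D_scale: "\<And>c f. D (fps_const c * f) = fps_const c * D f"
    and D_p: "\<And>i j. D (p i j) = of_nat (Suc i) * p (Suc i) j + of_nat (Suc j) * p i (Suc j)"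
  shows "fps_const (1 / fact n) * (D ^^ n) (p 0 0) = (\<Sum>i\<le>n. p i (n - i))"
proof (induction n)
  case (Suc n)
  have D0: "D 0 = 0" using D_scale[of 0 0] by simp
  have D_sum: "D (sum f A) = (\<Sum>i\<in>A. D (f i))" if "finite A" for f and A :: "nat set"
    using that by induction (simp_all add: D_add D0)
  \<comment> \<open>The factor \<open>n + 1\<close> is split as \<open>i + (n + 1 - i)\<close>, one
    summand for each index that \<open>D\<close> may raise.\<close>
  have "of_nat (Suc n) * (fps_const (1 / fact (Suc n)) * (D ^^ Suc n) (p 0 0))
      = fps_const (of_nat (Suc n)) * fps_const (1 / fact (Suc n)) * (D ^^ Suc n) (p 0 0)"
    by (simp only: fps_of_nat mult.assoc)
  also have "fps_const (of_nat (Suc n)) * fps_const (1 / fact (Suc n)) = fps_const (1 / fact n :: complex)"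
    by (simp del: of_nat_Suc)
  also have "\<dots> * (D ^^ Suc n) (p 0 0) = D (\<Sum>i\<le>n. p i (n - i))"
    by (simp add: D_scale flip: Suc)
  also have "\<dots> = (\<Sum>i\<le>n. of_nat (Suc i) * p (Suc i) (n - i)) + (\<Sum>i\<le>n. of_nat (Suc (n - i)) * p i (Suc (n - i)))"
    by (simp add: D_sum D_p sum.distrib del: of_nat_Suc)
  also have "(\<Sum>i\<le>n. of_nat (Suc i) * p (Suc i) (n - i)) = (\<Sum>i\<le>Suc n. of_nat i * p i (Suc n - i))"
    by (simp only: sum.atMost_Suc_shift) simp
  also have "(\<Sum>i\<le>n. of_nat (Suc (n - i)) * p i (Suc (n - i))) = (\<Sum>i\<le>Suc n. of_nat (Suc n - i) * p i (Suc n - i))"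
    by (simp only: sum.atMost_Suc) (auto intro!: sum.cong simp: Suc_diff_le simp del: of_nat_Suc)
  also have "(\<Sum>i\<le>Suc n. of_nat i * p i (Suc n - i)) + \<dots> = (\<Sum>i\<le>Suc n. of_nat (Suc n) * p i (Suc n - i))"
    unfolding sum.distrib[symmetric]
    by (intro sum.cong refl) (simp flip: distrib_right of_nat_add del: of_nat_Suc)
  also have "\<dots> = of_nat (Suc n) * (\<Sum>i\<le>Suc n. p i (Suc n - i))"
    by (simp only: sum_distrib_left)
  finally show ?case
    by (simp del: of_nat_Suc)
qed simp

lemma exp_term_step:
  fixes D :: "complex fps \<Rightarrow> complex fps"
  assumes "\<And>c f. D (fps_const c * f) = fps_const c * D f"
  shows "D (fps_const (1 / fact i) * (D ^^ i) f)
    = of_nat (Suc i) * (fps_const (1 / fact (Suc i)) * (D ^^ Suc i) f)"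
proof -
  have "of_nat (Suc i) * (fps_const (1 / fact (Suc i)) * (D ^^ Suc i) f)
      = fps_const (of_nat (Suc i)) * fps_const (1 / fact (Suc i)) * (D ^^ Suc i) f"
    by (simp only: fps_of_nat mult.assoc)
  also have "fps_const (of_nat (Suc i)) * fps_const (1 / fact (Suc i)) = fps_const (1 / fact i :: complex)"
    by (simp del: of_nat_Suc)
  finally show ?thesis
    by (simp only: assms funpow.simps comp_apply)
qed

context
  fixes a :: "nat \<Rightarrow> complex"
begin

definition fal :: "complex fps" where
  "fal = Abs_fps (\<lambda>n. if n \<ge> 2 then a (n - 1) else 0)"

text \<open>The Lie bracket of \<open>- fal d/dx\<close> with the vector field
  \<open>h d/dx\<close>.\<close>

definition fad :: "complex fps \<Rightarrow> complex fps" where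
  "fad h = fps_deriv fal * h - fal * fps_deriv h"

lemma coeff_derivation_eq: "coeff_derivation a f = - (fal * fps_deriv f)"
  by (simp add: coeff_derivation_def fal_def)

lemma coeff_derivation_scale: "coeff_derivation a (fps_const c * f) = fps_const c * coeff_derivation a f"
  by (simp add: coeff_derivation_eq algebra_simps)

lemma coeff_derivation_add: "coeff_derivation a (f + g) = coeff_derivation a f + coeff_derivation a g"
  by (simp add: coeff_derivation_eq algebra_simps)

lemma fad_scale: "fad (fps_const c * f) = fps_const c * fad f"
  by (simp add: fad_def algebra_simps)

lemma fal_nth: "fal $ n = (if n \<ge> 2 then a (n - 1) else 0)"
  by (simp add: fal_def)

text \<open>\<open>fal\<close> starts in degree 2, while differentiation costs one degree. The
  resulting gain of one order per step makes both exponentials below converge.\<close>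

lemma fal_deriv_order:
  assumes "\<And>i. i < m \<Longrightarrow> f $ i = 0" "i < Suc m"
  shows "(fal * fps_deriv f) $ i = 0"
  unfolding fps_mult_nth by (rule sum.neutral) (use assms in \<open>auto simp: fal_nth\<close>)

lemma coeff_derivation_order:
  assumes "\<And>i. i < m \<Longrightarrow> f $ i = 0" "i < m + n"
  shows "(coeff_derivation a ^^ n) f $ i = 0"
  using assms(2)
proof (induction n arbitrary: i)
  case (Suc n)
  then show ?case
    by (auto simp: coeff_derivation_eq intro!: fal_deriv_order[where m="m+n"])
qed (use assms in auto)

lemma fad_order:
  assumes "\<And>i. i < m \<Longrightarrow> f $ i = 0" "i < m + n"
  shows "(fad ^^ n) f $ i = 0"
  using assms(2)
proof (induction n arbitrary: i)
  case (Suc n)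
  have "(fal * fps_deriv ((fad ^^ n) f)) $ i = 0"
    by (rule fal_deriv_order[where m="m+n"]) (use Suc in auto)
  moreover have "(fps_deriv fal * (fad ^^ n) f) $ i = 0"
    unfolding fps_mult_nth by (rule sum.neutral) (use Suc in \<open>auto simp: fal_nth\<close>)
  moreover have "(fad ^^ Suc n) f = fps_deriv fal * (fad ^^ n) f - fal * fps_deriv ((fad ^^ n) f)"
    by (simp only: funpow.simps comp_apply fad_def[of "(fad ^^ n) f"])
  ultimately show ?case
    by simp
qed (use assms in auto)

text \<open>The automorphism \<open>exp(- sum a_j x^(j+1) d/dx)\<close> of the power series ring;
  \<open>adflow\<close> is its adjoint action on vector fields. The \<open>n\<close>-th term has
  order at least \<open>n\<close>, so the diagonal sum is the full exponential.\<close>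

definition flow :: "complex fps \<Rightarrow> complex fps" where
  "flow f = fps_diag (\<lambda>n. fps_const (1 / fact n) * (coeff_derivation a ^^ n) f)"

definition adflow :: "complex fps \<Rightarrow> complex fps" where
  "adflow f = fps_diag (\<lambda>n. fps_const (1 / fact n) * (fad ^^ n) f)"

lemma flow_mult: "flow (f * g) = flow f * flow g"
proof -
  let ?e = "\<lambda>f n. fps_const (1 / fact n) * (coeff_derivation a ^^ n) f"
  have D: "coeff_derivation a (x * y) = coeff_derivation a x * y + x * coeff_derivation a y" for x y
    by (simp add: coeff_derivation_eq algebra_simps)
  have "?e (f * g) n = (\<Sum>i\<le>n. ?e f i * ?e g (n - i))" for n
  proof -
    have "coeff_derivation a (?e f i * ?e g j) =
        of_nat (Suc i) * (?e f (Suc i) * ?e g j) + of_nat (Suc j) * (?e f i * ?e g (Suc j))" for i j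
      unfolding D[of "?e f i" "?e g j"] exp_term_step[OF coeff_derivation_scale, where f=f]
        exp_term_step[OF coeff_derivation_scale, where f=g]
      by (simp only: mult_ac)
    from exp_leibniz_fps[of "coeff_derivation a" "\<lambda>i j. ?e f i * ?e g j" n,
        OF coeff_derivation_add coeff_derivation_scale this]
    show ?thesis by simp
  qed
  then show ?thesis
    unfolding flow_def by (subst fps_diag_mult) (simp_all add: coeff_derivation_order[where m=0])
qed

text \<open>Exponentiated form of \<open>D (h f') = (ad D h) f' + h (D f)'\<close>. A vanishing
  constant term of \<open>f\<close> makes up for the order that the derivative in
  \<open>(D^n f)'\<close> loses.\<close>

lemma adflow_flow_deriv: "flow (h * fps_deriv f) = adflow h * fps_deriv (flow f)"
  if "f $ 0 = 0"
proof -
  let ?e = "\<lambda>f n. fps_const (1 / fact n) * (coeff_derivation a ^^ n) f"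
  let ?d = "\<lambda>f n. fps_const (1 / fact n) * (fad ^^ n) f"
  have ord: "?e f n $ i = 0" if "i < Suc n" for n i
    using coeff_derivation_order[of 1 f i n] that \<open>f $ 0 = 0\<close> by simp
  have ord_d: "?d h n $ N = 0" if "N < n" for n N
    using fad_order[of 0 h N n] that by simp
  have ord_e: "fps_deriv (?e f n) $ N = 0" if "N < n" for n N
    using ord[of "Suc N" n] that unfolding fps_deriv_nth by simp
  have D: "coeff_derivation a (x * fps_deriv y) = fad x * fps_deriv y + x * fps_deriv (coeff_derivation a y)"
    for x y
    by (simp add: coeff_derivation_eq fad_def algebra_simps)
  have deriv_of_nat: "fps_deriv (of_nat n * x) = of_nat n * fps_deriv x" for n and x :: "complex fps"
    by simp
  have "?e (h * fps_deriv f) n = (\<Sum>i\<le>n. ?d h i * fps_deriv (?e f (n - i)))" for n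
  proof -
    have "coeff_derivation a (?d h i * fps_deriv (?e f j)) =
        of_nat (Suc i) * (?d h (Suc i) * fps_deriv (?e f j))
        + of_nat (Suc j) * (?d h i * fps_deriv (?e f (Suc j)))" for i j
      unfolding D[of "?d h i" "?e f j"] exp_term_step[OF coeff_derivation_scale, where f=f]
        exp_term_step[OF fad_scale, where f=h] deriv_of_nat
      by (simp only: mult_ac)
    from exp_leibniz_fps[of "coeff_derivation a" "\<lambda>i j. ?d h i * fps_deriv (?e f j)" n,
        OF coeff_derivation_add coeff_derivation_scale this]
    show ?thesis by simp
  qed
  then have "flow (h * fps_deriv f) = adflow h * fps_diag (\<lambda>n. fps_deriv (?e f n))"
    unfolding flow_def adflow_def by (subst fps_diag_mult[OF ord_d ord_e]) (simp_all only:)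
  also have "fps_diag (\<lambda>n. fps_deriv (?e f n)) = fps_deriv (flow f)"
  proof (rule fps_ext)
    fix N
    have "fps_deriv (flow f) $ N = of_nat (N + 1) * (\<Sum>n\<le>N. ?e f n $ (N + 1))"
      using ord[of "Suc N" "Suc N"] by (simp add: flow_def fps_diag_nth)
    then show "fps_diag (\<lambda>n. fps_deriv (?e f n)) $ N = fps_deriv (flow f) $ N"
      unfolding fps_diag_nth fps_deriv_nth sum_distrib_left by simp
  qed
  finally show ?thesis .
qed

lemma flow_add: "flow (f + g) = flow f + flow g"
proof -
  have "(coeff_derivation a ^^ n) (f + g) = (coeff_derivation a ^^ n) f + (coeff_derivation a ^^ n) g" for n
    by (induction n) (simp_all add: coeff_derivation_add)
  then show ?thesis
    by (simp add: fps_eq_iff flow_def fps_diag_nth algebra_simps sum.distrib)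
qed

lemma flow_scale: "flow (fps_const c * f) = fps_const c * flow f"
proof -
  have "(coeff_derivation a ^^ n) (fps_const c * f) = fps_const c * (coeff_derivation a ^^ n) f" for n
    by (induction n) (simp_all add: coeff_derivation_scale)
  then show ?thesis
    by (simp add: fps_eq_iff flow_def fps_diag_nth mult_ac sum_distrib_left)
qed

lemma flow_order: "flow f $ i = 0" if "\<And>i. i < m \<Longrightarrow> f $ i = 0" "i < m"
  using that by (auto simp add: flow_def fps_diag_nth coeff_derivation_order[where m=m] intro!: sum.neutral)

lemma flow_1: "flow 1 = 1"
proof -
  have *: "(coeff_derivation a ^^ n) 1 = (if n = 0 then 1 else 0)" for n
    by (induction n) (simp_all add: coeff_derivation_eq)
  have "flow 1 $ N = (\<Sum>n\<le>N. if n = 0 then (1 :: complex fps) $ N else 0)" for N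
    unfolding flow_def fps_diag_nth by (intro sum.cong) (auto simp: *)
  then show ?thesis
    by (simp add: fps_eq_iff)
qed

text \<open>An algebra homomorphism agrees with substitution on polynomials. For the coefficient of
  degree \<open>N\<close> it is enough to cut \<open>f\<close> at \<open>N\<close>, as the flow does
  not lower the order of the remainder.\<close>

lemma flow_compose: "flow f = f oo flow fps_X"
proof (rule fps_ext)
  fix N
  define T where "T = (\<Sum>i\<le>N. fps_const (f $ i) * fps_X ^ i)"
  have pow: "flow (fps_X ^ i) = flow fps_X ^ i" for i
    by (induction i) (simp_all add: flow_1 flow_mult)
  have flow_0: "flow 0 = 0"
    using flow_scale[of 0 0] by simp
  have "flow (\<Sum>i\<in>A. fps_const (f $ i) * fps_X ^ i) = (\<Sum>i\<in>A. fps_const (f $ i) * flow fps_X ^ i)"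
    if "finite A" for A
    using that by induction (simp_all add: flow_add flow_scale flow_0 pow)
  then have "flow T = (\<Sum>i\<le>N. fps_const (f $ i) * flow fps_X ^ i)"
    by (simp add: T_def)
  then have 1: "flow T $ N = (f oo flow fps_X) $ N"
    by (simp add: fps_sum_nth fps_compose_nth atLeast0AtMost)
  have "(f - T) $ i = 0" if "i < Suc N" for i
  proof -
    have "T $ i = (\<Sum>j\<le>N. if i = j then f $ j else 0)"
      by (simp add: T_def fps_sum_nth fps_X_power_nth if_distrib cong: if_cong)
    also have "\<dots> = f $ i"
      using that by simp
    finally show ?thesis by simp
  qed
  then have "flow (f - T) $ N = 0"
    by (rule flow_order) auto
  moreover have "flow f = flow (f - T) + flow T"
    by (simp flip: flow_add)
  ultimately show "flow f $ N = (f oo flow fps_X) $ N"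
    using 1 by simp
qed

text \<open>Convergence in the adic topology means that each coefficient of the partial sums is
  eventually constant. A partial sum with more than \<open>N\<close> terms already contains every
  term that reaches degree \<open>N\<close>.\<close>

lemma Delta_coeffs_flow:
  assumes "Delta_coeffs k a"
  shows "flow fps_X = fps_const (1 / of_nat k) * (fps_binomial (of_nat k) - 1)"
proof (rule fps_ext)
  fix N
  let ?e = "\<lambda>n. fps_const (1 / fact n) * (coeff_derivation a ^^ n) fps_X"
  let ?g = "fps_const (1 / of_nat k) * (1 + fps_X) ^ k - fps_const (1 / of_nat k) :: complex fps"
  have "eventually (\<lambda>n. (\<Sum>i<n. ?e i) $ N = ?g $ N) sequentially"
    using assms unfolding Delta_coeffs_def sums_def tendsto_fps_iff by blast
  then obtain n where n: "(\<Sum>i<n. ?e i) $ N = ?g $ N" "n > N"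
    using eventually_happens[OF eventually_conj[OF _ eventually_gt_at_top[of N]]] by fastforce
  have "flow fps_X $ N = (\<Sum>i\<le>n - 1. ?e i $ N)"
    unfolding flow_def using n(2)
    by (intro fps_diag_nth_le) (auto simp: coeff_derivation_order[where m=0])
  also have "{..n - 1} = {..<n}"
    using n(2) by auto
  also have "(\<Sum>i<n. ?e i $ N) = ?g $ N"
    using n(1) by (simp add: fps_sum_nth)
  finally show "flow fps_X $ N = (fps_const (1 / of_nat k) * (fps_binomial (of_nat k) - 1)) $ N"
    unfolding fps_binomial_of_nat by (simp add: right_diff_distrib)
qed

text \<open>For derivations of \<open>\<complex>[[z]]\<close> this says that \<open>exp(\<Sum>a\<^sub>jL(j)) k\<^bsup>-L(0)\<^esup>\<close> commutes with \<open>\<Sum>c\<^sub>jL(j)\<close>.\<close>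

lemma adflow_fxi:
  assumes "Delta_coeffs k a" and "k > 0"
  shows "adflow (fps_const (1 / of_nat k) * (fxi oo (fps_const (of_nat k) * fps_X))) = fxi"
proof -
  define K :: complex where "K = of_nat k"
  define h where "h = fps_const (1 / K) * (fxi oo (fps_const K * fps_X))"
  have K: "K \<noteq> 0" using assms by (simp add: K_def)
  have X: "flow fps_X = fps_const (1 / K) * (fps_binomial K - 1)"
    using Delta_coeffs_flow[OF assms(1)] by (simp add: K_def)
  have "fps_const K * fps_X oo flow fps_X = fps_binomial K - 1"
    using K by (simp add: X fps_compose_mult_distrib)
  moreover have "(fxi oo (fps_const K * fps_X)) oo flow fps_X = fxi oo (fps_const K * fps_X oo flow fps_X)"
    by (rule fps_compose_assoc[symmetric]) (simp_all add: X)
  ultimately have "flow h = fps_const (1 / K) * (fxi oo (fps_binomial K - 1))"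
    by (simp add: h_def flow_scale flow_compose[of "fxi oo _"])
  also have "\<dots> = (fps_const (1 / K) * fps_const K) * (fps_binomial K * fln)"
    using fps_binomial_compose[of 1 K] fln_compose[of K]
    by (simp add: fxi_def fps_compose_mult_distrib mult.left_commute del: fps_const_mult)
  also have "\<dots> = fps_binomial K * fln"
    using K by simp
  also have "\<dots> = fxi * fps_binomial (K - 1)"
    using fps_binomial_add_mult[of 1 "K - 1"] by (simp add: fxi_def mult_ac)
  \<comment> \<open>With \<open>f = fps_X\<close> the left side of \<open>adflow_flow_deriv\<close>
    is \<open>flow h\<close> itself. Having computed it by substitution, one recovers
    \<open>adflow h\<close> by cancelling \<open>(1 + x)^(K-1)\<close>.\<close>
  finally have "fxi * fps_binomial (K - 1) = adflow h * fps_deriv (flow fps_X)"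
    using adflow_flow_deriv[of fps_X h] by simp
  also have "fps_deriv (flow fps_X) = fps_binomial (K - 1)"
    using K by (simp add: X fps_deriv_binomial)
  finally show ?thesis
    by (simp add: h_def K_def)
qed

end

section \<open>Delta functions and the commutator formula\<close>

lemma Sum_any_single:
  assumes "\<And>y. y \<noteq> x \<Longrightarrow> f y = 0"
  shows "Sum_any f = f x"
proof -
  have "f = (\<lambda>y. if y = x then f y else 0)"
    using assms by auto
  then show ?thesis
    by (metis (mono_tags, lifting) Sum_any.delta)
qed

lemma Sum_any_inj_image:
  assumes "inj_on h A" "finite A" "\<And>y. y \<notin> h ` A \<Longrightarrow> f y = 0"
  shows "Sum_any f = (\<Sum>i\<in>A. f (h i))"
proof -
  have "Sum_any f = sum f (h ` A)"
    by (rule Sum_any.expand_superset) (use assms in auto)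
  then show ?thesis
    using assms by (simp add: sum.reindex)
qed

lemma fseries_image: "inj g \<Longrightarrow> fseries g f (g i) = f i"
  unfolding fseries_def by (subst Sum_any_single[of i]) (auto dest: injD)

lemma fseries_not_image: "e \<notin> range g \<Longrightarrow> fseries g f e = 0"
  unfolding fseries_def by (rule trans[OF Sum_any.cong Sum_any.neutral]) auto

lemma fmonom_times: "(fmonom c e0 \<star> B) e = c * B (e - e0)"
  unfolding fscale_def by (subst Sum_any_single[of e0]) (auto simp: fmonom_def)

lemma times_fmonom: "(A \<star> fmonom c e0) e = A (e - e0) * c"
  unfolding fscale_def by (subst Sum_any_single[of "e - e0"]) (auto simp: fmonom_def)

section \<open>Coefficients of the binomial expansions and delta functions\<close>

lemma inj_diff_pow_exponent:
  "inj (\<lambda>i::nat. X1 (r - of_nat i) + X0 (of_nat i))"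
  "inj (\<lambda>i::nat. X1 (r - of_nat i) + X2 (of_nat i))"
  "inj (\<lambda>i::nat. X2 (r - of_nat i) + X1 (of_nat i))"
  by (auto simp: inj_def X0_def X1_def X2_def)

lemma diff_pow_10:
  "diff_pow X1 X0 r (of_nat i, r - of_nat i, 0) = (r gchoose i) * (-1) ^ i"
  using fseries_image[OF inj_diff_pow_exponent(1)[of r], of "\<lambda>i. (r gchoose i) * (-1) ^ i" i]
  by (simp add: diff_pow_def X0_def X1_def)

lemma diff_pow_10_support:
  assumes "diff_pow X1 X0 r (a, b, c) \<noteq> 0"
  obtains i where "a = of_nat i" "b = r - of_nat i" "c = 0"
  using assms fseries_not_image[of "(a, b, c)" "\<lambda>i. X1 (r - of_nat i) + X0 (of_nat i)"
      "\<lambda>i. (r gchoose i) * (-1) ^ i"]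
  by (auto simp: diff_pow_def X0_def X1_def)

lemma diff_pow_12: "diff_pow X1 X2 n (a, b, c) = 0" if "a \<noteq> 0"
  using that by (auto simp: diff_pow_def X2_def X1_def intro!: fseries_not_image)

lemma diff_pow_21: "diff_pow X2 X1 n (a, b, c) = 0" if "a \<noteq> 0"
  using that by (auto simp: diff_pow_def X2_def X1_def intro!: fseries_not_image)

lemma diff_pow_zero: "diff_pow y z 0 = fmonom 1 (y 0 + z 0)"
proof
  fix e
  have "diff_pow y z 0 e = Sum_any (\<lambda>i::nat. if y (0 - of_nat i) + z (of_nat i) = e then (0 gchoose i) * (-1) ^ i else 0)"
    by (simp add: diff_pow_def fseries_def)
  also have "\<dots> = fmonom 1 (y 0 + z 0) e"
    by (subst Sum_any_single[of 0]) (auto simp: fmonom_def gbinomial_0_left)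
  finally show "diff_pow y z 0 e = fmonom 1 (y 0 + z 0) e" .
qed

lemma root_delta_nth:
  "root_delta k (a, b, c) =
     (1 / of_nat k) * Sum_any (\<lambda>n. diff_pow X1 X0 (of_int n / of_nat k) (a, b, c + 1 + of_int n / of_nat k))"
  by (simp add: root_delta_def fmonom_times fdelta_def times_fmonom X2_def)

text \<open>All monomials have total degree -1, so once the powers of \<open>x0\<close> and
  \<open>x1\<close> are fixed, at most one power of \<open>x2\<close> is left.\<close>

lemma root_delta_support:
  assumes "root_delta k (a, b, c) \<noteq> 0"
  obtains i n where "a = of_nat i" "b = of_int n / of_nat k - of_nat i" "c = -1 - of_int n / of_nat k"
proof -
  obtain n where "diff_pow X1 X0 (of_int n / of_nat k) (a, b, c + 1 + of_int n / of_nat k) \<noteq> 0"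
    using assms unfolding root_delta_nth
    by (metis (no_types, lifting) Sum_any.not_neutral_obtains_not_neutral mult_zero_right)
  then show ?thesis
    by (rule diff_pow_10_support) (use that in \<open>auto simp: algebra_simps add_eq_0_iff\<close>)
qed

lemma root_delta_eq:
  assumes "k > 0"
  shows "root_delta k (of_nat i, of_int n / of_nat k - of_nat i, -1 - of_int n / of_nat k)
     = (1 / of_nat k) * (((of_int n / of_nat k) gchoose i) * (-1) ^ i)"
proof -
  have "diff_pow X1 X0 (of_int m / of_nat k)
      (of_nat i, of_int n / of_nat k - of_nat i, -1 - of_int n / of_nat k + 1 + of_int m / of_nat k) = 0"
    if "m \<noteq> n" for m
    by (rule ccontr, erule diff_pow_10_support) (use that assms in \<open>auto simp: field_simps\<close>)
  then show ?thesis
    unfolding root_delta_nth by (subst Sum_any_single[of n]) (simp_all add: diff_pow_10)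
qed

text \<open>Coefficientwise form of
  \<open>(x1 - x0)^r (x1 - x0)^s = (x1 - x0)^(r+s)\<close>.\<close>

lemma gbinomial_Vandermonde_signed:
  fixes r s :: complex
  shows "(\<Sum>j\<le>i. (r gchoose (i - j)) * (-1) ^ (i - j) * ((s gchoose j) * (-1) ^ j)) = ((r + s) gchoose i) * (-1) ^ i"
proof -
  have "(\<Sum>j\<le>i. (r gchoose (i - j)) * (-1) ^ (i - j) * ((s gchoose j) * (-1) ^ j))
      = (\<Sum>j\<le>i. (s gchoose j) * (r gchoose (i - j)) * (-1) ^ i)"
    by (intro sum.cong refl) (simp add: mult_ac flip: power_add)
  also have "\<dots> = ((r + s) gchoose i) * (-1) ^ i"
    using gbinomial_Vandermonde[of s r i] by (simp add: atLeast0AtMost add.commute flip: sum_distrib_right)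
  finally show ?thesis .
qed

lemma quot_pow_support:
  assumes "quot_pow s (a, b, c) \<noteq> 0"
  obtains j where "a = of_nat j" "b = s - of_nat j" "c = - s"
proof -
  have "diff_pow X1 X0 s (a, b, c + s) \<noteq> 0"
    using assms by (simp add: quot_pow_def times_fmonom X2_def)
  then show ?thesis
    by (rule diff_pow_10_support) (use that in \<open>auto simp: add_eq_0_iff2 add_eq_0_iff\<close>)
qed

lemma quot_pow_eq: "quot_pow s (of_nat j, s - of_nat j, - s) = (s gchoose j) * (-1) ^ j"
  by (simp add: quot_pow_def times_fmonom X2_def diff_pow_10)

lemma delta_quot_support:
  assumes "(root_delta k \<star> quot_pow s) (a, b, c) \<noteq> 0"
  obtains i n where "a = of_nat i" "b = of_int n / of_nat k + s - of_nat i" "c = -1 - of_int n / of_nat k - s"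
proof -
  obtain d where d: "root_delta k d * quot_pow s ((a, b, c) - d) \<noteq> 0"
    using assms unfolding fscale_def by (rule Sum_any.not_neutral_obtains_not_neutral)
  obtain a' b' c' where d': "d = (a', b', c')" by (cases d) auto
  from d have *: "root_delta k (a', b', c') \<noteq> 0" "quot_pow s (a - a', b - b', c - c') \<noteq> 0"
    by (auto simp: d')
  from *(1) obtain i n where
    1: "a' = of_nat i" "b' = of_int n / of_nat k - of_nat i" "c' = -1 - of_int n / of_nat k"
    by (rule root_delta_support)
  from *(2) obtain j where 2: "a - a' = of_nat j" "b - b' = s - of_nat j" "c - c' = - s"
    by (rule quot_pow_support)
  from 2 have "a = of_nat j + a'" "b = s - of_nat j + b'" "c = - s + c'"
    by (simp_all only: diff_eq_eq)
  with 1 show ?thesis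
    by (intro that[of "i + j" n]) simp_all
qed

text \<open>Apart from \<open>x2^(-1) / k\<close>, the \<open>n\<close>-th term of the delta
  function is a power of \<open>(x1 - x0) / x2\<close>; the quotient just adds \<open>s\<close> to
  its exponent.\<close>

lemma delta_quot_eq:
  assumes "k > 0"
  shows "(root_delta k \<star> quot_pow s)
      (of_nat i, of_int n / of_nat k + s - of_nat i, -1 - of_int n / of_nat k - s)
     = (1 / of_nat k) * (((of_int n / of_nat k + s) gchoose i) * (-1) ^ i)"
proof -
  define r :: complex where "r = of_int n / of_nat k"
  \<comment> \<open>The quotient takes \<open>x0^j\<close>; \<open>h j\<close> is the monomial of
    the delta function with the remaining \<open>x0^(i-j)\<close>.\<close>
  define h :: "nat \<Rightarrow> exp3" where "h = (\<lambda>j. (of_nat (i - j), r - of_nat (i - j), -1 - r))"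
  have "(root_delta k \<star> quot_pow s) (of_nat i, r + s - of_nat i, -1 - r - s)
      = (\<Sum>j\<le>i. root_delta k (h j) * quot_pow s ((of_nat i, r + s - of_nat i, -1 - r - s) - h j))"
    unfolding fscale_def
  proof (rule Sum_any_inj_image)
    show "inj_on h {..i}"
      by (auto simp: inj_on_def h_def)
    fix d assume d: "d \<notin> h ` {..i}"
    obtain a' b' c' where d': "d = (a', b', c')" by (cases d) auto
    show "root_delta k d * quot_pow s ((of_nat i, r + s - of_nat i, -1 - r - s) - d) = 0"
    proof (rule ccontr)
      assume "\<not> ?thesis"
      then have *: "root_delta k (a', b', c') \<noteq> 0"
        "quot_pow s (of_nat i - a', r + s - of_nat i - b', -1 - r - s - c') \<noteq> 0"
        by (auto simp: d')
      from *(1) obtain i' n' where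
        1: "a' = of_nat i'" "b' = of_int n' / of_nat k - of_nat i'" "c' = -1 - of_int n' / of_nat k"
        by (rule root_delta_support)
      from *(2) obtain j where 2: "of_nat i - a' = of_nat j"
        "r + s - of_nat i - b' = s - of_nat j" "-1 - r - s - c' = - s"
        by (rule quot_pow_support)
      have "of_nat i = (of_nat (i' + j) :: complex)"
        using 1 2 by (simp add: algebra_simps)
      then have i: "i = i' + j"
        by (simp only: of_nat_eq_iff)
      have "d = h j"
        using 1 2 i by (simp add: d' h_def algebra_simps)
      then show False using d i by auto
    qed
  qed auto
  also have "\<dots> = (\<Sum>j\<le>i. (1 / of_nat k) * ((r gchoose (i - j)) * (-1) ^ (i - j) * ((s gchoose j) * (-1) ^ j)))"
  proof (rule sum.cong[OF refl])
    fix j assume "j \<in> {..i}"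
    then have "(of_nat i, r + s - of_nat i, -1 - r - s) - h j = (of_nat j, s - of_nat j, - s)"
      by (simp add: h_def of_nat_diff)
    then show "root_delta k (h j) * quot_pow s ((of_nat i, r + s - of_nat i, -1 - r - s) - h j)
        = (1 / of_nat k) * ((r gchoose (i - j)) * (-1) ^ (i - j) * ((s gchoose j) * (-1) ^ j))"
      using root_delta_eq[OF assms, of "i - j" n] by (simp add: quot_pow_eq h_def r_def)
  qed
  also have "\<dots> = (1 / of_nat k) * (((r + s) gchoose i) * (-1) ^ i)"
    by (simp only: gbinomial_Vandermonde_signed flip: sum_distrib_left)
  finally show ?thesis
    by (simp add: r_def)
qed

text \<open>Under the residue, \<open>x0^i\<close> from the kernel meets \<open>x0^(-1-i)\<close>
  from \<open>Y(u, x0)\<close>, which carries the mode \<open>i\<close>. Truncation leaves finitely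
  many.\<close>

lemma fscale_iterate02:
  assumes "vector_space sM"
    and K: "\<And>a c. K (a, b, c) \<noteq> 0 \<Longrightarrow> \<exists>i::nat. a = of_nat i \<and> c = - 1 - b - of_nat i"
    and F: "\<And>c. F 0 c w = 0"
    and Y: "\<And>i. i \<ge> I \<Longrightarrow> Y u (int i) v = 0"
  shows "fscale sM K (iterate02 F Y u v w) (-1, b, c)
    = (\<Sum>i<I. sM (K (of_nat i, b, - 1 - b - of_nat i)) (F (Y u (int i) v) (c + 1 + b + of_nat i) w))"
proof -
  interpret vector_space sM by fact
  have vf: "vertex_field Y u (- 1 - of_nat i) v = Y u (int i) v" for i
  proof -
    have "(- 1 - of_nat i :: complex) = - of_int (int i) - 1"
      by simp
    then show ?thesis
      unfolding vertex_field_def by (simp only:) (rule fseries_image, simp add: inj_def)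
  qed
  define h :: "nat \<Rightarrow> exp3" where "h = (\<lambda>i. (of_nat i, b, - 1 - b - of_nat i))"
  have "fscale sM K (iterate02 F Y u v w) (-1, b, c)
      = (\<Sum>i<I. sM (K (h i)) (iterate02 F Y u v w ((-1, b, c) - h i)))"
    unfolding fscale_def
  proof (rule Sum_any_inj_image)
    show "inj_on h {..<I}"
      by (auto simp: inj_on_def h_def)
    fix d assume d: "d \<notin> h ` {..<I}"
    obtain a' b' c' where d': "d = (a', b', c')" by (cases d) auto
    show "sM (K d) (iterate02 F Y u v w ((-1, b, c) - d)) = 0"
    proof (cases "b' = b \<and> K d \<noteq> 0")
      case True
      with K[of a' c'] obtain i where i: "d = h i"
        by (auto simp: d' h_def)
      with d have "i \<ge> I" by force
      then show ?thesis
        using vf[of i] Y[of i] F by (simp add: i h_def iterate02_def)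
    qed (auto simp: d' iterate02_def)
  qed auto
  also have "\<dots> = (\<Sum>i<I. sM (K (of_nat i, b, - 1 - b - of_nat i)) (F (Y u (int i) v) (c + 1 + b + of_nat i) w))"
    using vf by (simp add: h_def iterate02_def algebra_simps)
  finally show ?thesis .
qed

lemma fscale_prod_single:
  assumes "vector_space sM"
    and K: "\<And>b c. K (-1, b, c) = (if b = 0 \<and> c = 0 then 1 else 0)"
    and B: "\<And>a b c. a \<noteq> 0 \<Longrightarrow> B (a, b, c) = 0"
  shows "fscale sM K B (-1, b, c) = B (0, b, c)"
proof -
  interpret vector_space sM by fact
  have "sM (K d) (B ((-1, b, c) - d)) = 0" if "d \<noteq> (-1, 0, 0)" for d
  proof -
    obtain a' b' c' where d: "d = (a', b', c')" by (cases d) auto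
    show ?thesis
    proof (cases "a' = -1")
      case True
      then show ?thesis using that by (auto simp: d K)
    next
      case False
      then have "B (-1 - a', b - b', c - c') = 0"
        by (intro B) simp
      then show ?thesis by (simp add: d)
    qed
  qed
  then show ?thesis
    unfolding fscale_def by (subst Sum_any_single[of "(-1, 0, 0)"]) (auto simp: K)
qed

text \<open>This is the residue in \<open>x0\<close> of the Jacobi identity. In the coefficient of
  \<open>x0^(-1)\<close> the two kernels on the left reduce to their terms \<open>n = 0\<close>,
  which are 1, and the kernel on the right is \<open>root_delta 1\<close>.\<close>

lemma jacobi_commutator:
  assumes "vector_space sM" and J: "jacobi sM Y YM p q u v w"
    and YM0: "\<And>n. YM 0 n w = 0"
    and Y: "\<And>i. i \<ge> I \<Longrightarrow> Y u (int i) v = 0"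
  shows "YM u m (YM v n w) - sM ((-1) ^ (p * q)) (YM v n (YM u m w))
    = (\<Sum>i<I. sM (of_int m gchoose i) (YM (Y u (int i) v) (m + n - int i) w))"
proof -
  interpret vector_space sM by fact
  define K1 where "K1 = fmonom 1 (X0 (-1)) \<star>
          fdelta (\<lambda>n. diff_pow X1 X2 (of_int n) \<star> fmonom 1 (X0 (- of_int n)))"
  define K2 where "K2 = fmonom 1 (X0 (-1)) \<star>
          fdelta (\<lambda>n. diff_pow X2 X1 (of_int n) \<star> fmonom ((-1) powi (- n)) (X0 (- of_int n)))"
  define b c :: complex where "b = - of_int m - 1" and "c = - of_int n - 1"
  have vf: "vertex_field YM u' (- of_int n' - 1) w' = YM u' n' w'" for u' n' w'
    using fseries_image[of "\<lambda>n. - of_int n - 1 :: complex" "\<lambda>n. YM u' n w'" n']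
    by (simp add: vertex_field_def inj_def)
  have vf0: "vertex_field YM 0 e w = 0" for e
    by (simp add: vertex_field_def fseries_def YM0 cong: if_cong)
  have K1: "K1 (-1, b, c) = (if b = 0 \<and> c = 0 then 1 else 0)" for b c
  proof -
    have "K1 (-1, b, c) = Sum_any (\<lambda>n. diff_pow X1 X2 (of_int n) (of_int n, b, c))"
      by (simp add: K1_def fmonom_times X0_def fdelta_def times_fmonom)
    also have "\<dots> = (if b = 0 \<and> c = 0 then 1 else 0)"
      by (subst Sum_any_single[of 0])
         (auto simp: diff_pow_12 diff_pow_zero fmonom_def X1_def X2_def zero_prod_def)
    finally show ?thesis .
  qed
  have K2: "K2 (-1, b, c) = (if b = 0 \<and> c = 0 then 1 else 0)" for b c
  proof -
    have "K2 (-1, b, c) = Sum_any (\<lambda>n. diff_pow X2 X1 (of_int n) (of_int n, b, c) * (-1) powi (- n))"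
      by (simp add: K2_def fmonom_times X0_def fdelta_def times_fmonom)
    also have "\<dots> = (if b = 0 \<and> c = 0 then 1 else 0)"
      by (subst Sum_any_single[of 0])
         (auto simp: diff_pow_21 diff_pow_zero fmonom_def X1_def X2_def zero_prod_def)
    finally show ?thesis .
  qed
  have K3: "fmonom 1 (X2 (-1)) \<star>
          fdelta (\<lambda>n. diff_pow X1 X0 (of_int n) \<star> fmonom 1 (X2 (- of_int n))) = root_delta 1"
    by (simp add: root_delta_def)
  have supp: "\<exists>i::nat. a = of_nat i \<and> c = - 1 - b - of_nat i" if "root_delta 1 (a, b, c) \<noteq> 0" for a b c
    using that by (rule root_delta_support) auto
  \<comment> \<open>The mode \<open>m\<close> sits at \<open>x1^b\<close> with
    \<open>b = -m-1\<close>, so the delta function enters through its term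
    \<open>n = i - m - 1\<close>; negating the upper index gives the usual binomial
    coefficient.\<close>
  have val: "root_delta 1 (of_nat i, b, - 1 - b - of_nat i) = (of_int m gchoose i)" for i
  proof -
    have "root_delta 1 (of_nat i, b, - 1 - b - of_nat i) = (of_nat i - of_int m - 1 gchoose i) * (-1) ^ i"
    proof -
      have "b = of_int (int i - m - 1) / of_nat 1 - of_nat i"
        "- 1 - b - of_nat i = - 1 - of_int (int i - m - 1) / of_nat 1"
        by (simp_all add: b_def)
      then show ?thesis
        using root_delta_eq[of 1 i "int i - m - 1"] by (simp only:) simp
    qed
    also have "\<dots> = (of_int m gchoose i)"
      by (subst gbinomial_negated_upper[of "of_int m"]) simp
    finally show ?thesis .
  qed
  have "fscale sM K1 (prod12 (vertex_field YM) u v w) (-1, b, c)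
      - sM ((-1) ^ (p * q)) (fscale sM K2 (prod21 (vertex_field YM) u v w) (-1, b, c))
      = fscale sM (root_delta 1) (iterate02 (vertex_field YM) Y u v w) (-1, b, c)"
    by (rule J[unfolded jacobi_def K3 K1_def[symmetric] K2_def[symmetric], rule_format])
  also have "fscale sM K1 (prod12 (vertex_field YM) u v w) (-1, b, c) = prod12 (vertex_field YM) u v w (0, b, c)"
    by (rule fscale_prod_single[OF \<open>vector_space sM\<close> K1]) (simp add: prod12_def)
  also have "fscale sM K2 (prod21 (vertex_field YM) u v w) (-1, b, c) = prod21 (vertex_field YM) u v w (0, b, c)"
    by (rule fscale_prod_single[OF \<open>vector_space sM\<close> K2]) (simp add: prod21_def)
  also have "fscale sM (root_delta 1) (iterate02 (vertex_field YM) Y u v w) (-1, b, c)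
      = (\<Sum>i<I. sM (of_int m gchoose i) (vertex_field YM (Y u (int i) v) (c + 1 + b + of_nat i) w))"
    using fscale_iterate02[of sM "root_delta 1" b "vertex_field YM" w I Y u v c, OF \<open>vector_space sM\<close> supp vf0 Y]
    by (simp add: val del: One_nat_def)
  also have "\<dots> = (\<Sum>i<I. sM (of_int m gchoose i) (YM (Y u (int i) v) (m + n - int i) w))"
  proof (rule sum.cong[OF refl])
    fix i
    have "c + 1 + b + of_nat i = - of_int (m + n - int i) - 1"
      by (simp add: b_def c_def)
    then show "sM (of_int m gchoose i) (vertex_field YM (Y u (int i) v) (c + 1 + b + of_nat i) w)
       = sM (of_int m gchoose i) (YM (Y u (int i) v) (m + n - int i) w)"
      by (simp only: vf)
  qed
  finally show ?thesis
    by (simp add: prod12_def prod21_def b_def c_def vf)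
qed

section \<open>The action of vector fields on vertex operators\<close>

text \<open>The index \<open>r\<close> records how far the weight is lowered in total. Working one
  \<open>r\<close> at a time turns identities between infinite sums of operators into finite ones,
  and reordering into associativity and commutativity of this sum.\<close>

definition conv :: "nat \<Rightarrow> (nat \<Rightarrow> nat \<Rightarrow> 'a) \<Rightarrow> 'a::comm_monoid_add" where
  "conv r g = (\<Sum>i\<le>r. g i (r - i))"

lemma conv_cong: "(\<And>i j. i + j = r \<Longrightarrow> g i j = h i j) \<Longrightarrow> conv r g = conv r h"
  unfolding conv_def by (intro sum.cong refl) auto

lemma conv_assoc:
  "conv r (\<lambda>i m. conv m (\<lambda>j l. g i j l)) = conv r (\<lambda>m l. conv m (\<lambda>i j. g i j l))"
proof -
  have "conv r (\<lambda>i m. conv m (\<lambda>j l. g i j l)) = (\<Sum>n\<le>r. \<Sum>i\<le>n. g i (n - i) (r - i - (n - i)))"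
    unfolding conv_def by (rule sum_triangle)
  also have "\<dots> = conv r (\<lambda>m l. conv m (\<lambda>i j. g i j l))"
    unfolding conv_def by (intro sum.cong refl) auto
  finally show ?thesis .
qed

lemma conv_commute: "conv r g = conv r (\<lambda>i j. g j i)"
  unfolding conv_def by (rule sum.reindex_bij_witness[where i="\<lambda>i. r - i" and j="\<lambda>i. r - i"]) auto

lemma conv_swap:
  "conv r (\<lambda>i m. conv m (\<lambda>j l. g i j l)) = conv r (\<lambda>j m. conv m (\<lambda>i l. g i j l))"
  unfolding conv_assoc by (subst (2) conv_commute) (rule refl)

lemma conv_add: "conv r (\<lambda>i j. g i j + h i j) = conv r g + conv r h"
  by (simp add: conv_def sum.distrib)

lemma conv_diff: "conv r (\<lambda>i j. g i j - h i j) = conv r g - conv r h" for g :: "_ \<Rightarrow> _ \<Rightarrow> 'a::ab_group_add"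
  by (simp add: conv_def sum_subtractf)

lemma conv_sum: "conv r (\<lambda>i j. \<Sum>l\<in>A. g l i j) = (\<Sum>l\<in>A. conv r (g l))"
  unfolding conv_def by (rule sum.swap)

lemma conv_delta: "conv r (\<lambda>i j. if i = 0 then g j else 0) = g r"
proof -
  have "conv r (\<lambda>i j. if i = 0 then g j else 0) = (\<Sum>i\<le>r. if i = 0 then g r else 0)"
    unfolding conv_def by (intro sum.cong) auto
  then show ?thesis by simp
qed

lemma conv_Suc_Suc:
  fixes g :: "nat \<Rightarrow> nat \<Rightarrow> 'b::comm_monoid_add"
  assumes "g 0 (Suc (Suc r)) = 0" "g (Suc (Suc r)) 0 = 0"
  shows "conv (Suc (Suc r)) g = conv r (\<lambda>i j. g (Suc i) (Suc j))"
proof -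
  have "conv (Suc (Suc r)) g = g 0 (Suc (Suc r)) + (\<Sum>i\<le>r. g (Suc i) (Suc r - i)) + g (Suc (Suc r)) 0"
    unfolding conv_def sum.atMost_Suc_shift[of _ "Suc r"] by (simp add: add.assoc)
  also have "(\<Sum>i\<le>r. g (Suc i) (Suc r - i)) = conv r (\<lambda>i j. g (Suc i) (Suc j))"
    unfolding conv_def by (intro sum.cong refl) (simp add: Suc_diff_le)
  finally show ?thesis using assms by simp
qed

lemma fps_mult_nth_conv: "(f * g) $ n = conv n (\<lambda>i j. f $ i * g $ j)"
  by (simp add: fps_mult_nth conv_def atLeast0AtMost)

lemma internal_direct_sum_component:
  assumes "internal_direct_sum sc I W U" "i \<in> I" "x \<in> W i"
  shows "x \<in> U"
proof -
  have "x = (\<Sum>j\<in>{i}. x)" by simp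
  then show ?thesis
    using assms unfolding internal_direct_sum_def by blast
qed

context vector_space
begin

lemma conv_scale: "conv r (\<lambda>i j. scale x (g i j)) = scale x (conv r g)"
  by (simp add: conv_def scale_sum_right)

lemma conv_scale_left: "conv r (\<lambda>i j. scale (g i j) x) = scale (conv r g) x"
  by (simp add: conv_def scale_sum_left)

end

context vertex_operator_superalgebra
begin

sublocale Yr: Vector_Spaces.linear sV sV "Y u n" for u n
  by (rule Y_linear_right)

sublocale Yl: Vector_Spaces.linear sV sV "\<lambda>u. Y u n w" for n w
  by (rule Y_linear_left)

lemma Yr_conv: "Y u n (conv r g) = conv r (\<lambda>i j. Y u n (g i j))"
  by (simp add: conv_def Yr.sum)

lemma Yl_conv: "Y (conv r g) n w = conv r (\<lambda>i j. Y (g i j) n w)"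
  by (simp add: conv_def Yl.sum)

abbreviation L :: "nat \<Rightarrow> 'v \<Rightarrow> 'v" where "L j \<equiv> Y \<omega> (int j + 1)"

lemma omega_even: "\<omega> \<in> P 0"
  using internal_direct_sum_component[OF parity_weight[of 0], of 4 \<omega>] omega_weight by simp

lemma parity_cases:
  obtains u0 u1 where "u0 \<in> P 0" "u1 \<in> P 1" "u = u0 + u1"
proof -
  have "u \<in> {\<Sum>i\<in>F. f i | F f. finite F \<and> F \<subseteq> {0, 1} \<and> (\<forall>i\<in>F. f i \<in> P i)}"
    using par_direct_sum unfolding internal_direct_sum_def by auto
  then obtain F f where F: "finite F" "F \<subseteq> {0, 1}" "\<forall>i\<in>F. f i \<in> P i" and u: "u = (\<Sum>i\<in>F. f i)"
    by auto
  define g where "g i = (if i \<in> F then f i else 0)" for i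
  have "u = (\<Sum>i\<in>{0, 1}. g i)"
    unfolding u g_def using F by (intro sum.mono_neutral_cong_left) auto
  moreover have "0 \<in> P i" if "i \<in> {0, 1}" for i
    using par_direct_sum that unfolding internal_direct_sum_def by (auto intro: subspace_0)
  then have "g 0 \<in> P 0" "g 1 \<in> P 1"
    using F(3) by (auto simp: g_def)
  ultimately show ?thesis
    using that by simp
qed

text \<open>Among nonnegative modes the central term could only occur for \<open>m = n = 0\<close>,
  where \<open>m^3 - m\<close> vanishes.\<close>

lemma L_comm: "L m (L n v) - L n (L m v) = sV (of_nat m - of_nat n) (L (m + n) v)"
  using virasoro[of "int m" "int n" v] by (cases "m + n = 0") (auto simp: add_ac)

lemma L_minus_1: "Y (Y \<omega> 0 u) n w = sV (- of_int n) (Y u (n - 1) w)"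
proof -
  have vf: "vertex_field Y u' (- of_int n' - 1) w = Y u' n' w" for u' n'
    using fseries_image[of "\<lambda>n. - of_int n - 1 :: complex" "\<lambda>n. Y u' n w" n']
    by (simp add: vertex_field_def inj_def)
  have "- of_int n - 1 + 1 = - of_int (n - 1) - (1 :: complex)"
    by simp
  with L_derivative[of "- of_int n - 1" u w] show ?thesis
    by (simp only: vf) (simp add: scale_minus_left)
qed

text \<open>The commutator formula with the even vector \<open>\<omega>\<close> on the left has no
  sign, so it extends from homogeneous \<open>u\<close> to all \<open>u\<close> by
  linearity.\<close>

lemma L_Y_comm_choose:
  "L j (Y u n v) - Y u n (L j v)
     = (\<Sum>i\<le>Suc j. sV (of_nat (Suc j choose i)) (Y (Y \<omega> (int i) u) (int j + 1 + n - int i) v))"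
proof -
  have *: "L j (Y u n v) - Y u n (L j v)
     = (\<Sum>i\<le>Suc j. sV (of_nat (Suc j choose i)) (Y (Y \<omega> (int i) u) (int j + 1 + n - int i) v))"
    if "q \<in> {0, 1}" "u \<in> P q" for q u
  proof -
    obtain N where N: "\<forall>n\<ge>N. Y \<omega> n u = 0"
      using truncation by blast
    \<comment> \<open>Beyond \<open>N\<close> the modes vanish, beyond \<open>j + 1\<close> the
      binomial coefficients; the cut has to respect both.\<close>
    define I where "I = max (nat N) (j + 2)"
    have "L j (Y u n v) - sV ((-1) ^ (0 * q)) (Y u n (L j v))
      = (\<Sum>i<I. sV (of_int (int j + 1) gchoose i) (Y (Y \<omega> (int i) u) (int j + 1 + n - int i) v))"
    proof (rule jacobi_commutator[of sV Y Y 0 q \<omega> u v I "int j + 1" n])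
      show "vector_space sV" by (rule vector_space_axioms)
      show "jacobi sV Y Y 0 q \<omega> u v"
        using that omega_even by (intro jacobi_identity) auto
      show "Y 0 n v = 0" for n by (rule Yl.zero)
      show "Y \<omega> (int i) u = 0" if "i \<ge> I" for i
        using N that by (auto simp: I_def)
    qed
    also have "\<dots> = (\<Sum>i<I. sV (of_nat (Suc j choose i)) (Y (Y \<omega> (int i) u) (int j + 1 + n - int i) v))"
      by (intro sum.cong refl arg_cong[where f="\<lambda>x. sV x _"]) (simp add: binomial_gbinomial add_ac)
    also have "\<dots> = (\<Sum>i\<le>Suc j. sV (of_nat (Suc j choose i)) (Y (Y \<omega> (int i) u) (int j + 1 + n - int i) v))"
      by (rule sum.mono_neutral_right) (auto simp: I_def)
    finally show ?thesis by simp
  qed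
  obtain u0 u1 where u: "u0 \<in> P 0" "u1 \<in> P 1" "u = u0 + u1"
    by (rule parity_cases)
  show ?thesis
    using *[of 0 u0] *[of 1 u1] u
    by (simp add: Yl.add Yr.add scale_right_distrib sum.distrib algebra_simps del: sum.atMost_Suc binomial_Suc_Suc)
qed

text \<open>The summand \<open>i = 0\<close> of the preceding formula contains
  \<open>L(-1) u\<close>, which the derivative property turns into a multiple of a mode of
  \<open>u\<close>.\<close>

lemma L_Y_comm:
  "L j (Y u (int n) v) - Y u (int n) (L j v)
     = sV (- of_nat (Suc (j + n))) (Y u (int (j + n)) v)
       + (\<Sum>i\<le>j. sV (of_nat (Suc j choose Suc i)) (Y (L i u) (int (j + n) - int i) v))"
proof -
  have "L j (Y u (int n) v) - Y u (int n) (L j v)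
      = Y (Y \<omega> 0 u) (int j + 1 + int n) v
        + (\<Sum>i\<le>j. sV (of_nat (Suc j choose Suc i)) (Y (Y \<omega> (int (Suc i)) u) (int j + 1 + int n - int (Suc i)) v))"
    unfolding L_Y_comm_choose sum.atMost_Suc_shift by simp
  also have "Y (Y \<omega> 0 u) (int j + 1 + int n) v = sV (- of_nat (Suc (j + n))) (Y u (int (j + n)) v)"
    unfolding L_minus_1 by (simp add: algebra_simps)
  finally show ?thesis
    by (simp add: algebra_simps)
qed

abbreviation cx :: "nat \<Rightarrow> complex" where "cx j \<equiv> fxi $ Suc j"

text \<open>The \<open>L(-1)\<close> terms add up to \<open>- (fxi f)'\<close>. In the others, the
  factors in front of a fixed \<open>L(l) u\<close> are Taylor coefficients of \<open>fxi\<close>,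
  which \<open>fxi_taylor\<close> resums; its extra logarithm for \<open>l = 0\<close> meets
  \<open>L(0) u\<close> and gives \<open>b fln f\<close>.\<close>

lemma fsharp_bracket:
  assumes u: "L 0 u = sV b u"
  shows "conv r (\<lambda>j i. sV (cx j * f $ i) (L j (Y u (int i) v)))
    = conv r (\<lambda>j i. sV (cx j * f $ i) (Y u (int i) (L j v)))
      + sV (fsharp b f $ r) (Y u (int r) v)
      + conv r (\<lambda>j i. sV (cx j * (fps_binomial (- of_nat j) * f) $ i) (Y (L j u) (int i) v))"
proof -
  have "conv r (\<lambda>j i. sV (cx j * f $ i) (L j (Y u (int i) v)))
      - conv r (\<lambda>j i. sV (cx j * f $ i) (Y u (int i) (L j v)))
      = conv r (\<lambda>j i. sV (cx j * f $ i) (L j (Y u (int i) v) - Y u (int i) (L j v)))"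
    by (simp add: scale_right_diff_distrib flip: conv_diff)
  also have "\<dots> = conv r (\<lambda>j i. sV (- of_nat (Suc r) * (cx j * f $ i)) (Y u (int r) v)
      + conv j (\<lambda>l m. sV (of_nat (Suc (m + l) choose Suc l) * cx (m + l) * f $ i) (Y (L l u) (int (r - l)) v)))"
  proof (rule conv_cong)
    fix j i assume r: "j + i = r"
    have "(\<Sum>l\<le>j. sV (cx j * f $ i) (sV (of_nat (Suc j choose Suc l)) (Y (L l u) (int (j + i) - int l) v)))
      = conv j (\<lambda>l m. sV (of_nat (Suc (m + l) choose Suc l) * cx (m + l) * f $ i) (Y (L l u) (int (r - l)) v))"
      unfolding conv_def using r
      by (intro sum.cong refl) (auto simp: of_nat_diff mult_ac simp del: binomial_Suc_Suc)
    then show "sV (cx j * f $ i) (L j (Y u (int i) v) - Y u (int i) (L j v))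
      = sV (- of_nat (Suc r) * (cx j * f $ i)) (Y u (int r) v)
      + conv j (\<lambda>l m. sV (of_nat (Suc (m + l) choose Suc l) * cx (m + l) * f $ i) (Y (L l u) (int (r - l)) v))"
      unfolding L_Y_comm scale_right_distrib scale_sum_right
      by (simp add: r mult_ac del: of_nat_Suc binomial_Suc_Suc)
  qed
  also have "\<dots> = conv r (\<lambda>j i. sV (- of_nat (Suc r) * (cx j * f $ i)) (Y u (int r) v))
     + conv r (\<lambda>l q. conv q (\<lambda>m i. sV (of_nat (Suc (m + l) choose Suc l) * cx (m + l) * f $ i) (Y (L l u) (int (r - l)) v)))"
    unfolding conv_add conv_assoc ..
  also have "conv r (\<lambda>j i. sV (- of_nat (Suc r) * (cx j * f $ i)) (Y u (int r) v))
      = sV (- (fps_deriv (fxi * f) $ r)) (Y u (int r) v)"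
  proof -
    have "(fxi * f) $ Suc r = conv r (\<lambda>j i. cx j * f $ i)"
      unfolding fps_mult_nth conv_def atLeast0AtMost sum.atMost_Suc_shift by simp
    then show ?thesis
      unfolding conv_scale_left by (simp add: conv_def sum_distrib_left sum_negf del: fps_deriv_mult of_nat_Suc)
  qed
  also have "conv r (\<lambda>l q. conv q (\<lambda>m i. sV (of_nat (Suc (m + l) choose Suc l) * cx (m + l) * f $ i) (Y (L l u) (int (r - l)) v)))
     = conv r (\<lambda>l q. (if l = 0 then sV ((fln * f) $ q) (Y (L 0 u) (int q) v) else 0)
         + sV (cx l * (fps_binomial (- of_nat l) * f) $ q) (Y (L l u) (int q) v))"
  proof (rule conv_cong)
    fix l q assume r: "l + q = r"
    have "conv q (\<lambda>m i. sV (of_nat (Suc (m + l) choose Suc l) * cx (m + l) * f $ i) (Y (L l u) (int (r - l)) v))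
      = sV (conv q (\<lambda>m i. ((if l = 0 then fln $ m else 0) + cx l * fps_binomial (- of_nat l) $ m) * f $ i)) (Y (L l u) (int q) v)"
      unfolding conv_scale_left fxi_taylor using r by auto
    also have "conv q (\<lambda>m i. ((if l = 0 then fln $ m else 0) + cx l * fps_binomial (- of_nat l) $ m) * f $ i)
       = (if l = 0 then (fln * f) $ q else 0) + cx l * (fps_binomial (- of_nat l) * f) $ q"
      unfolding fps_mult_nth_conv
      by (cases "l = 0") (simp_all only: if_True if_False conv_def sum.distrib sum_distrib_left distrib_right mult.assoc
          simp_thms mult_zero_left sum.neutral_const add_0)
    finally show "conv q (\<lambda>m i. sV (of_nat (Suc (m + l) choose Suc l) * cx (m + l) * f $ i) (Y (L l u) (int (r - l)) v))
      = (if l = 0 then sV ((fln * f) $ q) (Y (L 0 u) (int q) v) else 0)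
         + sV (cx l * (fps_binomial (- of_nat l) * f) $ q) (Y (L l u) (int q) v)"
      by (simp only: scale_left_distrib split: if_split) auto
  qed
  also have "\<dots> = sV (b * (fln * f) $ r) (Y u (int r) v)
      + conv r (\<lambda>l q. sV (cx l * (fps_binomial (- of_nat l) * f) $ q) (Y (L l u) (int q) v))"
    unfolding conv_add conv_delta u by (simp add: Yl.scale mult.commute)
  moreover have "fsharp b f $ r = b * (fln * f) $ r - fps_deriv (fxi * f) $ r"
    by (simp add: fsharp_def mult.assoc del: fps_deriv_mult fps_deriv_nth)
  ultimately show ?thesis
    by (simp add: scale_left_diff_distrib scale_minus_left diff_eq_eq add_ac del: fps_deriv_mult fps_deriv_nth)
qed

end

context vector_space
begin

lemma pascal_sum:
  "(\<Sum>l\<le>n. scale (of_nat (n choose l)) (S (Suc l) (n - l))) + (\<Sum>l\<le>n. scale (of_nat (n choose l)) (S l (Suc (n - l))))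
    = (\<Sum>l\<le>Suc n. scale (of_nat (Suc n choose l)) (S l (Suc n - l)))"
proof -
  have "(\<Sum>l\<le>n. scale (of_nat (n choose l)) (S (Suc l) (n - l)))
      = (\<Sum>l\<le>n. scale (of_nat (n choose l)) (S (Suc l) (Suc n - Suc l)))"
    by simp
  moreover have "(\<Sum>l\<le>n. scale (of_nat (n choose l)) (S l (Suc (n - l))))
      = (\<Sum>l\<le>Suc n. scale (of_nat (n choose l)) (S l (Suc n - l)))"
    by (simp add: Suc_diff_le binomial_eq_0)
  ultimately show ?thesis
    unfolding sum.atMost_Suc_shift by (simp add: scale_left_distrib sum.distrib add_ac)
qed

end

section \<open>Conjugating vector fields by the exponential of the \<open>L(j)\<close>\<close>

context vertex_operator_superalgebra
begin

text \<open>\<open>L(j)\<close> represents \<open>- z^(j+1) d/dz\<close>; this is the part of the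
  operator for \<open>- h d/dz\<close> that lowers the weight by \<open>j\<close>. Hence the offset
  by one in the coefficient.\<close>

definition R :: "complex fps \<Rightarrow> nat \<Rightarrow> 'v \<Rightarrow> 'v" where
  "R h j v = sV (h $ Suc j) (L j v)"

lemma R_conv: "R h n (conv r g) = conv r (\<lambda>i j. R h n (g i j))"
  by (simp add: R_def Yr_conv conv_scale)

lemma R_zero [simp]: "R h j 0 = 0"
  by (simp add: R_def)

lemma R_scale: "R h j (sV x v) = sV x (R h j v)"
  by (simp add: R_def Yr.scale mult.commute)

lemma R_sum: "R h j (sum f A) = (\<Sum>i\<in>A. R h j (f i))"
  by (simp add: R_def Yr.sum scale_sum_right)

lemma R_add: "R h j (x + y) = R h j x + R h j y"
  by (simp add: R_def Yr.add scale_right_distrib)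

text \<open>The Witt relations in generating form. The coefficient of degree \<open>r + 1\<close> is
  a convolution of degree \<open>r + 2\<close>, whose two end terms vanish with the constant terms;
  shifting both indices by one leaves \<open>i - j\<close> unchanged.\<close>

lemma R_bracket:
  assumes "f $ 0 = 0" "h $ 0 = 0"
  shows "conv r (\<lambda>i j. R f i (R h j v)) = conv r (\<lambda>i j. R h i (R f j v))
    + R (fps_deriv f * h - f * fps_deriv h) r v"
proof -
  have "conv r (\<lambda>i j. R f i (R h j v)) - conv r (\<lambda>i j. R h i (R f j v))
      = conv r (\<lambda>i j. R f i (R h j v) - R h j (R f i v))"
    by (subst (2) conv_commute) (simp add: conv_diff)
  also have "\<dots> = conv r (\<lambda>i j. sV (f $ Suc i * h $ Suc j * (of_nat i - of_nat j)) (L r v))"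
  proof (rule conv_cong)
    fix i j assume "i + j = r"
    then have "sV (f $ Suc i * h $ Suc j) (L i (L j v) - L j (L i v))
      = sV (f $ Suc i * h $ Suc j * (of_nat i - of_nat j)) (L r v)"
      unfolding L_comm by simp
    then show "R f i (R h j v) - R h j (R f i v) = sV (f $ Suc i * h $ Suc j * (of_nat i - of_nat j)) (L r v)"
      by (simp add: R_def Yr.scale scale_right_diff_distrib mult.commute)
  qed
  also have "\<dots> = R (fps_deriv f * h - f * fps_deriv h) r v"
  proof -
    have "(fps_deriv f * h) $ Suc r = conv (Suc (Suc r)) (\<lambda>i j. of_nat i * f $ i * h $ j)"
      unfolding fps_mult_nth conv_def atLeast0AtMost by (subst (2) sum.atMost_Suc_shift) simp
    moreover have "(f * fps_deriv h) $ Suc r = conv (Suc (Suc r)) (\<lambda>i j. f $ i * (of_nat j * h $ j))"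
    proof -
      have "(f * fps_deriv h) $ Suc r = (\<Sum>i\<le>Suc r. f $ i * (of_nat (Suc (Suc r) - i) * h $ (Suc (Suc r) - i)))"
        unfolding fps_mult_nth atLeast0AtMost by (intro sum.cong refl) (simp add: Suc_diff_le)
      then show ?thesis
        unfolding conv_def by simp
    qed
    ultimately have "(fps_deriv f * h - f * fps_deriv h) $ Suc r
       = conv (Suc (Suc r)) (\<lambda>i j. (of_nat i - of_nat j) * f $ i * h $ j)"
      by (simp add: algebra_simps flip: conv_diff)
    also have "\<dots> = conv r (\<lambda>i j. f $ Suc i * h $ Suc j * (of_nat i - of_nat j))"
      using assms by (simp add: conv_Suc_Suc mult_ac)
    finally show ?thesis
      unfolding R_def by (simp add: conv_scale_left del: fps_mult_nth_1)
  qed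
  finally show ?thesis
    by (simp add: algebra_simps)
qed

context
  fixes a :: "nat \<Rightarrow> complex"
begin

abbreviation Aop :: "nat \<Rightarrow> 'v \<Rightarrow> 'v" where
  "Aop \<equiv> (\<lambda>j v. if j = 0 then 0 else sV (a j) (Y \<omega> (int j + 1) v))"

text \<open>The part of \<open>exp(sum a_j L(j))\<close> that lowers the weight by \<open>N\<close>,
  without the powers of \<open>x\<close> and of \<open>\<kappa>\<close>.\<close>

definition T :: "nat \<Rightarrow> 'v \<Rightarrow> 'v" where
  "T N v = op_exp sV Aop N v"

lemma Aop_R: "Aop j v = R (fal a) j v"
  by (simp add: R_def fal_nth)

lemma op_power_Suc_conv: "op_power Aop (Suc n) N v = conv N (\<lambda>i m. R (fal a) i (op_power Aop n m v))"
  by (simp add: conv_def flip: Aop_R)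

lemma op_power_zero_below: "N < n \<Longrightarrow> op_power Aop n N v = 0"
proof (induction n arbitrary: N)
  case (Suc n)
  show ?case
    unfolding op_power_Suc_conv conv_def
  proof (rule sum.neutral, rule ballI)
    fix i assume "i \<in> {..N}"
    show "R (fal a) i (op_power Aop n (N - i) v) = 0"
    proof (cases "i = 0")
      case False
      then have "op_power Aop n (N - i) v = 0"
        using Suc.prems \<open>i \<in> {..N}\<close> by (intro Suc.IH) auto
      then show ?thesis by simp
    qed (simp add: R_def fal_nth)
  qed
qed simp

lemma op_power_linear: "Vector_Spaces.linear sV sV (op_power Aop n N)"
proof unfold_locales
  show "op_power Aop n N (x + y) = op_power Aop n N x + op_power Aop n N y" for x y
    by (induction n arbitrary: N) (simp_all add: op_power_Suc_conv R_add conv_add del: op_power.simps(2))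
  show "op_power Aop n N (sV c x) = sV c (op_power Aop n N x)" for c x
    by (induction n arbitrary: N) (simp_all add: op_power_Suc_conv R_scale conv_scale del: op_power.simps(2))
qed

lemma T_linear: "Vector_Spaces.linear sV sV (T N)"
proof -
  interpret op: Vector_Spaces.linear sV sV "op_power Aop n N" for n N
    by (rule op_power_linear)
  show ?thesis
    by unfold_locales (simp_all add: T_def op_exp_def op.add op.scale scale_right_distrib sum.distrib
        scale_sum_right mult.commute)
qed

interpretation T: Vector_Spaces.linear sV sV "T N" for N
  by (rule T_linear)

lemma T_0 [simp]: "T 0 v = v"
  by (simp add: T_def op_exp_def)

lemma T_upto:
  assumes "N \<le> K"
  shows "T N v = (\<Sum>n\<le>K. sV (1 / fact n) (op_power Aop n N v))"
  unfolding T_def op_exp_def using assms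
  by (intro sum.mono_neutral_left) (auto simp: op_power_zero_below simp del: op_power.simps)

text \<open>Iterating \<open>A R(h) = R(h) A + R(ad h)\<close>; the binomial coefficients arise from
  Pascal's rule.\<close>

lemma op_power_R:
  assumes h: "h $ 0 = 0"
  shows "conv r (\<lambda>N j. op_power Aop n N (R h j v))
    = (\<Sum>l\<le>n. sV (of_nat (n choose l)) (conv r (\<lambda>j N. R ((fad a ^^ l) h) j (op_power Aop (n - l) N v))))"
proof (induction n arbitrary: r)
  case 0
  have "conv r (\<lambda>N j. op_power Aop 0 N (R h j v)) = conv r (\<lambda>N j. if N = 0 then R h j v else 0)"
    by simp
  also have "\<dots> = conv r (\<lambda>j N. R h j (op_power Aop 0 N v))"
    by (subst conv_commute) (auto simp: if_distrib[of "R h _"] cong: if_cong)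
  finally show ?case by simp
next
  case (Suc n)
  let ?S = "\<lambda>r l m. conv r (\<lambda>j N. R ((fad a ^^ l) h) j (op_power Aop m N v))"
  have h0: "(fad a ^^ l) h $ 0 = 0" for l
    using fad_order[of 1 h 0 l a] h by simp
  have step: "conv r (\<lambda>i q. R (fal a) i (?S q l m)) = ?S r (Suc l) m + ?S r l (Suc m)" for l m
  proof -
    have "conv r (\<lambda>i q. R (fal a) i (?S q l m))
        = conv r (\<lambda>m' N. conv m' (\<lambda>i j. R (fal a) i (R ((fad a ^^ l) h) j (op_power Aop m N v))))"
      unfolding R_conv conv_assoc ..
    also have "\<dots> = conv r (\<lambda>m' N. conv m' (\<lambda>j i. R ((fad a ^^ l) h) j (R (fal a) i (op_power Aop m N v)))
        + R ((fad a ^^ Suc l) h) m' (op_power Aop m N v))"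
      by (intro conv_cong, subst R_bracket) (simp_all add: fal_nth h0 fad_def[of a "(fad a ^^ l) h"])
    also have "\<dots> = conv r (\<lambda>j m'. conv m' (\<lambda>i N. R ((fad a ^^ l) h) j (R (fal a) i (op_power Aop m N v))))
        + ?S r (Suc l) m"
      unfolding conv_add conv_assoc ..
    also have "conv r (\<lambda>j m'. conv m' (\<lambda>i N. R ((fad a ^^ l) h) j (R (fal a) i (op_power Aop m N v))))
        = ?S r l (Suc m)"
      unfolding op_power_Suc_conv R_conv ..
    finally show ?thesis by (simp add: add.commute)
  qed
  have "conv r (\<lambda>N j. op_power Aop (Suc n) N (R h j v))
      = conv r (\<lambda>i q. R (fal a) i (conv q (\<lambda>m j. op_power Aop n m (R h j v))))"
    unfolding op_power_Suc_conv R_conv conv_assoc ..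
  also have "\<dots> = (\<Sum>l\<le>n. sV (of_nat (n choose l)) (conv r (\<lambda>i q. R (fal a) i (?S q l (n - l)))))"
    unfolding Suc.IH R_sum R_scale conv_sum conv_scale ..
  also have "\<dots> = (\<Sum>l\<le>n. sV (of_nat (n choose l)) (?S r (Suc l) (n - l)))
      + (\<Sum>l\<le>n. sV (of_nat (n choose l)) (?S r l (Suc (n - l))))"
    unfolding step scale_right_distrib sum.distrib ..
  also have "\<dots> = (\<Sum>l\<le>Suc n. sV (of_nat (Suc n choose l)) (?S r l (Suc n - l)))"
    by (rule pascal_sum)
  finally show ?case .
qed

text \<open>This is \<open>exp(A) R(h) exp(-A) = R(exp(ad A) h)\<close>, sorted by weight and with
  the inverse moved to the other side.\<close>

lemma T_R:
  assumes h: "h $ 0 = 0"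
  shows "conv r (\<lambda>N j. T N (R h j v)) = conv r (\<lambda>j N. R (adflow a h) j (T N v))"
proof -
  let ?S = "\<lambda>l m. conv r (\<lambda>j N. R ((fad a ^^ l) h) j (op_power Aop m N v))"
  \<comment> \<open>Each \<open>fad\<close> and each factor of the power lowers the weight further,
    so \<open>l + m\<close> cannot exceed \<open>r\<close>. This allows both indices to run up to
    \<open>r\<close> independently.\<close>
  have zero: "?S l m = 0" if "r < l + m" for l m
    unfolding conv_def
  proof (rule sum.neutral, rule ballI)
    fix j assume "j \<in> {..r}"
    show "R ((fad a ^^ l) h) j (op_power Aop m (r - j) v) = 0"
    proof (cases "j < l")
      case True
      then have "(fad a ^^ l) h $ Suc j = 0"
        using h by (intro fad_order[of 1]) auto
      then show ?thesis by (simp add: R_def)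
    next
      case False
      then have "r - j < m" using that \<open>j \<in> {..r}\<close> by auto
      then have "op_power Aop m (r - j) v = 0" by (rule op_power_zero_below)
      then show ?thesis by simp
    qed
  qed
  have R_ad: "R (adflow a h) j x = (\<Sum>l\<le>r. sV (1 / fact l) (R ((fad a ^^ l) h) j x))" if "j \<le> r" for j x
  proof -
    have "adflow a h $ Suc j = (\<Sum>l\<le>Suc r. (1 / fact l) * (fad a ^^ l) h $ Suc j)"
      unfolding adflow_def using that fad_order[of 0 h _ _ a]
      by (subst fps_diag_nth_le[where K="Suc r"]) auto
    also have "\<dots> = (\<Sum>l\<le>r. (1 / fact l) * (fad a ^^ l) h $ Suc j)"
      using fad_order[of 1 h "Suc j" "Suc r" a] that h by simp
    finally show ?thesis
      by (simp add: R_def scale_sum_left)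
  qed
  have "conv r (\<lambda>N j. T N (R h j v))
      = conv r (\<lambda>N j. \<Sum>n\<le>r. sV (1 / fact n) (op_power Aop n N (R h j v)))"
    by (rule conv_cong) (rule T_upto, simp)
  also have "\<dots> = (\<Sum>n\<le>r. sV (1 / fact n) (\<Sum>l\<le>n. sV (of_nat (n choose l)) (?S l (n - l))))"
    unfolding conv_sum conv_scale op_power_R[OF h] ..
  also have "\<dots> = (\<Sum>n\<le>r. \<Sum>l\<le>n. sV (1 / (fact l * fact (n - l))) (?S l (n - l)))"
    unfolding scale_sum_right
    by (intro sum.cong refl) (simp add: binomial_fact)
  also have "\<dots> = (\<Sum>l\<le>r. \<Sum>m\<le>r - l. sV (1 / (fact l * fact m)) (?S l m))"
    by (rule sum_triangle[symmetric])
  also have "\<dots> = (\<Sum>l\<le>r. \<Sum>m\<le>r. sV (1 / (fact l * fact m)) (?S l m))"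
  proof (rule sum.cong[OF refl], rule sum.mono_neutral_left)
    fix l assume "l \<in> {..r}"
    show "\<forall>m\<in>{..r} - {..r - l}. sV (1 / (fact l * fact m)) (?S l m) = 0"
    proof
      fix m assume "m \<in> {..r} - {..r - l}"
      then have "?S l m = 0" by (intro zero) auto
      then show "sV (1 / (fact l * fact m)) (?S l m) = 0" by (simp only: scale_zero_right)
    qed
  qed auto
  also have "\<dots> = conv r (\<lambda>j N. \<Sum>l\<le>r. \<Sum>m\<le>r. sV (1 / (fact l * fact m)) (R ((fad a ^^ l) h) j (op_power Aop m N v)))"
    unfolding conv_sum conv_scale ..
  also have "\<dots> = conv r (\<lambda>j N. R (adflow a h) j (T N v))"
  proof (rule conv_cong)
    fix j N assume *: "j + N = r"
    have "R (adflow a h) j (T N v) = (\<Sum>l\<le>r. sV (1 / fact l) (R ((fad a ^^ l) h) j (\<Sum>m\<le>r. sV (1 / fact m) (op_power Aop m N v))))"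
      using * by (subst R_ad) (simp_all add: T_upto[of N r] del: op_power.simps)
    then show "(\<Sum>l\<le>r. \<Sum>m\<le>r. sV (1 / (fact l * fact m)) (R ((fad a ^^ l) h) j (op_power Aop m N v)))
      = R (adflow a h) j (T N v)"
      by (simp add: R_sum R_scale scale_sum_right del: op_power.simps)
  qed
  finally show ?thesis .
qed

text \<open>The operator form of \<open>adflow_fxi\<close>. The powers \<open>k^j\<close> come from
  conjugating \<open>L(j)\<close> by \<open>k^(-L(0))\<close>.\<close>

lemma T_L:
  assumes "Delta_coeffs k a" "k > 0"
  shows "conv r (\<lambda>j N. sV (cx j) (L j (T N v))) = conv r (\<lambda>N j. sV (of_nat k ^ j * cx j) (T N (L j v)))"
proof -
  let ?h = "fps_const (1 / of_nat k) * (fxi oo (fps_const (of_nat k) * fps_X)) :: complex fps"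
  have "R ?h j x = sV (of_nat k ^ j * cx j) (L j x)" for j x
    using assms(2) by (simp add: R_def)
  moreover have "conv r (\<lambda>N j. T N (R ?h j v)) = conv r (\<lambda>j N. R fxi j (T N v))"
    by (subst T_R) (simp_all add: adflow_fxi[OF assms])
  ultimately show ?thesis
    using assms(2) by (simp add: R_def T.scale)
qed

lemma L0_L: "L 0 u = sV b u \<Longrightarrow> L 0 (L j u) = sV (b - of_nat j) (L j u)"
  using L_comm[of 0 j u] by (simp add: Yr.scale scale_left_diff_distrib algebra_simps)

lemma L0_T:
  assumes "L 0 u = sV b u"
  shows "L 0 (T N u) = sV (b - of_nat N) (T N u)"
proof -
  have "L 0 (op_power Aop n N u) = sV (b - of_nat N) (op_power Aop n N u)" for n N
  proof (induction n arbitrary: N)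
    case (Suc n)
    have "L 0 (R (fal a) i (op_power Aop n m u)) = sV (b - of_nat N) (R (fal a) i (op_power Aop n m u))"
      if "i + m = N" for i m
    proof -
      have "b - of_nat N = b - of_nat m - of_nat i"
        using that by auto
      then show ?thesis
        unfolding R_def Yr.scale using L0_L[OF Suc.IH[of m], of i] by (simp add: mult.commute)
    qed
    then show ?case
      unfolding op_power_Suc_conv Yr_conv by (simp cong: conv_cong flip: conv_scale)
  qed (use assms in auto)
  then show ?thesis
    by (simp add: T_def op_exp_def Yr.sum Yr.scale scale_sum_right mult.commute del: op_power.simps)
qed

lemma L0_Y:
  assumes "L 0 u = sV b u" "L 0 v = sV b' v"
  shows "L 0 (Y u (int i) v) = sV (b + b' - of_nat i - 1) (Y u (int i) v)"
  using L_Y_comm[of 0 u i v] assms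
  by (simp add: Yr.scale Yl.scale scale_left_diff_distrib scale_left_distrib algebra_simps)

end

end

section \<open>The conjugation formula for the exponential\<close>

lemma fps_X_power_dvd:
  assumes "\<And>i. i < n \<Longrightarrow> f $ i = 0"
  shows "f = fps_X ^ n * fps_shift n f"
  by (rule fps_ext) (use assms in \<open>auto simp: fps_X_power_mult_nth\<close>)

text \<open>\<open>(1 + x)^k - 1 = x h\<close> with \<open>h(0) = k\<close>: each power of
  \<open>z\<close> keeps its order and contributes a factor \<open>k\<close>, and the prefactor
  contributes one more.\<close>

lemma substitution_order:
  assumes "\<And>i. i < n \<Longrightarrow> f $ i = 0"
  shows "i < n \<Longrightarrow> substitution k b N f $ i = 0" and "substitution k b N f $ n = of_nat k ^ Suc n * f $ n"
proof -
  define u where "u = (fps_binomial (of_nat k) - 1 :: complex fps)"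
  define g where "g = fps_shift n f"
  define h where "h = fps_shift 1 u"
  define M where "M = fps_binomial (of_nat k - 1 + b * (1 - of_nat k) - of_nat N)"
  have u: "u = fps_X * h"
    using fps_X_power_dvd[of 1 u] by (simp add: h_def u_def)
  have "f oo u = (fps_X ^ n * g) oo u"
    using fps_X_power_dvd[of n f] assms by (simp add: g_def)
  also have "\<dots> = u ^ n * (g oo u)"
    by (simp add: u_def fps_compose_mult_distrib flip: fps_compose_power)
  finally have "substitution k b N f = fps_X ^ n * (fps_const (of_nat k) * M * h ^ n * (g oo u))"
    by (simp add: substitution_def flip: u_def M_def) (simp add: u power_mult_distrib mult_ac)
  moreover have "(fps_const (of_nat k) * M * h ^ n * (g oo u)) $ 0 = of_nat k ^ Suc n * f $ n"
    by (simp add: M_def h_def u_def g_def fps_nth_power_0)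
  ultimately show "i < n \<Longrightarrow> substitution k b N f $ i = 0" "substitution k b N f $ n = of_nat k ^ Suc n * f $ n"
    by (simp_all add: fps_X_power_mult_nth)
qed

lemma substitution_add: "substitution k b N (f + g) = substitution k b N f + substitution k b N g"
  by (simp add: substitution_def fps_compose_add_distrib algebra_simps)

lemma substitution_scale: "substitution k b N (fps_const c * f) = fps_const c * substitution k b N f"
  by (simp add: substitution_def fps_compose_mult_distrib mult_ac)

text \<open>Multiplication by \<open>fln\<close> raises the order and \<open>fxi\<close> starts with
  \<open>z\<close>, so in degree \<open>n\<close> only the derivative in \<open>- (fxi f)'\<close>
  counts, with its factor \<open>n + 1\<close>.\<close>

lemma fsharp_order:
  assumes "\<And>i. i < n \<Longrightarrow> f $ i = 0" and "i < Suc n"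
  shows "(fsharp b f + fps_const (of_nat (Suc n)) * f) $ i = 0"
proof -
  have 1: "(fln * f) $ i = 0"
    unfolding fps_mult_nth
  proof (rule sum.neutral, rule ballI)
    fix j assume "j \<in> {0..i}"
    then show "fln $ j * f $ (i - j) = 0"
      using assms by (cases "j = 0") auto
  qed
  have 2: "(fxi * f) $ Suc i = f $ i"
  proof -
    have "(fxi * f) $ Suc i = (\<Sum>j\<le>i. fxi $ Suc j * f $ (i - j))"
      unfolding fps_mult_nth atLeast0AtMost sum.atMost_Suc_shift by simp
    also have "\<dots> = (\<Sum>j\<le>i. if j = 0 then f $ i else 0)"
      using assms by (intro sum.cong) auto
    finally show ?thesis by simp
  qed
  have "fsharp b f $ i = b * (fln * f) $ i - of_nat (Suc i) * (fxi * f) $ Suc i"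
    by (simp add: fsharp_def mult.assoc del: fps_deriv_mult)
  then show ?thesis
    unfolding 1 2 using assms by (cases "i = n") (auto simp: algebra_simps)
qed

text \<open>For use when the lower components agree by induction: what remains of two convolutions
  is the contribution of \<open>L(0)\<close>.\<close>

lemma conv_head:
  fixes g h :: "nat \<Rightarrow> nat \<Rightarrow> 'a::ab_group_add"
  assumes "\<And>j q. j + q = r \<Longrightarrow> q < r \<Longrightarrow> g j q = h j q"
  shows "conv r g - conv r h = g 0 r - h 0 r"
proof -
  have "conv r g - conv r h = conv r (\<lambda>j q. g j q - h j q)"
    by (simp add: conv_diff)
  also have "\<dots> = conv r (\<lambda>j q. if j = 0 then g 0 q - h 0 q else 0)"
    using assms by (intro conv_cong) auto
  finally show ?thesis by (simp add: conv_delta)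
qed

lemma conv_exchange:
  "conv r (\<lambda>i j. conv s (\<lambda>l m. g i j l m)) = conv s (\<lambda>l m. conv r (\<lambda>i j. g i j l m))"
  unfolding conv_def by (rule sum.swap)

context vertex_operator_superalgebra
begin

context
  fixes a :: "nat \<Rightarrow> complex" and k :: nat
  assumes Dc: "Delta_coeffs k a" and k: "k > 0"
begin

interpretation T: Vector_Spaces.linear sV sV "T a N" for N
  by (rule T_linear)

lemma T_conv: "T a N (conv r g) = conv r (\<lambda>i j. T a N (g i j))"
  by (simp add: conv_def T.sum)

abbreviation (input) K :: complex where "K \<equiv> of_nat k"

lemma T_L': "conv r (\<lambda>N j. sV (cx j) (L j (T a N v))) = conv r (\<lambda>N j. sV (K ^ j * cx j) (T a N (L j v)))"
  using T_L[OF Dc k] by (subst conv_commute)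

text \<open>The components of weight \<open>r\<close> below the top of the two sides of the conjugation formula at
  \<open>x\<^sub>2 = 1\<close>, paired with \<open>f\<close> under \<open>Res\<close>. The scaling \<open>k\<^bsup>-L(0)\<^esup>\<close> has been moved to one side, where it
  leaves only \<open>k\<^bsup>i+1\<^esup>\<close>.\<close>

definition exp_after :: "complex fps \<Rightarrow> 'v \<Rightarrow> 'v \<Rightarrow> nat \<Rightarrow> 'v" where
  "exp_after f u v r = conv r (\<lambda>N i. sV (K ^ Suc i * f $ i) (T a N (Y u (int i) v)))"

definition exp_inside :: "complex \<Rightarrow> complex fps \<Rightarrow> 'v \<Rightarrow> 'v \<Rightarrow> nat \<Rightarrow> 'v" where
  "exp_inside b f u v r = conv r (\<lambda>N m. conv m (\<lambda>N' i. sV (substitution k b N f $ i) (Y (T a N u) (int i) (T a N' v))))"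

text \<open>\<open>T_L\<close> carries \<open>B\<close> through the exponential at the cost of
  \<open>k^j\<close>, and \<open>fsharp_bracket\<close> carries it past the mode of
  \<open>u\<close>. The powers of \<open>k\<close> match because
  \<open>k^(q+1) = k^j k^(i+1)\<close> for \<open>q = j + i\<close>.\<close>

lemma exp_after_bracket:
  assumes u: "L 0 u = sV b u"
  shows "conv r (\<lambda>j q. sV (cx j) (L j (exp_after f u v q)))
    = conv r (\<lambda>j q. sV (K ^ j * cx j) (exp_after f u (L j v) q))
      + exp_after (fsharp b f) u v r
      + conv r (\<lambda>j q. sV (K ^ j * cx j) (exp_after (fps_binomial (- of_nat j) * f) (L j u) v q))"
proof -
  have "conv r (\<lambda>j q. sV (cx j) (L j (exp_after f u v q)))
      = conv r (\<lambda>j q. conv q (\<lambda>N i. sV (K ^ Suc i * f $ i) (sV (cx j) (L j (T a N (Y u (int i) v))))))"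
    unfolding exp_after_def Yr_conv Yr.scale conv_scale[symmetric] by (simp add: mult.commute)
  also have "\<dots> = conv r (\<lambda>m i. sV (K ^ Suc i * f $ i) (conv m (\<lambda>N j. sV (cx j) (L j (T a N (Y u (int i) v))))))"
    unfolding conv_assoc conv_scale by (subst (2) conv_commute) (rule refl)
  also have "\<dots> = conv r (\<lambda>m i. conv m (\<lambda>N j. sV (K ^ Suc i * f $ i) (sV (K ^ j * cx j) (T a N (L j (Y u (int i) v))))))"
    unfolding T_L' conv_scale ..
  also have "\<dots> = conv r (\<lambda>N q. conv q (\<lambda>j i. sV (K ^ Suc i * f $ i) (sV (K ^ j * cx j) (T a N (L j (Y u (int i) v))))))"
    unfolding conv_assoc ..
  also have "\<dots> = conv r (\<lambda>N q. sV (K ^ Suc q) (T a N (conv q (\<lambda>j i. sV (cx j * f $ i) (L j (Y u (int i) v))))))"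
    unfolding T_conv conv_scale[symmetric]
    by (intro conv_cong) (auto simp: T.scale mult_ac power_add)
  also have "\<dots> = conv r (\<lambda>N q. sV (K ^ Suc q) (T a N (conv q (\<lambda>j i. sV (cx j * f $ i) (Y u (int i) (L j v))))))
      + exp_after (fsharp b f) u v r
      + conv r (\<lambda>N q. sV (K ^ Suc q) (T a N (conv q (\<lambda>j i. sV (cx j * (fps_binomial (- of_nat j) * f) $ i) (Y (L j u) (int i) v)))))"
    unfolding fsharp_bracket[OF u] T.add scale_right_distrib conv_add exp_after_def
    by (simp add: T.scale)
  also have "conv r (\<lambda>N q. sV (K ^ Suc q) (T a N (conv q (\<lambda>j i. sV (cx j * f $ i) (Y u (int i) (L j v))))))
      = conv r (\<lambda>N q. conv q (\<lambda>j i. sV (K ^ j * cx j) (sV (K ^ Suc i * f $ i) (T a N (Y u (int i) (L j v))))))"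
    unfolding T_conv conv_scale[symmetric]
    by (intro conv_cong) (auto simp: T.scale mult_ac power_add)
  also have "\<dots> = conv r (\<lambda>j q. sV (K ^ j * cx j) (exp_after f u (L j v) q))"
    unfolding exp_after_def conv_scale[symmetric] by (rule conv_swap)
  also have "conv r (\<lambda>N q. sV (K ^ Suc q) (T a N (conv q (\<lambda>j i. sV (cx j * (fps_binomial (- of_nat j) * f) $ i) (Y (L j u) (int i) v)))))
      = conv r (\<lambda>N q. conv q (\<lambda>j i. sV (K ^ j * cx j) (sV (K ^ Suc i * (fps_binomial (- of_nat j) * f) $ i) (T a N (Y (L j u) (int i) v)))))"
    unfolding T_conv conv_scale[symmetric]
    by (intro conv_cong) (auto simp: T.scale mult_ac power_add)
  also have "\<dots> = conv r (\<lambda>j q. sV (K ^ j * cx j) (exp_after (fps_binomial (- of_nat j) * f) (L j u) v q))"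
    unfolding exp_after_def conv_scale[symmetric] by (rule conv_swap)
  finally show ?thesis .
qed

text \<open>\<open>B\<close> passes the modes of \<open>T N u\<close>, which has eigenvalue
  \<open>b - N\<close>, and then the exponential on \<open>v\<close>. The result has the same shape
  as for \<open>exp_after\<close>, so that the two sides can be compared by induction.\<close>

lemma exp_inside_bracket:
  assumes u: "L 0 u = sV b u"
  shows "conv r (\<lambda>j q. sV (cx j) (L j (exp_inside b f u v q)))
    = conv r (\<lambda>j q. sV (K ^ j * cx j) (exp_inside b f u (L j v) q))
      + exp_inside b (fsharp b f) u v r
      + conv r (\<lambda>j q. sV (K ^ j * cx j) (exp_inside (b - of_nat j) (fps_binomial (- of_nat j) * f) (L j u) v q))"
proof -
  define t where "t N = substitution k b N f" for N
  have "conv r (\<lambda>j q. sV (cx j) (L j (exp_inside b f u v q)))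
      = conv r (\<lambda>j q. conv q (\<lambda>N m. conv m (\<lambda>N' i. sV (cx j * t N $ i) (L j (Y (T a N u) (int i) (T a N' v))))))"
    unfolding exp_inside_def Yr_conv Yr.scale conv_scale[symmetric] t_def by simp
  also have "\<dots> = conv r (\<lambda>N q. conv q (\<lambda>j m. conv m (\<lambda>N' i. sV (cx j * t N $ i) (L j (Y (T a N u) (int i) (T a N' v))))))"
    by (rule conv_swap)
  also have "\<dots> = conv r (\<lambda>N q. conv q (\<lambda>N' m. conv m (\<lambda>j i. sV (cx j * t N $ i) (L j (Y (T a N u) (int i) (T a N' v))))))"
    by (intro conv_cong conv_swap)
  also have "\<dots> = conv r (\<lambda>N q. conv q (\<lambda>N' m. conv m (\<lambda>j i. sV (cx j * t N $ i) (Y (T a N u) (int i) (L j (T a N' v))))))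
      + conv r (\<lambda>N q. conv q (\<lambda>N' m. sV (fsharp (b - of_nat N) (t N) $ m) (Y (T a N u) (int m) (T a N' v))))
      + conv r (\<lambda>N q. conv q (\<lambda>N' m. conv m (\<lambda>j i. sV (cx j * (fps_binomial (- of_nat j) * t N) $ i) (Y (L j (T a N u)) (int i) (T a N' v)))))"
    unfolding conv_add[symmetric]
    by (intro conv_cong) (rule fsharp_bracket[OF L0_T[OF u]])
  also have "conv r (\<lambda>N q. conv q (\<lambda>N' m. sV (fsharp (b - of_nat N) (t N) $ m) (Y (T a N u) (int m) (T a N' v))))
      = exp_inside b (fsharp b f) u v r"
    unfolding exp_inside_def t_def fsharp_substitution[OF k] ..
  also have "conv r (\<lambda>N q. conv q (\<lambda>N' m. conv m (\<lambda>j i. sV (cx j * t N $ i) (Y (T a N u) (int i) (L j (T a N' v))))))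
      = conv r (\<lambda>j q. sV (K ^ j * cx j) (exp_inside b f u (L j v) q))"
  proof -
    have "conv q (\<lambda>N' m. conv m (\<lambda>j i. sV (cx j * t N $ i) (Y (T a N u) (int i) (L j (T a N' v)))))
       = conv q (\<lambda>j m. conv m (\<lambda>N' i. sV (K ^ j * cx j) (sV (t N $ i) (Y (T a N u) (int i) (T a N' (L j v))))))" for N q
    proof -
      have "conv q (\<lambda>N' m. conv m (\<lambda>j i. sV (cx j * t N $ i) (Y (T a N u) (int i) (L j (T a N' v)))))
        = conv q (\<lambda>s i. sV (t N $ i) (Y (T a N u) (int i) (conv s (\<lambda>N' j. sV (cx j) (L j (T a N' v))))))"
        unfolding conv_assoc Yr_conv conv_scale[symmetric] Yr.scale by (simp add: mult.commute)
      also have "\<dots> = conv q (\<lambda>N' m. conv m (\<lambda>j i. sV (K ^ j * cx j) (sV (t N $ i) (Y (T a N u) (int i) (T a N' (L j v))))))"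
        unfolding T_L' conv_assoc Yr_conv conv_scale[symmetric] Yr.scale by (simp add: mult.commute)
      also have "\<dots> = conv q (\<lambda>j m. conv m (\<lambda>N' i. sV (K ^ j * cx j) (sV (t N $ i) (Y (T a N u) (int i) (T a N' (L j v))))))"
        by (rule conv_swap)
      finally show ?thesis .
    qed
    then have "conv r (\<lambda>N q. conv q (\<lambda>N' m. conv m (\<lambda>j i. sV (cx j * t N $ i) (Y (T a N u) (int i) (L j (T a N' v))))))
      = conv r (\<lambda>N q. conv q (\<lambda>j m. conv m (\<lambda>N' i. sV (K ^ j * cx j) (sV (t N $ i) (Y (T a N u) (int i) (T a N' (L j v)))))))"
      by simp
    also have "\<dots> = conv r (\<lambda>j q. conv q (\<lambda>N m. conv m (\<lambda>N' i. sV (K ^ j * cx j) (sV (t N $ i) (Y (T a N u) (int i) (T a N' (L j v)))))))"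
      by (rule conv_swap)
    finally show ?thesis
      unfolding exp_inside_def conv_scale t_def .
  qed
  \<comment> \<open>Both parts of \<open>substitution_mult_binomial\<close> are used. By the first,
    the series depends only on \<open>N + j\<close>, so \<open>T_L'\<close> applies to the whole sum
    over \<open>N + j = s\<close>; the second reads the outcome as an expression in
    \<open>L(j) u\<close> with eigenvalue \<open>b - j\<close>.\<close>
  also have "conv r (\<lambda>N q. conv q (\<lambda>N' m. conv m (\<lambda>j i. sV (cx j * (fps_binomial (- of_nat j) * t N) $ i) (Y (L j (T a N u)) (int i) (T a N' v)))))
      = conv r (\<lambda>j q. sV (K ^ j * cx j) (exp_inside (b - of_nat j) (fps_binomial (- of_nat j) * f) (L j u) v q))"
  proof -
    have "conv r (\<lambda>N q. conv q (\<lambda>N' m. conv m (\<lambda>j i. sV (cx j * (fps_binomial (- of_nat j) * t N) $ i) (Y (L j (T a N u)) (int i) (T a N' v)))))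
      = conv r (\<lambda>N q. conv q (\<lambda>N' m. conv m (\<lambda>j i. sV (cx j * t (N + j) $ i) (Y (L j (T a N u)) (int i) (T a N' v)))))"
      unfolding t_def substitution_mult_binomial by (simp add: add.commute)
    also have "\<dots> = conv r (\<lambda>N q. conv q (\<lambda>j m. conv m (\<lambda>N' i. sV (cx j * t (N + j) $ i) (Y (L j (T a N u)) (int i) (T a N' v)))))"
      by (intro conv_cong conv_swap)
    also have "\<dots> = conv r (\<lambda>s m. conv s (\<lambda>N j. conv m (\<lambda>N' i. sV (cx j * t (N + j) $ i) (Y (L j (T a N u)) (int i) (T a N' v)))))"
      by (rule conv_assoc)
    also have "\<dots> = conv r (\<lambda>s m. conv m (\<lambda>N' i. sV (t s $ i) (Y (conv s (\<lambda>N j. sV (cx j) (L j (T a N u)))) (int i) (T a N' v))))"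
      unfolding Yl_conv conv_scale[symmetric] Yl.scale
      by (intro conv_cong) (subst conv_exchange, intro conv_cong, simp add: mult.commute)
    also have "\<dots> = conv r (\<lambda>s m. conv m (\<lambda>N' i. sV (t s $ i) (Y (conv s (\<lambda>N j. sV (K ^ j * cx j) (T a N (L j u)))) (int i) (T a N' v))))"
      unfolding T_L' ..
    also have "\<dots> = conv r (\<lambda>s m. conv s (\<lambda>N j. conv m (\<lambda>N' i. sV (K ^ j * cx j) (sV (t (N + j) $ i) (Y (T a N (L j u)) (int i) (T a N' v))))))"
      unfolding Yl_conv conv_scale[symmetric] Yl.scale
      by (intro conv_cong) (subst conv_exchange, intro conv_cong, simp add: mult.commute)
    also have "\<dots> = conv r (\<lambda>N q. conv q (\<lambda>j m. conv m (\<lambda>N' i. sV (K ^ j * cx j) (sV (t (N + j) $ i) (Y (T a N (L j u)) (int i) (T a N' v))))))"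
      by (rule conv_assoc[symmetric])
    also have "\<dots> = conv r (\<lambda>j q. conv q (\<lambda>N m. conv m (\<lambda>N' i. sV (K ^ j * cx j) (sV (t (N + j) $ i) (Y (T a N (L j u)) (int i) (T a N' v))))))"
      by (rule conv_swap)
    finally show ?thesis
      unfolding exp_inside_def conv_scale substitution_mult_binomial t_def by (simp add: add.commute)
  qed
  finally show ?thesis .
qed

lemma exp_after_add: "exp_after (f + g) u v r = exp_after f u v r + exp_after g u v r"
  by (simp add: exp_after_def distrib_left scale_left_distrib conv_add)

lemma exp_inside_add: "exp_inside b (f + g) u v r = exp_inside b f u v r + exp_inside b g u v r"
  by (simp add: exp_inside_def substitution_add scale_left_distrib conv_add)

lemma exp_after_scale: "exp_after (fps_const x * f) u v r = sV x (exp_after f u v r)"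
  by (simp add: exp_after_def mult.left_commute flip: conv_scale)

lemma exp_inside_scale: "exp_inside b (fps_const x * f) u v r = sV x (exp_inside b f u v r)"
  by (simp add: exp_inside_def substitution_scale flip: conv_scale)

lemma exp_after_scale_vec: "exp_after f (sV x u) v r = sV x (exp_after f u v r)" "exp_after f u (sV x v) r = sV x (exp_after f u v r)"
  by (simp_all add: exp_after_def Yl.scale Yr.scale T.scale mult.commute flip: conv_scale)

lemma exp_inside_scale_vec: "exp_inside b f (sV x u) v r = sV x (exp_inside b f u v r)" "exp_inside b f u (sV x v) r = sV x (exp_inside b f u v r)"
  by (simp_all add: exp_inside_def Yl.scale Yr.scale T.scale mult.commute flip: conv_scale)

lemma exp_after_L0:
  assumes "L 0 u = sV b u" "L 0 v = sV b' v"
  shows "L 0 (exp_after f u v r) = sV (b + b' - of_nat r - 1) (exp_after f u v r)"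
  unfolding exp_after_def Yr_conv Yr.scale conv_scale[symmetric] L0_T[OF L0_Y[OF assms]]
  by (rule conv_cong) (auto simp: algebra_simps)

lemma exp_inside_L0:
  assumes "L 0 u = sV b u" "L 0 v = sV b' v"
  shows "L 0 (exp_inside b f u v r) = sV (b + b' - of_nat r - 1) (exp_inside b f u v r)"
  unfolding exp_inside_def Yr_conv Yr.scale conv_scale[symmetric] L0_Y[OF L0_T[OF assms(1)] L0_T[OF assms(2)]]
  by (intro conv_cong) (auto simp: algebra_simps)

text \<open>For \<open>f\<close> of order \<open>r\<close> no weight is left for the exponentials to
  lower: only \<open>T 0\<close>, the identity, occurs. Both sides carry the leading coefficient
  \<open>k^(r+1) f_r\<close>.\<close>

lemma exp_after_eq_exp_inside_leading:
  assumes "\<And>i. i < r \<Longrightarrow> f $ i = 0"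
  shows "exp_after f u v r = exp_inside b f u v r"
proof -
  have "exp_after f u v r = conv r (\<lambda>N i. if N = 0 then sV (K ^ Suc i * f $ i) (Y u (int i) v) else 0)"
    unfolding exp_after_def using assms by (intro conv_cong) auto
  moreover have "exp_inside b f u v r = conv r (\<lambda>N m. if N = 0 then
      conv m (\<lambda>N' i. if N' = 0 then sV (substitution k b 0 f $ i) (Y u (int i) v) else 0) else 0)"
    unfolding exp_inside_def
  proof (rule conv_cong)
    fix N m assume r: "N + m = r"
    show "conv m (\<lambda>N' i. sV (substitution k b N f $ i) (Y (T a N u) (int i) (T a N' v)))
      = (if N = 0 then conv m (\<lambda>N' i. if N' = 0 then sV (substitution k b 0 f $ i) (Y u (int i) v) else 0) else 0)"
    proof (cases "N = 0")
      case True
      then show ?thesis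
        using r by (auto intro!: conv_cong simp: substitution_order(1)[of r f] assms)
    next
      case False
      have "conv m (\<lambda>N' i. sV (substitution k b N f $ i) (Y (T a N u) (int i) (T a N' v))) = conv m (\<lambda>N' i. 0)"
        using r False by (intro conv_cong) (auto simp: substitution_order(1)[of r f] assms)
      then show ?thesis using False by (simp add: conv_def)
    qed
  qed
  ultimately show ?thesis
    using substitution_order(2)[of r f k b 0] assms by (simp add: conv_delta)
qed

text \<open>The difference \<open>Z f\<close> of the two sides satisfies \<open>Z (fsharp b f) = - (r + 1) Z f\<close> by induction, while
  \<open>fsharp b f = - (n + 1) f\<close> modulo higher order for \<open>f\<close> of order \<open>n\<close>. This gives \<open>Z f = 0\<close> by
  descending induction on the order, starting from the leading terms at \<open>n = r\<close>.\<close>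

lemma exp_after_eq_exp_inside:
  assumes "L 0 u = sV b u" "L 0 v = sV b' v"
  shows "exp_after f u v r = exp_inside b f u v r"
  using assms
proof (induction r arbitrary: f u v b b' rule: less_induct)
  case (less r)
  define Z where "Z f = exp_after f u v r - exp_inside b f u v r" for f
  have Zsharp: "Z (fsharp b f) = sV (- of_nat (Suc r)) (Z f)" for f
  proof -
    have 1: "exp_after f u v q = exp_inside b f u v q" if "q < r" for q
      using that less by blast
    have 2: "exp_after f u (L j v) q = exp_inside b f u (L j v) q" if "q < r" for q j
      using that less.IH less.prems(1) L0_L[OF less.prems(2)] by blast
    have 3: "exp_after (fps_binomial (- of_nat j) * f) (L j u) v q
        = exp_inside (b - of_nat j) (fps_binomial (- of_nat j) * f) (L j u) v q" if "q < r" for q j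
      using that less.IH less.prems(2) L0_L[OF less.prems(1)] by blast
    have "conv r (\<lambda>j q. sV (cx j) (L j (exp_after f u v q))) - conv r (\<lambda>j q. sV (cx j) (L j (exp_inside b f u v q)))
        = (conv r (\<lambda>j q. sV (K ^ j * cx j) (exp_after f u (L j v) q)) - conv r (\<lambda>j q. sV (K ^ j * cx j) (exp_inside b f u (L j v) q)))
        + Z (fsharp b f)
        + (conv r (\<lambda>j q. sV (K ^ j * cx j) (exp_after (fps_binomial (- of_nat j) * f) (L j u) v q))
          - conv r (\<lambda>j q. sV (K ^ j * cx j) (exp_inside (b - of_nat j) (fps_binomial (- of_nat j) * f) (L j u) v q)))"
      unfolding exp_after_bracket[OF less.prems(1)] exp_inside_bracket[OF less.prems(1)] Z_def by (simp add: algebra_simps)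
    also have "conv r (\<lambda>j q. sV (cx j) (L j (exp_after f u v q))) - conv r (\<lambda>j q. sV (cx j) (L j (exp_inside b f u v q)))
        = sV (cx 0) (L 0 (exp_after f u v r)) - sV (cx 0) (L 0 (exp_inside b f u v r))"
      by (rule conv_head) (simp only: 1)
    also have "conv r (\<lambda>j q. sV (K ^ j * cx j) (exp_after f u (L j v) q)) - conv r (\<lambda>j q. sV (K ^ j * cx j) (exp_inside b f u (L j v) q))
        = sV (K ^ 0 * cx 0) (exp_after f u (L 0 v) r) - sV (K ^ 0 * cx 0) (exp_inside b f u (L 0 v) r)"
      by (rule conv_head) (simp only: 2)
    also have "conv r (\<lambda>j q. sV (K ^ j * cx j) (exp_after (fps_binomial (- of_nat j) * f) (L j u) v q))
          - conv r (\<lambda>j q. sV (K ^ j * cx j) (exp_inside (b - of_nat j) (fps_binomial (- of_nat j) * f) (L j u) v q))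
        = sV (K ^ 0 * cx 0) (exp_after (fps_binomial (- of_nat 0) * f) (L 0 u) v r)
          - sV (K ^ 0 * cx 0) (exp_inside (b - of_nat 0) (fps_binomial (- of_nat 0) * f) (L 0 u) v r)"
      by (rule conv_head) (simp only: 3)
    \<comment> \<open>\<open>L(0)\<close> multiplies both sides by \<open>b + b' - r - 1\<close>,
      while \<open>L(0) u\<close> and \<open>L(0) v\<close> account for \<open>b\<close> and
      \<open>b'\<close>. The excess is the factor \<open>-(r + 1)\<close>.\<close>
    finally have "sV (b + b' - of_nat r - 1) (Z f) = sV b' (Z f) + Z (fsharp b f) + sV b (Z f)"
      unfolding exp_after_L0[OF less.prems] exp_inside_L0[OF less.prems] less.prems exp_after_scale_vec exp_inside_scale_vec
      by (simp add: Z_def scale_right_diff_distrib)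
    then have "Z f + (Z (fsharp b f) + sV (of_nat r) (Z f)) = 0"
      by (simp add: algebra_simps scale_left_distrib scale_left_diff_distrib)
    then have "Z (fsharp b f) + sV (of_nat (Suc r)) (Z f) = 0"
      by (simp add: scale_left_distrib add_ac)
    then show ?thesis
      unfolding scale_minus_left eq_neg_iff_add_eq_0 .
  qed
  have Z_add: "Z (f + g) = Z f + Z g" for f g
    by (simp add: Z_def exp_after_add exp_inside_add)
  have Z_scale: "Z (fps_const x * f) = sV x (Z f)" for x f
    by (simp add: Z_def exp_after_scale exp_inside_scale scale_right_diff_distrib)
  have "Z f = 0" if "\<forall>i<n. f $ i = 0" "n \<le> r" for n f
    using that(2,1)
  proof (induction n arbitrary: f rule: inc_induct)
    case base
    then show ?case
      by (simp add: Z_def exp_after_eq_exp_inside_leading)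
  next
    case (step n)
    have "Z (fsharp b f + fps_const (of_nat (Suc n)) * f) = 0"
      using step fsharp_order[of n f _ b] by blast
    then have "sV (- of_nat (Suc r) + of_nat (Suc n)) (Z f) = 0"
      unfolding Z_add Z_scale Zsharp scale_left_distrib[symmetric] .
    moreover have "- of_nat (Suc r) + of_nat (Suc n) \<noteq> (0 :: complex)"
      using step by (simp add: add_eq_0_iff del: of_nat_Suc)
    ultimately show ?case
      unfolding scale_eq_0_iff by blast
  qed
  from this[of 0 f] show ?case
    by (simp add: Z_def)
qed

end

end

section \<open>Weight components and twisted fields\<close>

lemma internal_direct_sum_eq_0:
  assumes "internal_direct_sum sc I W U" "finite F" "F \<subseteq> I" "\<forall>i\<in>F. f i \<in> W i" "(\<Sum>i\<in>F. f i) = 0"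
  shows "\<forall>i\<in>F. f i = 0"
proof -
  have "\<forall>F f. finite F \<and> F \<subseteq> I \<and> (\<forall>i\<in>F. f i \<in> W i) \<and> (\<Sum>i\<in>F. f i) = 0 \<longrightarrow> (\<forall>i\<in>F. f i = 0)"
    using assms(1) unfolding internal_direct_sum_def by (elim conjE)
  from this[rule_format, of F f] assms show ?thesis
    by simp
qed

lemma internal_direct_sumE:
  assumes "internal_direct_sum sc I W U" "u \<in> U"
  obtains F f where "finite F" "F \<subseteq> I" "\<forall>i\<in>F. f i \<in> W i" "u = (\<Sum>i\<in>F. f i)"
proof -
  have "u \<in> {\<Sum>i\<in>F. f i | F f. finite F \<and> F \<subseteq> I \<and> (\<forall>i\<in>F. f i \<in> W i)}"
    using assms unfolding internal_direct_sum_def by (elim conjE) simp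
  then obtain F f where "finite F" "F \<subseteq> I" "\<forall>i\<in>F. f i \<in> W i" "u = (\<Sum>i\<in>F. f i)"
    by (elim CollectE exE conjE)
  then show ?thesis by (intro that[of F f]) simp_all
qed

lemma internal_direct_sum_subspace:
  "internal_direct_sum sc I W U \<Longrightarrow> i \<in> I \<Longrightarrow> module.subspace sc (W i)"
  unfolding internal_direct_sum_def by (elim conjE) (rule bspec)

context vertex_operator_superalgebra
begin

definition wcomp :: "'v \<Rightarrow> int \<Rightarrow> 'v" where
  "wcomp u m = weight_component G m u"

lemma G_subspace: "subspace (G m)"
  using internal_direct_sum_subspace[OF weight_direct_sum] by simp

lemma weight_decomposition_unique:
  assumes "\<And>i. f i \<in> G i" "finite {i. f i \<noteq> 0}" "\<And>i. g i \<in> G i" "finite {i. g i \<noteq> 0}"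
    and "Sum_any f = Sum_any g"
  shows "f = g"
proof -
  define F where "F = {i. f i \<noteq> 0} \<union> {i. g i \<noteq> 0}"
  have F: "finite F" using assms by (simp add: F_def)
  have "Sum_any f = sum f F" "Sum_any g = sum g F"
    by (rule Sum_any.expand_superset[OF F], simp add: F_def)+
  then have "(\<Sum>i\<in>F. f i - g i) = 0"
    using assms(5) by (simp add: sum_subtractf)
  moreover have "\<forall>i\<in>F. f i - g i \<in> G i"
    using assms(1,3) by (intro ballI subspace_diff[OF G_subspace])
  ultimately have "\<forall>i\<in>F. f i - g i = 0"
    by (intro internal_direct_sum_eq_0[OF weight_direct_sum F]) simp_all
  then have "f i - g i = 0" if "i \<in> F" for i
    using that by blast
  then show ?thesis
    by (intro ext) (simp add: F_def, metis)
qed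

lemma direct_sum_decomposition:
  assumes "internal_direct_sum sV I G U" "u \<in> U"
  obtains f where "\<And>i. f i \<in> G i" "finite {i. f i \<noteq> 0}" "Sum_any f = u" "\<And>i. i \<notin> I \<Longrightarrow> f i = 0"
proof -
  obtain F f where F: "finite F" "F \<subseteq> I" "\<forall>i\<in>F. f i \<in> G i" "u = (\<Sum>i\<in>F. f i)"
    using assms by (rule internal_direct_sumE)
  define g where "g i = (if i \<in> F then f i else 0)" for i
  have "Sum_any g = u"
    unfolding F(4) g_def by (subst Sum_any.expand_superset[OF F(1)]) (auto intro!: sum.cong)
  moreover have "finite {i. g i \<noteq> 0}"
    by (rule finite_subset[OF _ F(1)]) (auto simp: g_def)
  ultimately show ?thesis
    using F(2,3) by (intro that[of g]) (auto simp: g_def subspace_0[OF G_subspace])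
qed

lemma wcomp_eqI:
  assumes "\<And>i. f i \<in> G i" "finite {i. f i \<noteq> 0}" "Sum_any f = u"
  shows "wcomp u = f"
proof -
  have "(THE f. (\<forall>i. f i \<in> G i) \<and> finite {i. f i \<noteq> 0} \<and> Sum_any f = u) = f"
    using assms by (intro the_equality) (auto intro: weight_decomposition_unique)
  then show ?thesis
    by (intro ext) (simp only: wcomp_def weight_component_def)
qed

lemma wcomp_in_G: "wcomp u m \<in> G m" and wcomp_finite: "finite {m. wcomp u m \<noteq> 0}" and Sum_any_wcomp: "Sum_any (wcomp u) = u"
proof -
  obtain f where f: "\<And>i. f i \<in> G i" "finite {i. f i \<noteq> 0}" "Sum_any f = u"
    using direct_sum_decomposition[OF weight_direct_sum, of u] by blast
  then have "wcomp u = f" by (rule wcomp_eqI)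
  with f show "wcomp u m \<in> G m" "finite {m. wcomp u m \<noteq> 0}" "Sum_any (wcomp u) = u" by auto
qed

lemma sum_wcomp: "finite F \<Longrightarrow> {m. wcomp u m \<noteq> 0} \<subseteq> F \<Longrightarrow> (\<Sum>m\<in>F. wcomp u m) = u"
  using Sum_any.expand_superset[of F "wcomp u"] Sum_any_wcomp[of u] by simp

lemma wcomp_parity:
  assumes "p \<in> {0, 1}" "u \<in> P p" "wcomp u m \<noteq> 0"
  shows "m mod 2 = int p"
proof -
  obtain f where f: "\<And>i. f i \<in> G i" "finite {i. f i \<noteq> 0}" "Sum_any f = u"
    "\<And>i. i \<notin> {m. m mod 2 = int p} \<Longrightarrow> f i = 0"
    using direct_sum_decomposition[OF parity_weight[OF assms(1)] assms(2)] by blast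
  have "wcomp u = f" by (rule wcomp_eqI) (use f in auto)
  then show ?thesis using f(4)[of m] assms(3) by auto
qed

lemma wcomp_homogeneous: "u \<in> G m \<Longrightarrow> wcomp u = (\<lambda>i. if i = m then u else 0)"
  by (rule wcomp_eqI) (auto simp: subspace_0[OF G_subspace])

lemma wcomp_add: "wcomp (x + y) m = wcomp x m + wcomp y m"
proof -
  have fin: "finite {m. wcomp x m + wcomp y m \<noteq> 0}"
    by (rule finite_subset[of _ "{m. wcomp x m \<noteq> 0} \<union> {m. wcomp y m \<noteq> 0}"]) (auto simp: wcomp_finite)
  have "wcomp (x + y) = (\<lambda>m. wcomp x m + wcomp y m)"
    by (rule wcomp_eqI)
       (auto simp: subspace_add[OF G_subspace] wcomp_in_G fin Sum_any.distrib wcomp_finite Sum_any_wcomp)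
  then show ?thesis by simp
qed

lemma G_L0: "u \<in> G m \<Longrightarrow> L 0 u = sV (of_int m / 2) u"
  using L0_weight by simp

text \<open>Applying \<open>L(0) - j/2\<close> multiplies the component of index \<open>m\<close> by
  \<open>(m - j)/2\<close>; as the sum is direct, all components with \<open>m\<close> different
  from \<open>j\<close> vanish.\<close>

lemma eigenvector_in_G:
  assumes "L 0 u = sV (of_int j / 2) u"
  shows "u \<in> G j"
proof -
  define F where "F = insert j {m. wcomp u m \<noteq> 0}"
  have F: "finite F" "(\<Sum>m\<in>F. wcomp u m) = u"
    using sum_wcomp[of F u] wcomp_finite[of u] by (auto simp: F_def)
  have "(\<Sum>m\<in>F. sV (of_int (m - j) / 2) (wcomp u m)) = L 0 (\<Sum>m\<in>F. wcomp u m) - sV (of_int j / 2) (\<Sum>m\<in>F. wcomp u m)"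
    unfolding Yr.sum G_L0[OF wcomp_in_G] scale_sum_right sum_subtractf[symmetric]
    by (intro sum.cong refl) (simp add: diff_divide_distrib scale_left_diff_distrib)
  then have "(\<Sum>m\<in>F. sV (of_int (m - j) / 2) (wcomp u m)) = 0"
    using assms by (simp add: F)
  moreover have "\<forall>m\<in>F. sV (of_int (m - j) / 2) (wcomp u m) \<in> G m"
    by (auto intro: subspace_scale[OF G_subspace] wcomp_in_G)
  ultimately have *: "\<forall>m\<in>F. sV (of_int (m - j) / 2) (wcomp u m) = 0"
    by (intro internal_direct_sum_eq_0[OF weight_direct_sum F(1)]) auto
  have "wcomp u m = 0" if "m \<noteq> j" "m \<in> F" for m
    using * that by (auto simp: F_def)
  then have "(\<Sum>m\<in>F. wcomp u m) = (\<Sum>m\<in>F. if m = j then wcomp u j else 0)"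
    by (intro sum.cong) auto
  also have "\<dots> = wcomp u j"
    using F(1) by (simp add: F_def)
  finally show ?thesis
    using F(2) wcomp_in_G[of u j] by simp
qed

lemma T_in_G:
  assumes "u \<in> G m"
  shows "T a N u \<in> G (m - 2 * int N)"
  using L0_T[OF G_L0[OF assms], of a N] by (intro eigenvector_in_G) (simp add: diff_divide_distrib)

lemma Y_in_G:
  assumes "u \<in> G m" "v \<in> G n"
  shows "Y u (int i) v \<in> G (m + n - 2 * int i - 2)"
  using L0_Y[OF G_L0[OF assms(1)] G_L0[OF assms(2)], of i]
  by (intro eigenvector_in_G) (simp add: diff_divide_distrib add_divide_distrib)

lemma G_parity:
  assumes "u \<in> G m" "m mod 2 = int p" "p \<in> {0, 1}"
  shows "u \<in> P p"
  using internal_direct_sum_component[OF parity_weight[OF assms(3)], of m u] assms by auto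

text \<open>Each of the finitely many components is pushed below the lower bound of the
  weights.\<close>

lemma T_eventually_0: "\<exists>B. \<forall>N\<ge>B. T a N u = 0"
proof -
  interpret T: Vector_Spaces.linear sV sV "T a N" for N
    by (rule T_linear)
  obtain m0 where m0: "\<forall>m<m0. G m = {0}"
    using weight_bounded_below by blast
  define F where "F = {m. wcomp u m \<noteq> 0}"
  have F: "finite F" "(\<Sum>m\<in>F. wcomp u m) = u"
    by (auto simp: F_def wcomp_finite intro: sum_wcomp)
  obtain M where M: "\<forall>m\<in>F. m \<le> M"
    using F(1) by (meson bdd_above.E bdd_above_finite)
  have "T a N u = 0" if "N \<ge> nat (M - m0) + 1" for N
  proof -
    have "T a N (wcomp u m) = 0" if "m \<in> F" for m
    proof -
      have "m - 2 * int N < m0"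
        using M that \<open>N \<ge> nat (M - m0) + 1\<close> by force
      then show ?thesis
        using T_in_G[OF wcomp_in_G, of a N u m] m0 by auto
    qed
    then have "T a N (\<Sum>m\<in>F. wcomp u m) = 0"
      by (simp add: T.sum)
    then show ?thesis by (simp add: F)
  qed
  then show ?thesis by blast
qed

lemma T_bound:
  assumes "finite A"
  obtains B where "\<And>N x. x \<in> A \<Longrightarrow> N \<ge> B \<Longrightarrow> T a N x = 0"
proof -
  have "\<exists>B. \<forall>x\<in>A. \<forall>N\<ge>B. T a N x = 0"
    using assms
  proof induction
    case (insert x A)
    obtain B B' where "\<forall>x\<in>A. \<forall>N\<ge>B. T a N x = 0" "\<forall>N\<ge>B'. T a N x = 0"
      using insert T_eventually_0 by metis
    then show ?case
      by (intro exI[of _ "max B B'"]) auto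
  qed simp
  then show ?thesis using that by blast
qed

lemma Y_bound:
  assumes "finite A" "finite C"
  obtains I :: nat where "\<And>i x y. x \<in> A \<Longrightarrow> y \<in> C \<Longrightarrow> i \<ge> I \<Longrightarrow> Y x (int i) y = 0"
proof -
  have "finite (A \<times> C)" using assms by simp
  then have "\<exists>I::nat. \<forall>(x, y)\<in>A \<times> C. \<forall>i\<ge>I. Y x (int i) y = 0"
  proof induction
    case (insert z Z)
    obtain I where "\<forall>(x, y)\<in>Z. \<forall>i\<ge>I. Y x (int i) y = 0"
      using insert by auto
    moreover obtain N where "\<forall>n\<ge>N. Y (fst z) n (snd z) = 0"
      using truncation by blast
    ultimately show ?case
      by (intro exI[of _ "max I (nat N)"]) auto
  qed simp
  then show ?thesis using that by blast
qed

end

text \<open>Passage from truncated double sums, as they occur in the fields, to the grading by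
  weight used in the conjugation formula.\<close>

lemma sum_eq_sum_conv:
  fixes g :: "nat \<Rightarrow> nat \<Rightarrow> 'a::comm_monoid_add"
  assumes "\<And>i j. i \<ge> A \<or> j \<ge> B \<Longrightarrow> g i j = 0" "A + B \<le> r"
  shows "(\<Sum>i<A. \<Sum>j<B. g i j) = (\<Sum>n<r. conv n g)"
proof -
  have "(\<Sum>i<A. \<Sum>j<B. g i j) = (\<Sum>(i, j)\<in>{..<A} \<times> {..<B}. g i j)"
    by (rule sum.cartesian_product)
  also have "\<dots> = (\<Sum>(i, j)\<in>{(i, j). i + j < r}. g i j)"
  proof (rule sum.mono_neutral_left)
    show "finite {(i, j). i + j < r}"
      by (rule finite_subset[of _ "{..<r} \<times> {..<r}"]) auto
    show "{..<A} \<times> {..<B} \<subseteq> {(i, j). i + j < r}"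
      using assms(2) by auto
    show "\<forall>z\<in>{(i, j). i + j < r} - {..<A} \<times> {..<B}. (case z of (i, j) \<Rightarrow> g i j) = 0"
    proof
      fix z assume z: "z \<in> {(i, j). i + j < r} - {..<A} \<times> {..<B}"
      obtain i j where ij: "z = (i, j)" by (cases z)
      with z have "i \<ge> A \<or> j \<ge> B" by auto
      then show "(case z of (i, j) \<Rightarrow> g i j) = 0"
        by (simp only: ij prod.case assms(1))
    qed
  qed
  also have "\<dots> = (\<Sum>n<r. conv n g)"
    unfolding conv_def by (rule sum.triangle_reindex)
  finally show ?thesis .
qed

lemma conv_eq_0:
  assumes "\<And>i j. i + j = r \<Longrightarrow> g i j = 0"
  shows "conv r g = 0"
  unfolding conv_def using assms by (intro sum.neutral) auto

text \<open>Substituting \<open>x^(1/k)\<close> turns the exponent \<open>e\<close> into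
  \<open>k (e - d)\<close>. For each \<open>d\<close> at most one mode matches, so the support is
  finite and the sum over pairs can be iterated.\<close>

lemma twisted_field_finite:
  assumes "finite S" "\<And>d. d \<notin> S \<Longrightarrow> D u d = 0" "\<And>n w. YM 0 n w = 0" "k > 0"
  shows "twisted_field YM D k u e w = (\<Sum>d\<in>S. vertex_field YM (D u d) (of_nat k * (e - d)) w)"
proof -
  let ?g = "\<lambda>d n. if d + (- of_int n - 1) / of_nat k = e then YM (D u d) n w else 0"
  have iff: "d + (- of_int n - 1) / of_nat k = e \<longleftrightarrow> - of_int n - 1 = of_nat k * (e - d)" for d n
    using \<open>k > 0\<close> by (auto simp: field_simps)
  let ?N = "\<Union>d\<in>S. {n::int. - of_int n - 1 = of_nat k * (e - d)}"
  have "finite {n::int. - of_int n - 1 = z}" for z :: complex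
    by (rule finite_subset[of _ "{\<lfloor>Re (- z - 1)\<rfloor>}"]) auto
  then have fin: "finite (S \<times> ?N)"
    using assms(1) by auto
  have "twisted_field YM D k u e w = Sum_any (\<lambda>(d, n). ?g d n)"
    unfolding twisted_field_def fseries_def by (rule Sum_any.cong) auto
  also have "\<dots> = Sum_any (\<lambda>d. Sum_any (?g d))"
  proof (rule Sum_any.cartesian_product[symmetric, OF fin])
    show "{d. \<exists>n. ?g d n \<noteq> 0} \<times> {n. \<exists>d. ?g d n \<noteq> 0} \<subseteq> S \<times> ?N"
      using assms(2,3) iff by (auto split: if_splits) (metis assms(2,3))+
  qed
  also have "\<dots> = (\<Sum>d\<in>S. Sum_any (?g d))"
  proof (rule Sum_any.expand_superset[OF assms(1)])
    have "Sum_any (?g d) = 0" if "d \<notin> S" for d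
      using that by (simp add: assms(2,3) cong: if_cong)
    then show "{d. Sum_any (?g d) \<noteq> 0} \<subseteq> S"
      by blast
  qed
  finally show ?thesis
    unfolding vertex_field_def fseries_def iff .
qed

context weak_module
begin

sublocale YMr: Vector_Spaces.linear sM sM "YM u n" for u n
  by (rule YM_linear_right)

sublocale YMl: Vector_Spaces.linear sV sM "\<lambda>u. YM u n w" for n w
  by (rule YM_linear_left)

abbreviation vf :: "'v \<Rightarrow> complex \<Rightarrow> 'w \<Rightarrow> 'w" where "vf \<equiv> vertex_field YM"

lemma vf_int: "vf x (- of_int n - 1) w = YM x n w"
  using fseries_image[of "\<lambda>n. - of_int n - 1 :: complex" "\<lambda>n. YM x n w" n]
  by (simp add: vertex_field_def inj_def)

lemma vf_not_int: "(\<And>n. e \<noteq> - of_int n - 1) \<Longrightarrow> vf x e w = 0"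
  unfolding vertex_field_def by (rule fseries_not_image) auto

lemma vf_linear_left: "Vector_Spaces.linear sV sM (\<lambda>x. vf x e w)"
proof (cases "\<exists>n. e = - of_int n - 1")
  case True
  then show ?thesis by (auto simp: vf_int YM_linear_left)
next
  case False
  then have "vf x e w = 0" for x by (intro vf_not_int) auto
  then show ?thesis by unfold_locales auto
qed

lemma vf_linear_right: "Vector_Spaces.linear sM sM (vf x e)"
proof (cases "\<exists>n. e = - of_int n - 1")
  case True
  then obtain n where "e = - of_int n - 1" by blast
  then have "vf x e = YM x n" by (intro ext) (simp add: vf_int)
  then show ?thesis by (simp add: YM_linear_right)
next
  case False
  then have "vf x e w = 0" for w by (intro vf_not_int) auto
  then show ?thesis by unfold_locales auto
qed

sublocale vfl: Vector_Spaces.linear sV sM "\<lambda>x. vf x e w" for e w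
  by (rule vf_linear_left)

sublocale vfr: Vector_Spaces.linear sM sM "vf x e" for x e
  by (rule vf_linear_right)

text \<open>At integral exponents this is the commutator formula; at all others both sides vanish,
  since the exponents involved differ by integers.\<close>

lemma vf_commutator:
  assumes "p \<in> {0, 1}" "q \<in> {0, 1}" "x \<in> P p" "y \<in> P q"
    and I: "\<And>i. i \<ge> I \<Longrightarrow> Y x (int i) y = 0"
  shows "YM x m (vf y e w) - sM ((-1) ^ (p * q)) (vf y e (YM x m w))
    = (\<Sum>i<I. sM (of_int m gchoose i) (vf (Y x (int i) y) (e - of_int m + of_nat i) w))"
proof (cases "\<exists>n. e = - of_int n - 1")
  case True
  then obtain n where e: "e = - of_int n - 1" by blast
  have idx: "- of_int n - 1 - of_int m + of_nat i = - of_int (m + n - int i) - (1 :: complex)" for i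
    by simp
  show ?thesis
    unfolding e idx vf_int using jacobi_commutator[of sM Y YM p q x y w I m n] YM_jacobi[of p q x y w] assms
    by (simp add: M.vector_space_axioms YMl.zero)
next
  case False
  then have 1: "vf y e w = 0" for w by (intro vf_not_int) auto
  have "vf z (e - of_int m + of_nat i) w = 0" for z i
  proof (rule vf_not_int)
    fix n
    show "e - of_int m + of_nat i \<noteq> - of_int n - 1"
    proof
      assume "e - of_int m + of_nat i = - of_int n - 1"
      then have "e = - of_int (n - m + int i) - 1"
        by (simp add: algebra_simps)
      with False show False by blast
    qed
  qed
  with 1 show ?thesis by (simp add: YMr.zero)
qed

end

section \<open>The supercommutator\<close>

text \<open>The coefficient of the kernel at \<open>x0^i x1^b\<close>. After negating the upper
  index, \<open>s\<close> survives only in the support condition, that is, modulo integral multiples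
  of \<open>1/k\<close>.\<close>

definition comm_coeff :: "nat \<Rightarrow> complex \<Rightarrow> complex \<Rightarrow> nat \<Rightarrow> complex" where
  "comm_coeff k s b i = (if \<exists>n. b + of_nat i = of_int n / of_nat k + s
     then (1 / of_nat k) * (- b - 1 gchoose i) else 0)"

lemma comm_coeff_cong:
  assumes "s - s' = of_int n0 / of_nat k"
  shows "comm_coeff k s = comm_coeff k s'"
proof -
  have "(\<exists>n. z = of_int n / of_nat k + s) \<longleftrightarrow> (\<exists>n. z = of_int n / of_nat k + s')" for z
  proof
    assume "\<exists>n. z = of_int n / of_nat k + s"
    then obtain n where "z = of_int n / of_nat k + s" by blast
    then have "z = of_int (n + n0) / of_nat k + s'"
      using assms by (simp add: add_divide_distrib algebra_simps)
    then show "\<exists>n. z = of_int n / of_nat k + s'" by blast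
  next
    assume "\<exists>n. z = of_int n / of_nat k + s'"
    then obtain n where "z = of_int n / of_nat k + s'" by blast
    then have "z = of_int (n - n0) / of_nat k + s"
      using assms by (simp add: diff_divide_distrib algebra_simps)
    then show "\<exists>n. z = of_int n / of_nat k + s" by blast
  qed
  then show ?thesis
    by (intro ext) (simp only: comm_coeff_def)
qed

lemma gbinomial_upper: "((b + of_nat i) gchoose i) * (-1) ^ i = (- b - 1 gchoose i)" for b :: complex
  using gbinomial_negated_upper[of "- b - 1" i] by (simp add: add.commute mult.commute)

lemma delta_quot_comm_coeff:
  assumes "k > 0"
  shows "(root_delta k \<star> quot_pow s) (of_nat i, b, - 1 - b - of_nat i) = comm_coeff k s b i"
proof (cases "\<exists>n. b + of_nat i = of_int n / of_nat k + s")
  case True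
  then obtain n where n: "b + of_nat i = of_int n / of_nat k + s" by blast
  then have "b = of_int n / of_nat k + s - of_nat i" "- 1 - b - of_nat i = - 1 - of_int n / of_nat k - s"
    by (simp_all add: algebra_simps)
  then have "(of_nat i, b, - 1 - b - of_nat i)
      = (of_nat i :: complex, of_int n / of_nat k + s - of_nat i, - 1 - of_int n / of_nat k - s)"
    by (simp only: prod.inject simp_thms)
  then have "(root_delta k \<star> quot_pow s) (of_nat i, b, - 1 - b - of_nat i)
      = (1 / of_nat k) * (((b + of_nat i) gchoose i) * (-1) ^ i)"
    by (simp only: delta_quot_eq[OF assms] n)
  then show ?thesis
    unfolding gbinomial_upper using True by (simp add: comm_coeff_def)
next
  case False
  have "(root_delta k \<star> quot_pow s) (of_nat i, b, - 1 - b - of_nat i) = 0"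
  proof (rule ccontr)
    assume "\<not> ?thesis"
    then obtain i' n where "of_nat i = (of_nat i' :: complex)" "b = of_int n / of_nat k + s - of_nat i'"
      by (rule delta_quot_support)
    then have "b + of_nat i = of_int n / of_nat k + s" by simp
    with False show False by blast
  qed
  with False show ?thesis by (simp only: comm_coeff_def if_False)
qed

lemma root_delta_comm_coeff:
  assumes "k > 0"
  shows "root_delta k (of_nat i, b, - 1 - b - of_nat i) = comm_coeff k 0 b i"
proof (cases "\<exists>n. b + of_nat i = of_int n / of_nat k + 0")
  case True
  then obtain n where n: "b + of_nat i = of_int n / of_nat k" by auto
  then have "b = of_int n / of_nat k - of_nat i" "- 1 - b - of_nat i = - 1 - of_int n / of_nat k"
    by (simp_all add: algebra_simps)
  then have "(of_nat i, b, - 1 - b - of_nat i)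
      = (of_nat i :: complex, of_int n / of_nat k - of_nat i, - 1 - of_int n / of_nat k)"
    by (simp only: prod.inject simp_thms)
  then have "root_delta k (of_nat i, b, - 1 - b - of_nat i)
      = (1 / of_nat k) * (((b + of_nat i) gchoose i) * (-1) ^ i)"
    by (simp only: root_delta_eq[OF assms] n)
  then show ?thesis
    unfolding gbinomial_upper using True by (simp add: comm_coeff_def)
next
  case False
  have "root_delta k (of_nat i, b, - 1 - b - of_nat i) = 0"
  proof (rule ccontr)
    assume "\<not> ?thesis"
    then obtain i' n where "of_nat i = (of_nat i' :: complex)" "b = of_int n / of_nat k - of_nat i'"
      by (rule root_delta_support)
    then have "b + of_nat i = of_int n / of_nat k + 0" by simp
    with False show False by blast
  qed
  with False show ?thesis by (simp only: comm_coeff_def if_False)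
qed

section \<open>Coefficients of the twisted fields and their commutator\<close>

context weak_module
begin

context
  fixes a :: "nat \<Rightarrow> complex" and \<kappa> :: complex and k :: nat
  assumes Dc: "Delta_coeffs k a" and k: "k > 0" and \<kappa>: "\<kappa> ^ 2 = of_nat k"
begin

interpretation T: Vector_Spaces.linear sV sV "V.T a N" for N
  by (rule V.T_linear)

abbreviation T :: "nat \<Rightarrow> 'v \<Rightarrow> 'v" where "T \<equiv> V.T a"

abbreviation barY :: "'v \<Rightarrow> complex \<Rightarrow> 'w \<Rightarrow> 'w" where
  "barY \<equiv> twisted_field YM (Delta sV Y \<omega> G a \<kappa> k) k"

text \<open>What remains of \<open>x^e\<close> after removing the prefactor
  \<open>x^((1-k)m/2k)\<close> of weight \<open>m/2\<close>, written as an exponent of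
  \<open>x^(1/k)\<close>.\<close>

definition expo :: "int \<Rightarrow> complex \<Rightarrow> complex" where
  "expo m e = of_nat k * e - (1 - of_nat k) * of_int m / 2"

lemma k_nonzero: "of_nat k \<noteq> (0 :: complex)" and \<kappa>_nonzero: "\<kappa> \<noteq> 0"
  using k \<kappa> by auto

lemma barY_formula:
  assumes F: "finite F" "{m. V.wcomp u m \<noteq> 0} \<subseteq> F" and B: "\<And>m N. m \<in> F \<Longrightarrow> N \<ge> B \<Longrightarrow> T N (V.wcomp u m) = 0"
  shows "barY u e w = (\<Sum>m\<in>F. \<Sum>N<B. sM (\<kappa> powi (- m)) (vf (T N (V.wcomp u m)) (expo m e + of_nat N) w))"
proof -
  let ?g = "\<lambda>(N::nat, m::int). - (of_nat N / of_nat k) + (1 - of_nat k) * of_int m / (2 * of_nat k) :: complex"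
  let ?y = "\<lambda>(N, m). T N (sV (\<kappa> powi (- m)) (V.wcomp u m))"
  define I where "I = {..<B} \<times> F"
  have I: "finite I" using F by (simp add: I_def)
  have y0: "?y z = 0" if "z \<notin> I" for z
  proof -
    obtain N m where z: "z = (N, m)" by (cases z)
    with that have "m \<notin> F \<or> m \<in> F \<and> N \<ge> B" by (auto simp: I_def)
    then have "V.wcomp u m = 0 \<or> T N (V.wcomp u m) = 0"
      using F(2) B by blast
    then have "T N (V.wcomp u m) = 0"
      by (auto simp: T.zero)
    then show ?thesis by (simp add: z T.scale)
  qed
  have D: "Delta sV Y \<omega> G a \<kappa> k u d = (\<Sum>z\<in>I. if ?g z = d then ?y z else 0)" for d
  proof -
    have "Delta sV Y \<omega> G a \<kappa> k u d = Sum_any (\<lambda>z. if ?g z = d then ?y z else 0)"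
      unfolding Delta_def fseries_def V.T_def V.wcomp_def ..
    also have "\<dots> = (\<Sum>z\<in>I. if ?g z = d then ?y z else 0)"
    proof (rule Sum_any.expand_superset[OF I])
      have "(if ?g z = d then ?y z else 0) = 0" if "z \<notin> I" for z
        using y0[OF that] by simp
      then show "{z. (if ?g z = d then ?y z else 0) \<noteq> 0} \<subseteq> I"
        by blast
    qed
    finally show ?thesis .
  qed
  have D0: "Delta sV Y \<omega> G a \<kappa> k u d = 0" if "d \<notin> ?g ` I" for d
    unfolding D by (rule sum.neutral) (use that in auto)
  have "barY u e w = (\<Sum>d\<in>?g ` I. vf (Delta sV Y \<omega> G a \<kappa> k u d) (of_nat k * (e - d)) w)"
    by (rule twisted_field_finite) (use I D0 k in \<open>auto simp: YMl.zero\<close>)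
  \<comment> \<open>Different pairs \<open>(N, m)\<close> may give the same exponent
    \<open>d\<close>, so each coefficient of \<open>Delta\<close> is itself a sum over the pairs
    with that exponent.\<close>
  also have "\<dots> = (\<Sum>d\<in>?g ` I. \<Sum>z\<in>I. if ?g z = d then vf (?y z) (of_nat k * (e - d)) w else 0)"
    unfolding D vfl.sum by (intro sum.cong refl) (simp add: vfl.zero)
  also have "\<dots> = (\<Sum>z\<in>I. \<Sum>d\<in>?g ` I. if d = ?g z then vf (?y z) (of_nat k * (e - d)) w else 0)"
    by (subst sum.swap) (intro sum.cong refl, auto)
  also have "\<dots> = (\<Sum>z\<in>I. vf (?y z) (of_nat k * (e - ?g z)) w)"
    by (intro sum.cong refl) (subst sum.delta, use I in auto)
  also have "\<dots> = (\<Sum>N<B. \<Sum>m\<in>F. sM (\<kappa> powi (- m)) (vf (T N (V.wcomp u m)) (expo m e + of_nat N) w))"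
    unfolding I_def sum.cartesian_product
  proof (rule sum.cong[OF refl])
    fix z assume "z \<in> {..<B} \<times> F"
    obtain N m where z: "z = (N, m)" by (cases z)
    have "of_nat k * (e - ?g (N, m)) = expo m e + of_nat N"
      using k_nonzero by (simp add: expo_def field_simps)
    then show "vf (?y z) (of_nat k * (e - ?g z)) w
       = (case z of (N, m) \<Rightarrow> sM (\<kappa> powi (- m)) (vf (T N (V.wcomp u m)) (expo m e + of_nat N) w))"
      by (simp add: z T.scale vfl.scale)
  qed
  finally show ?thesis
    by (subst sum.swap)
qed

lemma barY_homogeneous:
  assumes u: "u \<in> G m" and B: "\<And>N. N \<ge> B \<Longrightarrow> T N u = 0"
  shows "barY u e w = sM (\<kappa> powi (- m)) (\<Sum>N<B. vf (T N u) (expo m e + of_nat N) w)"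
proof -
  have "barY u e w = (\<Sum>m'\<in>{m}. \<Sum>N<B. sM (\<kappa> powi (- m')) (vf (T N (V.wcomp u m')) (expo m' e + of_nat N) w))"
    by (rule barY_formula) (use B in \<open>auto simp: V.wcomp_homogeneous[OF u]\<close>)
  then show ?thesis
    by (simp add: V.wcomp_homogeneous[OF u] M.scale_sum_right)
qed

lemma barY_add: "barY (x + y) e w = barY x e w + barY y e w"
proof -
  define F where "F = {m. V.wcomp x m \<noteq> 0} \<union> {m. V.wcomp y m \<noteq> 0}"
  have F: "finite F" by (simp add: F_def V.wcomp_finite)
  obtain B where B: "\<And>N z. z \<in> V.wcomp x ` F \<union> V.wcomp y ` F \<Longrightarrow> N \<ge> B \<Longrightarrow> T N z = 0"
    using V.T_bound[of "V.wcomp x ` F \<union> V.wcomp y ` F" a] F by blast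
  have x: "barY x e w = (\<Sum>m\<in>F. \<Sum>N<B. sM (\<kappa> powi (- m)) (vf (T N (V.wcomp x m)) (expo m e + of_nat N) w))"
    by (rule barY_formula[OF F]) (use B in \<open>auto simp: F_def\<close>)
  have y: "barY y e w = (\<Sum>m\<in>F. \<Sum>N<B. sM (\<kappa> powi (- m)) (vf (T N (V.wcomp y m)) (expo m e + of_nat N) w))"
    by (rule barY_formula[OF F]) (use B in \<open>auto simp: F_def\<close>)
  have "barY (x + y) e w = (\<Sum>m\<in>F. \<Sum>N<B. sM (\<kappa> powi (- m)) (vf (T N (V.wcomp (x + y) m)) (expo m e + of_nat N) w))"
    by (rule barY_formula[OF F]) (use B in \<open>auto simp: F_def V.wcomp_add T.add\<close>)
  then show ?thesis
    unfolding x y V.wcomp_add T.add vfl.add M.scale_right_distrib sum.distrib .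
qed

lemma barY_zero: "barY 0 e w = 0"
  using barY_add[of 0 0 e w] by simp

lemma barY_sum: "barY (sum f A) e w = (\<Sum>i\<in>A. barY (f i) e w)"
  by (induction A rule: infinite_finite_induct) (simp_all add: barY_add barY_zero)

lemma barY_linear_right: "Vector_Spaces.linear sM sM (barY u e)"
proof -
  define F where "F = {m. V.wcomp u m \<noteq> 0}"
  have F: "finite F" by (simp add: F_def V.wcomp_finite)
  obtain B where B: "\<And>N z. z \<in> V.wcomp u ` F \<Longrightarrow> N \<ge> B \<Longrightarrow> T N z = 0"
    using V.T_bound[of "V.wcomp u ` F" a] F by blast
  have *: "barY u e w = (\<Sum>m\<in>F. \<Sum>N<B. sM (\<kappa> powi (- m)) (vf (T N (V.wcomp u m)) (expo m e + of_nat N) w))" for w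
    by (rule barY_formula[OF F]) (use B in \<open>auto simp: F_def\<close>)
  show ?thesis
    by unfold_locales
      (simp_all add: * vfr.add vfr.scale M.scale_right_distrib sum.distrib M.scale_sum_right mult.commute)
qed

interpretation bar: Vector_Spaces.linear sM sM "barY u e" for u e
  by (rule barY_linear_right)

text \<open>The commutators of \<open>T N u\<close> with \<open>T N' v\<close> have coefficients
  \<open>M - N choose i\<close>. These are, up to \<open>k\<close>, the coefficients of
  \<open>substitution\<close> at \<open>(1 + z)^\<beta>\<close>, so the conjugation formula replaces
  the sums over \<open>N\<close> and \<open>N'\<close> by \<open>T\<close> applied to
  \<open>Y u i v\<close>.\<close>

lemma supercommutator_homogeneous:
  assumes p: "p \<in> {0, 1}" and q: "q \<in> {0, 1}" and u: "u \<in> G mu" and v: "v \<in> G mv"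
    and mu: "mu mod 2 = int p" and mv: "mv mod 2 = int q"
    and I: "\<And>i. i \<ge> I \<Longrightarrow> Y u (int i) v = 0"
  shows "barY u b (barY v d w) - sM ((-1) ^ (p * q)) (barY v d (barY u b w))
    = (\<Sum>i<I. sM (comm_coeff k (of_nat p / (2 * of_nat k) * (1 - of_nat k)) b i)
        (barY (Y u (int i) v) (d + 1 + b + of_nat i) w))"
proof -
  let ?s = "of_nat p / (2 * of_nat k) * (1 - of_nat k) :: complex"
  define t where "t = mu div 2"
  have mu_t: "mu = int p + 2 * t" using mu by (simp add: t_def) presburger
  have exu: "expo mu b = of_nat k * (b - ?s) - (1 - of_nat k) * of_int t"
    using k_nonzero by (simp add: expo_def mu_t field_simps)
  obtain B where "\<And>N x. x \<in> {u, v} \<union> (\<lambda>i. Y u (int i) v) ` {..<I} \<Longrightarrow> N \<ge> B \<Longrightarrow> T N x = 0"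
    using V.T_bound[of "{u, v} \<union> (\<lambda>i. Y u (int i) v) ` {..<I}" a] by blast
  then have Bu: "T N u = 0" and Bv: "T N v = 0" and BY: "T N (Y u (int i) v) = 0" if "N \<ge> B" for N i
    using that I[of i] by (auto simp: T.zero) (metis T.zero I imageI lessThan_iff not_le UnI2)
  obtain J where J0: "\<And>i x y. x \<in> (\<lambda>N. T N u) ` {..<B} \<Longrightarrow> y \<in> (\<lambda>N. T N v) ` {..<B} \<Longrightarrow> i \<ge> J \<Longrightarrow> Y x (int i) y = 0"
    using V.Y_bound[of "(\<lambda>N. T N u) ` {..<B}" "(\<lambda>N. T N v) ` {..<B}"] by blast
  have J: "Y (T N u) (int i) (T N' v) = 0" if "i \<ge> J" for i N N'
    using J0[OF imageI imageI that, of N N'] Bu[of N] Bv[of N']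
    by (cases "N < B"; cases "N' < B") (auto simp: V.Yl.zero V.Yr.zero)
  have bu: "barY u b x = sM (\<kappa> powi (- mu)) (\<Sum>N<B. vf (T N u) (expo mu b + of_nat N) x)" for x
    by (rule barY_homogeneous[OF u Bu])
  have bv: "barY v d x = sM (\<kappa> powi (- mv)) (\<Sum>N<B. vf (T N v) (expo mv d + of_nat N) x)" for x
    by (rule barY_homogeneous[OF v Bv])
  \<comment> \<open>The shift by \<open>i\<close> is invisible because integers are multiples of
    \<open>1/k\<close>. The exponent \<open>?s\<close> absorbs the parity of \<open>mu\<close>, and
    the even rest \<open>2 t\<close> contributes integers only.\<close>
  have ex_iff: "(\<exists>n. b + of_nat i = of_int n / of_nat k + ?s) \<longleftrightarrow> (\<exists>M. expo mu b = - of_int M - 1)" for i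
  proof
    assume "\<exists>n. b + of_nat i = of_int n / of_nat k + ?s"
    then obtain n where n: "b + of_nat i = of_int n / of_nat k + ?s" by blast
    then have "b - ?s = of_int n / of_nat k - of_nat i" by (simp add: algebra_simps)
    then have "of_nat k * (b - ?s) = of_int n - of_nat k * of_nat i"
      using k_nonzero by (simp only: right_diff_distrib) simp
    then have "expo mu b = - of_int (int k * int i + (1 - int k) * t - n - 1) - 1"
      unfolding exu by (simp add: algebra_simps)
    then show "\<exists>M. expo mu b = - of_int M - 1" by blast
  next
    assume "\<exists>M. expo mu b = - of_int M - 1"
    then obtain M where "expo mu b = - of_int M - 1" by blast
    then have "of_nat k * (b + of_nat i - ?s) = of_int (int k * int i + (1 - int k) * t - M - 1)"
      unfolding exu by (simp add: algebra_simps)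
    then have "b + of_nat i - ?s = of_int (int k * int i + (1 - int k) * t - M - 1) / of_nat k"
      using k_nonzero by (simp add: field_simps del: of_int_diff of_int_add of_int_mult)
    then have "b + of_nat i = of_int (int k * int i + (1 - int k) * t - M - 1) / of_nat k + ?s"
      by (simp add: diff_eq_eq)
    then show "\<exists>n. b + of_nat i = of_int n / of_nat k + ?s" by blast
  qed
  show ?thesis
  proof (cases "\<exists>M. expo mu b = - of_int M - 1")
    case False
    have "vf x (expo mu b + of_nat N) w = 0" for x N w
    proof (rule vf_not_int)
      fix n
      show "expo mu b + of_nat N \<noteq> - of_int n - 1"
      proof
        assume "expo mu b + of_nat N = - of_int n - 1"
        then have "expo mu b = - of_int (n + int N) - 1" by (simp add: algebra_simps)
        with False show False by blast
      qed
    qed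
    then have "barY u b x = 0" for x by (simp add: bu)
    moreover have "comm_coeff k ?s b i = 0" for i
      using False unfolding comm_coeff_def ex_iff by simp
    ultimately show ?thesis by (simp add: bar.zero)
  next
    case True
    then obtain M where M: "expo mu b = - of_int M - 1" by blast
    \<comment> \<open>The exponent of the test series; its coefficients are the binomials in
      \<open>comm_coeff\<close>.\<close>
    define \<beta> where "\<beta> = - b - 1"
    define e0 where "e0 = expo mv d - of_int M"
    define \<kappa>' where "\<kappa>' = \<kappa> powi (- mu) * \<kappa> powi (- mv)"
    \<comment> \<open>Large enough for both rectangles: \<open>N < B\<close> with
      \<open>N' + i < B + J\<close>, and \<open>N < B\<close> with \<open>i < I\<close>.\<close>
    define R where "R = B + (B + J) + I"
    define g where "g N N' i = sM (of_int (M - int N) gchoose i)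
        (vf (Y (T N u) (int i) (T N' v)) (e0 + of_nat (N + N' + i)) w)" for N N' i
    define h where "h N i = sM ((1 / of_nat k) * (of_nat k ^ Suc i * (\<beta> gchoose i)))
        (vf (T N (Y u (int i) v)) (e0 + of_nat (N + i)) w)" for N i
    have vfM: "vf x (expo mu b + of_nat N) y = YM x (M - int N) y" for x N y
    proof -
      have "expo mu b + of_nat N = - of_int (M - int N) - 1" by (simp add: M)
      then show ?thesis by (simp only: vf_int)
    qed
    have Tu: "T N u \<in> P p" and Tv: "T N v \<in> P q" for N
    proof -
      have "(mu - 2 * int N) mod 2 = int p" "(mv - 2 * int N) mod 2 = int q"
        using mu mv by presburger+
      then show "T N u \<in> P p" "T N v \<in> P q"
        using V.G_parity[OF V.T_in_G[OF u]] V.G_parity[OF V.T_in_G[OF v]] p q by blast+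
    qed
    have "barY u b (barY v d w) - sM ((-1) ^ (p * q)) (barY v d (barY u b w))
      = sM \<kappa>' (\<Sum>N<B. \<Sum>N'<B. YM (T N u) (M - int N) (vf (T N' v) (expo mv d + of_nat N') w)
          - sM ((-1) ^ (p * q)) (vf (T N' v) (expo mv d + of_nat N') (YM (T N u) (M - int N) w)))"
    proof -
      have 1: "barY u b (barY v d w)
        = sM \<kappa>' (\<Sum>N<B. \<Sum>N'<B. YM (T N u) (M - int N) (vf (T N' v) (expo mv d + of_nat N') w))"
        unfolding bu bv vfM by (simp add: YMr.scale YMr.sum \<kappa>'_def flip: M.scale_sum_right)
      have "barY v d (barY u b w)
        = sM \<kappa>' (\<Sum>N'<B. \<Sum>N<B. vf (T N' v) (expo mv d + of_nat N') (YM (T N u) (M - int N) w))"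
        unfolding bu bv vfM by (simp add: vfr.scale vfr.sum \<kappa>'_def mult.commute flip: M.scale_sum_right)
      then have 2: "barY v d (barY u b w)
        = sM \<kappa>' (\<Sum>N<B. \<Sum>N'<B. vf (T N' v) (expo mv d + of_nat N') (YM (T N u) (M - int N) w))"
        by (subst sum.swap)
      show ?thesis
        unfolding 1 2 sum_subtractf M.scale_right_diff_distrib
        by (simp add: mult.commute flip: M.scale_sum_right)
    qed
    also have "\<dots> = sM \<kappa>' (\<Sum>N<B. \<Sum>N'<B. \<Sum>i<J. g N N' i)"
    proof -
      have "YM (T N u) (M - int N) (vf (T N' v) (expo mv d + of_nat N') w)
          - sM ((-1) ^ (p * q)) (vf (T N' v) (expo mv d + of_nat N') (YM (T N u) (M - int N) w))
          = (\<Sum>i<J. g N N' i)" for N N'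
      proof -
        have "expo mv d + of_nat N' - of_int (M - int N) + of_nat i = e0 + of_nat (N + N' + i)" for i
          by (simp add: e0_def)
        then show ?thesis
          using vf_commutator[of p q "T N u" "T N' v" J "M - int N" "expo mv d + of_nat N'" w, OF p q Tu Tv J]
          by (simp only: g_def)
      qed
      then show ?thesis by simp
    qed
    also have "(\<Sum>N<B. \<Sum>N'<B. \<Sum>i<J. g N N' i) = (\<Sum>r<R. conv r (\<lambda>N m. conv m (g N)))"
    proof -
      have g0: "g N N' i = 0" if "N \<ge> B \<or> N' \<ge> B \<or> i \<ge> J" for N N' i
        using that Bu[of N] Bv[of N'] J[of i N N']
        by (auto simp: g_def V.Yl.zero V.Yr.zero vfl.zero)
      have "(\<Sum>N'<B. \<Sum>i<J. g N N' i) = (\<Sum>m<B + J. conv m (g N))" for N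
        by (rule sum_eq_sum_conv) (auto simp: g0)
      moreover have "(\<Sum>N<B. \<Sum>m<B + J. conv m (g N)) = (\<Sum>r<R. conv r (\<lambda>N m. conv m (g N)))"
      proof (rule sum_eq_sum_conv)
        fix N m assume N: "N \<ge> B \<or> m \<ge> B + J"
        show "conv m (g N) = 0"
        proof (rule conv_eq_0)
          fix i j assume "i + j = m"
          with N have "N \<ge> B \<or> i \<ge> B \<or> j \<ge> J" by auto
          then show "g N i j = 0" by (rule g0)
        qed
      qed (simp add: R_def)
      ultimately show ?thesis by simp
    qed
    also have "\<dots> = (\<Sum>r<R. conv r h)"
    proof (rule sum.cong[OF refl])
      fix r
      \<comment> \<open>Under the substitution the test series becomes a power of
        \<open>1 + x\<close> with exponent the integral mode \<open>M - N\<close>: the powers of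
        \<open>x\<close> built into the twist fit the change of variable. The prefactor
        \<open>k\<close> is cancelled by the \<open>1/k\<close> of the kernel.\<close>
      have upper: "of_nat k - 1 + of_int mu / 2 * (1 - of_nat k) - of_nat N + \<beta> * of_nat k = of_int (M - int N)" for N
      proof -
        have "of_int M = - expo mu b - 1" by (simp add: M)
        then show ?thesis by (simp add: \<beta>_def expo_def algebra_simps)
      qed
      have "conv r (\<lambda>N m. conv m (g N))
        = conv r (\<lambda>N m. conv m (\<lambda>N' i. vf (sV (of_int (M - int N) gchoose i) (Y (T N u) (int i) (T N' v))) (e0 + of_nat r) w))"
        unfolding g_def by (intro conv_cong) (simp add: vfl.scale add_ac)
      also have "\<dots> = vf (conv r (\<lambda>N m. conv m (\<lambda>N' i. sV (of_int (M - int N) gchoose i) (Y (T N u) (int i) (T N' v))))) (e0 + of_nat r) w"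
        by (simp add: conv_def vfl.sum)
      also have "conv r (\<lambda>N m. conv m (\<lambda>N' i. sV (of_int (M - int N) gchoose i) (Y (T N u) (int i) (T N' v))))
         = sV (1 / of_nat k) (V.exp_inside a k (of_int mu / 2) (fps_binomial \<beta>) u v r)"
        unfolding V.exp_inside_def[OF Dc k] substitution_binomial upper V.conv_scale[symmetric] using k_nonzero by simp
      also have "V.exp_inside a k (of_int mu / 2) (fps_binomial \<beta>) u v r = V.exp_after a k (fps_binomial \<beta>) u v r"
        by (rule V.exp_after_eq_exp_inside[OF Dc k V.G_L0[OF u] V.G_L0[OF v], symmetric])
      also have "vf (sV (1 / of_nat k) (V.exp_after a k (fps_binomial \<beta>) u v r)) (e0 + of_nat r) w
          = conv r (\<lambda>N i. sM (1 / of_nat k) (sM (of_nat k ^ Suc i * (\<beta> gchoose i)) (vf (T N (Y u (int i) v)) (e0 + of_nat r) w)))"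
        unfolding V.exp_after_def[OF Dc k] M.conv_scale by (simp add: conv_def vfl.sum vfl.scale)
      also have "\<dots> = conv r h"
        unfolding h_def by (rule conv_cong) (auto simp: add_ac)
      finally show "conv r (\<lambda>N m. conv m (g N)) = conv r h" .
    qed
    also have "\<dots> = (\<Sum>N<B. \<Sum>i<I. h N i)"
      by (rule sum_eq_sum_conv[symmetric]) (auto simp: h_def R_def BY I T.zero vfl.zero)
    also have "sM \<kappa>' (\<Sum>N<B. \<Sum>i<I. h N i) = (\<Sum>i<I. sM (comm_coeff k ?s b i) (barY (Y u (int i) v) (d + 1 + b + of_nat i) w))"
    proof -
      have "sM (comm_coeff k ?s b i) (barY (Y u (int i) v) (d + 1 + b + of_nat i) w) = sM \<kappa>' (\<Sum>N<B. h N i)" for i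
      proof -
        let ?m = "mu + mv - 2 * int i - 2"
        have kc: "comm_coeff k ?s b i = (1 / of_nat k) * (\<beta> gchoose i)"
          unfolding comm_coeff_def ex_iff using True by (simp add: \<beta>_def)
        have ex: "expo ?m (d + 1 + b + of_nat i) = e0 + of_nat i"
        proof -
          have m: "of_int M = - expo mu b - 1" by (simp add: M)
          show ?thesis unfolding e0_def m expo_def by (simp add: field_simps)
        qed
        \<comment> \<open>The mode \<open>i\<close> lowers the doubled weight by
          \<open>2 (i + 1)\<close>, so \<open>\<kappa>\<close> yields \<open>k^(i+1)\<close>, the
          factor put into \<open>exp_after\<close>.\<close>
        have pw: "\<kappa> powi (- ?m) = \<kappa>' * of_nat k ^ Suc i"
        proof -
          have "- ?m = - mu + (- mv + 2 * int (Suc i))" by simp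
          then have "\<kappa> powi (- ?m) = \<kappa> powi (- mu) * (\<kappa> powi (- mv) * \<kappa> powi (2 * int (Suc i)))"
            using \<kappa>_nonzero by (simp only: power_int_add simp_thms)
          also have "\<kappa> powi (2 * int (Suc i)) = (\<kappa> ^ 2) ^ Suc i"
            by (simp only: power_int_mult power_int_of_nat) simp
          finally show ?thesis by (simp add: \<kappa> \<kappa>'_def)
        qed
        have "barY (Y u (int i) v) (d + 1 + b + of_nat i) w
            = sM (\<kappa> powi (- ?m)) (\<Sum>N<B. vf (T N (Y u (int i) v)) (expo ?m (d + 1 + b + of_nat i) + of_nat N) w)"
          by (rule barY_homogeneous[OF V.Y_in_G[OF u v] BY])
        then show ?thesis
          unfolding kc ex pw h_def using k_nonzero
          by (simp add: M.scale_sum_right add_ac mult_ac)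
      qed
      then show ?thesis
        by (simp add: M.scale_sum_right sum.swap[of _ "{..<I}"])
    qed
    finally show ?thesis .
  qed
qed

text \<open>Weight components inherit the parity, so biadditivity reduces to homogeneous weights;
  one truncation bound serves all pairs of components.\<close>

lemma supercommutator_sum:
  assumes p: "p \<in> {0, 1}" and q: "q \<in> {0, 1}" and u: "u \<in> P p" and v: "v \<in> P q"
  obtains I :: nat where "\<forall>i\<ge>I. Y u (int i) v = 0"
    "\<forall>b c w. barY u b (barY v c w) - sM ((-1) ^ (p * q)) (barY v c (barY u b w))
    = (\<Sum>i<I. sM (comm_coeff k (of_nat p / (2 * of_nat k) * (1 - of_nat k)) b i)
        (barY (Y u (int i) v) (c + 1 + b + of_nat i) w))"
proof -
  define F where "F = {m. V.wcomp u m \<noteq> 0}"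
  define F' where "F' = {m. V.wcomp v m \<noteq> 0}"
  have F: "finite F" "(\<Sum>m\<in>F. V.wcomp u m) = u" and F': "finite F'" "(\<Sum>m\<in>F'. V.wcomp v m) = v"
    by (simp_all add: F_def F'_def V.wcomp_finite V.sum_wcomp)
  obtain I :: nat where I: "\<And>i x y. x \<in> V.wcomp u ` F \<Longrightarrow> y \<in> V.wcomp v ` F' \<Longrightarrow> i \<ge> I \<Longrightarrow> Y x (int i) y = 0"
    using V.Y_bound[of "V.wcomp u ` F" "V.wcomp v ` F'"] F F' by blast
  have Y: "Y u (int i) v = (\<Sum>m\<in>F. \<Sum>n\<in>F'. Y (V.wcomp u m) (int i) (V.wcomp v n))" for i
  proof -
    have "Y u (int i) v = Y (\<Sum>m\<in>F. V.wcomp u m) (int i) (\<Sum>m\<in>F'. V.wcomp v m)"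
      by (simp only: F F')
    then show ?thesis by (simp only: V.Yl.sum V.Yr.sum) (rule sum.swap)
  qed
  have bu: "barY u e w = (\<Sum>m\<in>F. barY (V.wcomp u m) e w)" for e w
    using barY_sum[of "V.wcomp u" F e w] by (simp only: F)
  have bv: "barY v e w = (\<Sum>m\<in>F'. barY (V.wcomp v m) e w)" for e w
    using barY_sum[of "V.wcomp v" F' e w] by (simp only: F')
  show ?thesis
  proof (rule that[of I])
    show "\<forall>i\<ge>I. Y u (int i) v = 0"
      unfolding Y by (intro allI impI sum.neutral ballI) (use I in auto)
    show "\<forall>b c w. barY u b (barY v c w) - sM ((-1) ^ (p * q)) (barY v c (barY u b w))
    = (\<Sum>i<I. sM (comm_coeff k (of_nat p / (2 * of_nat k) * (1 - of_nat k)) b i)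
        (barY (Y u (int i) v) (c + 1 + b + of_nat i) w))"
    proof (intro allI)
      fix b c w
      let ?C = "\<lambda>i. comm_coeff k (of_nat p / (2 * of_nat k) * (1 - of_nat k)) b i"
      have "barY u b (barY v c w) - sM ((-1) ^ (p * q)) (barY v c (barY u b w))
        = (\<Sum>m\<in>F. \<Sum>n\<in>F'. barY (V.wcomp u m) b (barY (V.wcomp v n) c w)
            - sM ((-1) ^ (p * q)) (barY (V.wcomp v n) c (barY (V.wcomp u m) b w)))"
      proof -
        have "barY u b (barY v c w) = (\<Sum>m\<in>F. \<Sum>n\<in>F'. barY (V.wcomp u m) b (barY (V.wcomp v n) c w))"
          unfolding bu bv bar.sum by (rule sum.swap)
        moreover have "barY v c (barY u b w) = (\<Sum>m\<in>F. \<Sum>n\<in>F'. barY (V.wcomp v n) c (barY (V.wcomp u m) b w))"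
          unfolding bu bv bar.sum ..
        ultimately show ?thesis
          by (simp add: sum_subtractf M.scale_sum_right)
      qed
      also have "\<dots> = (\<Sum>m\<in>F. \<Sum>n\<in>F'. \<Sum>i<I. sM (?C i) (barY (Y (V.wcomp u m) (int i) (V.wcomp v n)) (c + 1 + b + of_nat i) w))"
      proof (intro sum.cong refl)
        fix m n assume m: "m \<in> F" and n: "n \<in> F'"
        show "barY (V.wcomp u m) b (barY (V.wcomp v n) c w)
            - sM ((-1) ^ (p * q)) (barY (V.wcomp v n) c (barY (V.wcomp u m) b w))
          = (\<Sum>i<I. sM (?C i) (barY (Y (V.wcomp u m) (int i) (V.wcomp v n)) (c + 1 + b + of_nat i) w))"
        proof (rule supercommutator_homogeneous[where mu = m and mv = n and u = "V.wcomp u m" and v = "V.wcomp v n",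
              OF p q V.wcomp_in_G V.wcomp_in_G])
          show "m mod 2 = int p" "n mod 2 = int q"
            using V.wcomp_parity[OF p u] V.wcomp_parity[OF q v] m n by (auto simp: F_def F'_def)
          show "Y (V.wcomp u m) (int i) (V.wcomp v n) = 0" if "i \<ge> I" for i
            using I m n that by blast
        qed
      qed
      also have "\<dots> = (\<Sum>i<I. \<Sum>m\<in>F. \<Sum>n\<in>F'. sM (?C i) (barY (Y (V.wcomp u m) (int i) (V.wcomp v n)) (c + 1 + b + of_nat i) w))"
        unfolding sum.swap[of _ "{..<I}"] ..
      also have "\<dots> = (\<Sum>i<I. sM (?C i) (barY (Y u (int i) v) (c + 1 + b + of_nat i) w))"
        unfolding Y barY_sum M.scale_sum_right ..
      finally show "barY u b (barY v c w) - sM ((-1) ^ (p * q)) (barY v c (barY u b w))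
        = (\<Sum>i<I. sM (?C i) (barY (Y u (int i) v) (c + 1 + b + of_nat i) w))" .
    qed
  qed
qed

text \<open>Only the support and the coefficients of the kernel \<open>D\<close> matter, so the
  three kernels of the theorem can be treated alike.\<close>

lemma supercommutator_Res0:
  assumes p: "p \<in> {0, 1}" and q: "q \<in> {0, 1}" and u: "u \<in> P p" and v: "v \<in> P q"
    and supp: "\<And>a b c. D (a, b, c) \<noteq> 0 \<Longrightarrow> \<exists>i::nat. a = of_nat i \<and> c = - 1 - b - of_nat i"
    and val: "\<And>i b. D (of_nat i, b, - 1 - b - of_nat i) = comm_coeff k (of_nat p / (2 * of_nat k) * (1 - of_nat k)) b i"
  shows "supercommutator sM barY p q u v w = Res0 (fscale sM D (iterate02 barY Y u v w))"
proof -
  obtain I :: nat where I: "\<forall>i\<ge>I. Y u (int i) v = 0"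
    "\<forall>b c w. barY u b (barY v c w) - sM ((-1) ^ (p * q)) (barY v c (barY u b w))
    = (\<Sum>i<I. sM (comm_coeff k (of_nat p / (2 * of_nat k) * (1 - of_nat k)) b i)
        (barY (Y u (int i) v) (c + 1 + b + of_nat i) w))"
    by (rule supercommutator_sum[OF p q u v])
  show ?thesis
  proof (rule ext, clarify)
    fix b c
    have "Res0 (fscale sM D (iterate02 barY Y u v w)) (b, c)
       = (\<Sum>i<I. sM (D (of_nat i, b, - 1 - b - of_nat i)) (barY (Y u (int i) v) (c + 1 + b + of_nat i) w))"
      unfolding Res0_def prod.case
      by (rule fscale_iterate02[of sM D b barY w I Y u v c, OF M.vector_space_axioms supp barY_zero I(1)[rule_format]])
    then show "supercommutator sM barY p q u v w (b, c) = Res0 (fscale sM D (iterate02 barY Y u v w)) (b, c)"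
      by (simp only: val supercommutator_def prod.case I(2)[rule_format])
  qed
qed

end

end

theorem lemma4p3:
  fixes sV :: "complex \<Rightarrow> 'v \<Rightarrow> 'v::ab_group_add"
    and sM :: "complex \<Rightarrow> 'w \<Rightarrow> 'w::ab_group_add"
    and P :: "nat \<Rightarrow> 'v set" and Q :: "nat \<Rightarrow> 'w set"
    and Y :: "'v \<Rightarrow> int \<Rightarrow> 'v \<Rightarrow> 'v" and YM :: "'v \<Rightarrow> int \<Rightarrow> 'w \<Rightarrow> 'w"
    and vac \<omega> :: 'v and c \<kappa> :: complex and G :: "int \<Rightarrow> 'v set"
    and k p q :: nat and a :: "nat \<Rightarrow> complex" and u v :: 'v
  assumes "vertex_operator_superalgebra sV P Y vac \<omega> c G"
    and "weak_module sV P Y vac \<omega> c G sM Q YM"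
    and "k > 0"
    and "\<kappa> ^ 2 = of_nat k"
    and "Delta_coeffs k a"
    and "p \<in> {0, 1}" and "u \<in> P p"
    and "q \<in> {0, 1}" and "v \<in> P q"
  shows "let barY = twisted_field YM (Delta sV Y \<omega> G a \<kappa> k) k in
    (\<forall>w. supercommutator sM barY p q u v w =
       Res0 (fscale sM (root_delta k \<star> quot_pow (of_nat p / (2 * of_nat k) * (1 - of_nat k)))
         (iterate02 barY Y u v w))) \<and>
    (odd k \<longrightarrow> (\<forall>w. supercommutator sM barY p q u v w =
       Res0 (fscale sM (root_delta k) (iterate02 barY Y u v w)))) \<and>
    (even k \<longrightarrow> (\<forall>w. supercommutator sM barY p q u v w =
       Res0 (fscale sM (root_delta k \<star> quot_pow (of_nat p / (2 * of_nat k)))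
         (iterate02 barY Y u v w))))"
proof -
  interpret weak_module sV P Y vac \<omega> c G sM Q YM by fact
  let ?s = "of_nat p / (2 * of_nat k) * (1 - of_nat k) :: complex"
  have k0: "of_nat k \<noteq> (0 :: complex)" using assms(3) by simp
  note res = supercommutator_Res0[OF assms(5,3,4,6,8,7,9)]
  have supp: "\<exists>i::nat. a = of_nat i \<and> c = - 1 - b - of_nat i"
    if "(root_delta k \<star> quot_pow s) (a, b, c) \<noteq> 0" for s a b c
    using that by (rule delta_quot_support) auto
  have supp0: "\<exists>i::nat. a = of_nat i \<and> c = - 1 - b - of_nat i" if "root_delta k (a, b, c) \<noteq> 0" for a b c
    using that by (rule root_delta_support) auto
  \<comment> \<open>For \<open>k = 2 l + 1\<close> the exponent is \<open>- p l / k\<close>, an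
    integral multiple of \<open>1/k\<close>.\<close>
  have odd: "comm_coeff k ?s = comm_coeff k 0" if "odd k"
  proof -
    from that obtain l where "k = 2 * l + 1" by (rule oddE)
    then have l: "1 - of_nat k = - 2 * (of_nat l :: complex)" by simp
    have "?s - 0 = of_int (- int (p * l)) / of_nat k"
      unfolding l using k0 by (simp add: field_simps)
    then show ?thesis by (rule comm_coeff_cong)
  qed
  \<comment> \<open>For \<open>k = 2 l\<close> the two exponents differ by
    \<open>- p / 2 = - p l / k\<close>.\<close>
  have even: "comm_coeff k ?s = comm_coeff k (of_nat p / (2 * of_nat k))" if "even k"
  proof -
    from that obtain l where "k = 2 * l" by (rule evenE)
    then have "?s - of_nat p / (2 * of_nat k) = of_int (- int (p * l)) / of_nat k"
      using k0 by (simp add: field_simps)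
    then show ?thesis by (rule comm_coeff_cong)
  qed
  show ?thesis
    unfolding Let_def
  proof (intro conjI allI impI)
    fix w
    show "supercommutator sM (twisted_field YM (Delta sV Y \<omega> G a \<kappa> k) k) p q u v w =
       Res0 (fscale sM (root_delta k \<star> quot_pow ?s) (iterate02 (twisted_field YM (Delta sV Y \<omega> G a \<kappa> k) k) Y u v w))"
      by (rule res) (use supp delta_quot_comm_coeff[OF assms(3)] in auto)
    show "supercommutator sM (twisted_field YM (Delta sV Y \<omega> G a \<kappa> k) k) p q u v w =
       Res0 (fscale sM (root_delta k) (iterate02 (twisted_field YM (Delta sV Y \<omega> G a \<kappa> k) k) Y u v w))" if "odd k"
      by (rule res) (use supp0 root_delta_comm_coeff[OF assms(3)] odd[OF that] in auto)
    show "supercommutator sM (twisted_field YM (Delta sV Y \<omega> G a \<kappa> k) k) p q u v w =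
       Res0 (fscale sM (root_delta k \<star> quot_pow (of_nat p / (2 * of_nat k)))
         (iterate02 (twisted_field YM (Delta sV Y \<omega> G a \<kappa> k) k) Y u v w))" if "even k"
      by (rule res) (use supp delta_quot_comm_coeff[OF assms(3)] even[OF that] in auto)
  qed
qed

end
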